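(* Let $(M,g)$ be a Riemannian manifold with a smooth function $f$ and a constant $\lambda\ne 0$ such that $\mathrm{Ric}+\mathrm{Hess} f=\lambda g$. Each of the following conditions implies that the metric is radially flat and has constant scalar curvature: (1) The scalar curvature is constant and, if $\lambda>0$, $\mathrm{sec}(E,\nabla f)\ge 0$ for all $E$; if $\lambda<0$, $\mathrm{sec}(E,\nabla f)\le 0$ for all $E$. (2) The scalar curvature is constant and, if $\lambda>0$, $0\le\mathrm{Ric}\le\lambda g$; if $\lambda<0$, $\lambda g\le\mathrm{Ric}\le 0$. (3) The curvature tensor is harmonic. (4) $\mathrm{sec}(E,\nabla f)=0$ for all $E$ and, if $\lambda>0$, $\mathrm{Ric}\ge 0$; if $\lambda<0$, $\mathrm{Ric}\le 0$.
   Context: Manifolds are connected and all data are smooth. The soliton is shrinking if $\lambda>0$ and expanding if $\lambda<0$. Conditions on $\mathrm{sec}(E,\nabla f)$ mean the corresponding sign condition on $g(R(E,\nabla f)\nabla f,E)$ for all tangent vectors $E$ at every point. Radially flat means $\mathrm{sec}(E,\nabla f)=0$ for all $E$, i.e. $R(\cdot,\nabla f)\nabla f=0$. The curvature tensor is harmonic if $d^*R=0$ (the divergence of $R$ vanishes), equivalently if the Ricci tensor satisfies $(\nabla_X\mathrm{Ric})(Y,Z)=(\nabla_Y\mathrm{Ric})(X,Z)$ for all $X,Y,Z$. *)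

theory Defs
  imports "HOL-Analysis.Analysis"
begin

section \<open>Smooth functions on open subsets of Euclidean space\<close>

primrec Ck_on :: "nat \<Rightarrow> ('a::real_normed_vector \<Rightarrow> 'b::real_normed_vector) \<Rightarrow> 'a set \<Rightarrow> bool" where
  "Ck_on 0 f S \<longleftrightarrow> continuous_on S f"
| "Ck_on (Suc k) f S \<longleftrightarrow>
     (\<forall>x\<in>S. f differentiable (at x)) \<and> (\<forall>v. Ck_on k (\<lambda>x. frechet_derivative f (at x) v) S)"

text \<open>Derivatives are two-sided, so \<open>Ck_on\<close> and \<open>smooth_on\<close> are meant for open sets only.\<close>

definition smooth_on :: "('a::real_normed_vector \<Rightarrow> 'b::real_normed_vector) \<Rightarrow> 'a set \<Rightarrow> bool" where
  "smooth_on f S \<longleftrightarrow> (\<forall>k. Ck_on k f S)"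

section \<open>Smooth manifolds\<close>

text \<open>A chart is a domain together with its coordinate map; the map is irrelevant off the domain.\<close>

type_synonym ('a, 'n) chart = "'a set \<times> ('a \<Rightarrow> real ^ 'n)"

definition chart_image :: "('a, 'n::finite) chart \<Rightarrow> (real ^ 'n) set" where
  "chart_image c = snd c ` fst c"

definition chart_inv :: "('a, 'n::finite) chart \<Rightarrow> real ^ 'n \<Rightarrow> 'a" where
  "chart_inv c = inv_into (fst c) (snd c)"

definition is_chart :: "'a topology \<Rightarrow> ('a, 'n::finite) chart \<Rightarrow> bool" where
  "is_chart M c \<longleftrightarrow> openin M (fst c) \<and> open (chart_image c) \<and>
     homeomorphic_map (subtopology M (fst c)) (top_of_set (chart_image c)) (snd c)"

definition transition :: "('a, 'n::finite) chart \<Rightarrow> ('a, 'n) chart \<Rightarrow> real ^ 'n \<Rightarrow> real ^ 'n" where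
  "transition c d = snd d \<circ> chart_inv c"

definition smooth_manifold :: "'a topology \<Rightarrow> ('a, 'n::finite) chart set \<Rightarrow> bool" where
  "smooth_manifold M \<A> \<longleftrightarrow>
     Hausdorff_space M \<and> second_countable M \<and>
     (\<forall>c\<in>\<A>. is_chart M c) \<and> (\<Union>c\<in>\<A>. fst c) = topspace M \<and>
     (\<forall>c\<in>\<A>. \<forall>d\<in>\<A>. smooth_on (transition c d) (snd c ` (fst c \<inter> fst d)))"

definition smooth_function :: "('a, 'n::finite) chart set \<Rightarrow> ('a \<Rightarrow> real) \<Rightarrow> bool" where
  "smooth_function \<A> f \<longleftrightarrow> (\<forall>c\<in>\<A>. smooth_on (f \<circ> chart_inv c) (chart_image c))"

text \<open>
  A Riemannian metric is given by its component matrices: \<open>g c x\<close> is the Gram matrix of the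
  coordinate frame of the chart \<open>c\<close> at the point with coordinates \<open>x\<close>. The last conjunct is the
  transformation law of a covariant 2-tensor, which makes the components in different charts
  represent the same inner product on the tangent space.
\<close>

definition riemannian_metric ::
    "('a, 'n::finite) chart set \<Rightarrow> (('a, 'n) chart \<Rightarrow> real ^ 'n \<Rightarrow> real ^ 'n ^ 'n) \<Rightarrow> bool" where
  "riemannian_metric \<A> g \<longleftrightarrow>
     (\<forall>c\<in>\<A>. smooth_on (g c) (chart_image c) \<and>
        (\<forall>x\<in>chart_image c. transpose (g c x) = g c x \<and> (\<forall>v. v \<noteq> 0 \<longrightarrow> v \<bullet> (g c x *v v) > 0))) \<and>
     (\<forall>c\<in>\<A>. \<forall>d\<in>\<A>. \<forall>p\<in>fst c \<inter> fst d. \<forall>u v.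
        (let T = frechet_derivative (transition c d) (at (snd c p))
         in u \<bullet> (g c (snd c p) *v v) = T u \<bullet> (g d (snd d p) *v T v)))"

section \<open>Riemannian geometry in coordinates\<close>

text \<open>
  Throughout, \<open>G\<close> is the matrix field of the metric in a coordinate domain and \<open>F\<close> is a function
  of the coordinates. All the quantities below depend only on the germs of \<open>G\<close> and \<open>F\<close> at the
  point \<open>x\<close>. The last argument of each function is that point.
\<close>

definition partial :: "'n \<Rightarrow> (real ^ 'n::finite \<Rightarrow> real) \<Rightarrow> real ^ 'n \<Rightarrow> real" where
  "partial i h x = frechet_derivative h (at x) (axis i 1)"

text \<open>\<open>christoffel G k i j\<close> is \<open>\<Gamma>\<^sup>k\<^sub>i\<^sub>j\<close>, the \<open>k\<close>-th component of \<open>\<nabla>\<^sub>i \<partial>\<^sub>j\<close> for the Levi-Civita connection.\<close>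

definition christoffel ::
    "(real ^ 'n \<Rightarrow> real ^ 'n ^ 'n) \<Rightarrow> 'n \<Rightarrow> 'n \<Rightarrow> 'n \<Rightarrow> real ^ 'n::finite \<Rightarrow> real" where
  "christoffel G k i j x = (1 / 2) * (\<Sum>l\<in>UNIV. matrix_inv (G x) $ k $ l *
     (partial i (\<lambda>y. G y $ j $ l) x + partial j (\<lambda>y. G y $ i $ l) x
      - partial l (\<lambda>y. G y $ i $ j) x))"

text \<open>
  \<open>riem G l i j k\<close> is the \<open>l\<close>-th component of \<open>R(\<partial>\<^sub>i, \<partial>\<^sub>j)\<partial>\<^sub>k\<close>, where
  \<open>R(X,Y)Z = \<nabla>\<^sub>X\<nabla>\<^sub>YZ - \<nabla>\<^sub>Y\<nabla>\<^sub>XZ - \<nabla>\<^bsub>[X,Y]\<^esub>Z\<close>. With this sign \<open>g(R(E,N)N,E)\<close> and the Ricci tensor are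
  positive on round spheres.
\<close>

definition riem ::
    "(real ^ 'n \<Rightarrow> real ^ 'n ^ 'n) \<Rightarrow> 'n \<Rightarrow> 'n \<Rightarrow> 'n \<Rightarrow> 'n \<Rightarrow> real ^ 'n::finite \<Rightarrow> real" where
  "riem G l i j k x =
     partial i (christoffel G l j k) x - partial j (christoffel G l i k) x
     + (\<Sum>m\<in>UNIV. christoffel G l i m x * christoffel G m j k x
                 - christoffel G l j m x * christoffel G m i k x)"

definition curvature ::
    "(real ^ 'n \<Rightarrow> real ^ 'n ^ 'n) \<Rightarrow> real ^ 'n \<Rightarrow> real ^ 'n \<Rightarrow> real ^ 'n \<Rightarrow> real ^ 'n \<Rightarrow> real ^ 'n::finite"
  where
  "curvature G X Y Z x =
     (\<chi> l. \<Sum>i\<in>UNIV. \<Sum>j\<in>UNIV. \<Sum>k\<in>UNIV. riem G l i j k x * X $ i * Y $ j * Z $ k)"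

definition ricci :: "(real ^ 'n \<Rightarrow> real ^ 'n ^ 'n) \<Rightarrow> real ^ 'n \<Rightarrow> real ^ 'n ^ 'n::finite" where
  "ricci G x = (\<chi> j k. \<Sum>i\<in>UNIV. riem G i i j k x)"

definition scal :: "(real ^ 'n \<Rightarrow> real ^ 'n ^ 'n) \<Rightarrow> real ^ 'n::finite \<Rightarrow> real" where
  "scal G x = (\<Sum>j\<in>UNIV. \<Sum>k\<in>UNIV. matrix_inv (G x) $ j $ k * ricci G x $ j $ k)"

text \<open>\<open>cov_riem G m l i j k\<close> is the \<open>l\<close>-th component of \<open>(\<nabla>\<^sub>mR)(\<partial>\<^sub>i, \<partial>\<^sub>j)\<partial>\<^sub>k\<close>.\<close>

definition cov_riem ::
    "(real ^ 'n \<Rightarrow> real ^ 'n ^ 'n) \<Rightarrow> 'n \<Rightarrow> 'n \<Rightarrow> 'n \<Rightarrow> 'n \<Rightarrow> 'n \<Rightarrow> real ^ 'n::finite \<Rightarrow> real" where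
  "cov_riem G m l i j k x = partial m (riem G l i j k) x
     + (\<Sum>q\<in>UNIV. christoffel G l m q x * riem G q i j k x
                 - christoffel G q m i x * riem G l q j k x
                 - christoffel G q m j x * riem G l i q k x
                 - christoffel G q m k x * riem G l i j q x)"

text \<open>
  \<open>curvature_codiff G l j k\<close> is the \<open>l\<close>-th component of \<open>-\<Sum>\<^sub>a (\<nabla>\<^bsub>e\<^sub>a\<^esub>R)(e\<^sub>a, \<partial>\<^sub>j)\<partial>\<^sub>k\<close> for an orthonormal
  frame \<open>e\<^sub>a\<close>, that is, of \<open>d\<^sup>*R\<close>.
\<close>

definition curvature_codiff ::
    "(real ^ 'n \<Rightarrow> real ^ 'n ^ 'n) \<Rightarrow> 'n \<Rightarrow> 'n \<Rightarrow> 'n \<Rightarrow> real ^ 'n::finite \<Rightarrow> real" where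
  "curvature_codiff G l j k x =
     - (\<Sum>m\<in>UNIV. \<Sum>i\<in>UNIV. matrix_inv (G x) $ m $ i * cov_riem G m l i j k x)"

definition grad ::
    "(real ^ 'n \<Rightarrow> real ^ 'n ^ 'n) \<Rightarrow> (real ^ 'n \<Rightarrow> real) \<Rightarrow> real ^ 'n \<Rightarrow> real ^ 'n::finite" where
  "grad G F x = matrix_inv (G x) *v (\<chi> i. partial i F x)"

definition hess ::
    "(real ^ 'n \<Rightarrow> real ^ 'n ^ 'n) \<Rightarrow> (real ^ 'n \<Rightarrow> real) \<Rightarrow> real ^ 'n \<Rightarrow> real ^ 'n ^ 'n::finite" where
  "hess G F x =
     (\<chi> i j. partial i (partial j F) x - (\<Sum>k\<in>UNIV. christoffel G k i j x * partial k F x))"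

text \<open>\<open>g(R(E,\<nabla>F)\<nabla>F, E)\<close>, not normalised by the area of the parallelogram.\<close>

definition radial_sec ::
    "(real ^ 'n \<Rightarrow> real ^ 'n ^ 'n) \<Rightarrow> (real ^ 'n \<Rightarrow> real) \<Rightarrow> real ^ 'n \<Rightarrow> real ^ 'n \<Rightarrow> real" where
  "radial_sec G F E x = curvature G E (grad G F x) (grad G F x) x \<bullet> (G x *v (E :: real ^ 'n::finite))"

definition form_le :: "real ^ 'n ^ 'n \<Rightarrow> real ^ 'n ^ 'n::finite \<Rightarrow> bool" where
  "form_le A B \<longleftrightarrow> (\<forall>v. v \<bullet> (A *v v) \<le> v \<bullet> (B *v v))"

section \<open>Global notions\<close>

text \<open>
  A tensorial condition on a manifold is imposed in every chart of the atlas at every point of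
  its image; vectors of \<open>real ^ 'n\<close> are the components of tangent vectors in that chart.
\<close>

definition in_charts ::
    "('a, 'n::finite) chart set \<Rightarrow> (('a, 'n) chart \<Rightarrow> real ^ 'n \<Rightarrow> bool) \<Rightarrow> bool" where
  "in_charts \<A> P \<longleftrightarrow> (\<forall>c\<in>\<A>. \<forall>x\<in>chart_image c. P c x)"

definition gradient_ricci_soliton ::
    "('a, 'n::finite) chart set \<Rightarrow> (('a, 'n) chart \<Rightarrow> real ^ 'n \<Rightarrow> real ^ 'n ^ 'n) \<Rightarrow>
     ('a \<Rightarrow> real) \<Rightarrow> real \<Rightarrow> bool" where
  "gradient_ricci_soliton \<A> g f lam \<longleftrightarrow>
     in_charts \<A> (\<lambda>c x. ricci (g c) x + hess (g c) (f \<circ> chart_inv c) x = lam *\<^sub>R g c x)"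

definition constant_scalar_curvature ::
    "('a, 'n::finite) chart set \<Rightarrow> (('a, 'n) chart \<Rightarrow> real ^ 'n \<Rightarrow> real ^ 'n ^ 'n) \<Rightarrow> bool" where
  "constant_scalar_curvature \<A> g \<longleftrightarrow> (\<exists>s. in_charts \<A> (\<lambda>c x. scal (g c) x = s))"

definition harmonic_curvature ::
    "('a, 'n::finite) chart set \<Rightarrow> (('a, 'n) chart \<Rightarrow> real ^ 'n \<Rightarrow> real ^ 'n ^ 'n) \<Rightarrow> bool" where
  "harmonic_curvature \<A> g \<longleftrightarrow>
     in_charts \<A> (\<lambda>c x. \<forall>l j k. curvature_codiff (g c) l j k x = 0)"

definition radial_sec_nonneg ::
    "('a, 'n::finite) chart set \<Rightarrow> (('a, 'n) chart \<Rightarrow> real ^ 'n \<Rightarrow> real ^ 'n ^ 'n) \<Rightarrow>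
     ('a \<Rightarrow> real) \<Rightarrow> bool" where
  "radial_sec_nonneg \<A> g f \<longleftrightarrow>
     in_charts \<A> (\<lambda>c x. \<forall>E. radial_sec (g c) (f \<circ> chart_inv c) E x \<ge> 0)"

definition radial_sec_nonpos ::
    "('a, 'n::finite) chart set \<Rightarrow> (('a, 'n) chart \<Rightarrow> real ^ 'n \<Rightarrow> real ^ 'n ^ 'n) \<Rightarrow>
     ('a \<Rightarrow> real) \<Rightarrow> bool" where
  "radial_sec_nonpos \<A> g f \<longleftrightarrow>
     in_charts \<A> (\<lambda>c x. \<forall>E. radial_sec (g c) (f \<circ> chart_inv c) E x \<le> 0)"

definition radially_flat ::
    "('a, 'n::finite) chart set \<Rightarrow> (('a, 'n) chart \<Rightarrow> real ^ 'n \<Rightarrow> real ^ 'n ^ 'n) \<Rightarrow>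
     ('a \<Rightarrow> real) \<Rightarrow> bool" where
  "radially_flat \<A> g f \<longleftrightarrow>
     in_charts \<A> (\<lambda>c x. \<forall>E. radial_sec (g c) (f \<circ> chart_inv c) E x = 0)"

end

theory Submission
  imports Defs
begin

text \<open>
  Let \<open>\<rho>\<close> be the Ricci tensor as an endomorphism. By the soliton equation the Ricci identity for
  \<open>\<nabla>f\<close> reads \<open>R(X,Y)\<nabla>f = (\<nabla>\<^sub>Y\<rho>)X - (\<nabla>\<^sub>X\<rho>)Y\<close>. Tracing it and using the twice contracted second
  Bianchi identity gives \<open>d scal = 2 Ric(\<nabla>f)\<close>, so the scalar curvature is constant iff
  \<open>Ric(\<nabla>f) = 0\<close>. The trace of the radial curvature form is \<open>Ric(\<nabla>f,\<nabla>f)\<close>, and a semidefinite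
  form with vanishing trace vanishes: this settles (1) and (4). If \<open>d\<^sup>*R = 0\<close> then \<open>\<nabla>Ric\<close> is
  totally symmetric, so \<open>R(X,Y)\<nabla>f = 0\<close>, which gives (3).

  In case (2) the divergence of \<open>Ric(\<nabla>f) = 0\<close> is \<open>\<lambda> scal = |Ric|\<^sup>2\<close>, and the bounds turn this into
  \<open>\<rho>\<^sup>2 = \<lambda>\<rho>\<close>. The Laplacian of \<open>|Ric|\<^sup>2\<close> then shows that \<open>|\<nabla>\<rho>|\<^sup>2\<close> is twice the contraction of
  \<open>\<nabla>\<^sub>i\<rho>\<^sub>j\<^sub>k\<close> with \<open>\<nabla>\<^sub>j\<rho>\<^sub>i\<^sub>k\<close>. The difference of the two is the sum of the squared norms of the
  integrability tensors of \<open>ker \<rho>\<close> and \<open>im \<rho>\<close>, so \<open>(\<nabla>\<^sub>X\<rho>)Y = (\<nabla>\<^sub>Y\<rho>)X\<close> on \<open>ker \<rho>\<close>. For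
  \<open>Y = \<nabla>f\<close> the left side vanishes; therefore \<open>\<nabla>\<rho> = 0\<close> in the direction of \<open>\<nabla>f\<close>, and
  \<open>R(X,\<nabla>f)\<nabla>f = 0\<close>.

  The scalar curvature is compared in different charts through \<open>scal = n\<lambda> - \<Delta>f\<close>, which needs only
  the transformation law of the Hessian.
\<close>

section \<open>Calculus of smooth functions\<close>

text \<open>The difficulty in case (2) is that the bounds are pointwise conditions on the Ricci
  tensor, while radial flatness involves its first derivative. The bridge is that
  \<open>\<rho> / \<lambda>\<close> becomes a field of projections: the derivative of a projection
  interchanges kernel and image, so only mixed components of \<open>\<nabla>\<rho>\<close> survive,
  and exactly this makes its two contractions comparable. All identities are derived in a single
  coordinate domain, without smooth orthonormal or eigenvector frames. Connection and curvature are
  matrix-valued, with the form indices kept as labels, so that tensor identities become matrix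
  algebra. Where a sum of squares is needed, the inverse metric at one point is written as a sum of
  matrices \<open>w w^T\<close>. Such a tight frame serves as a substitute for an orthonormal basis
  and is available without diagonalising anything. Radial flatness is verified chart by chart. Only
  the constancy of the scalar curvature requires a comparison of charts, and there connectedness
  enters.\<close>

lemma Ck_on_cong:
  assumes "open S" "\<And>x. x \<in> S \<Longrightarrow> f x = h x" "Ck_on k f S"
  shows "Ck_on k h S"
  using assms(2,3)
proof (induction k arbitrary: f h)
  case 0
  then show ?case using continuous_on_cong[of S S f h] by auto
next
  case (Suc k)
  have d: "(f has_derivative frechet_derivative f (at x)) (at x)" if "x \<in> S" for x
    using Suc.prems that by (simp add: frechet_derivative_works)
  have d': "(h has_derivative frechet_derivative f (at x)) (at x)" if "x \<in> S" for x
    using has_derivative_transform_within_open[OF d[OF that] \<open>open S\<close> that] Suc.prems by auto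
  have eq: "frechet_derivative h (at x) = frechet_derivative f (at x)" if "x \<in> S" for x
    using frechet_derivative_at[OF d'[OF that]] by simp
  have "Ck_on k (\<lambda>x. frechet_derivative h (at x) v) S" for v
    by (rule Suc.IH[of "\<lambda>x. frechet_derivative f (at x) v"]) (use Suc.prems eq in auto)
  then show ?case using d' by (auto simp: differentiable_def)
qed

lemma Ck_on_SucD: "Ck_on (Suc k) f S \<Longrightarrow> Ck_on k f S"
proof (induction k arbitrary: f)
  case 0
  then show ?case
    by (auto intro!: continuous_at_imp_continuous_on differentiable_imp_continuous_within)
next
  case (Suc k)
  then show ?case by (metis Ck_on.simps(2))
qed

text \<open>The derivative may be given by any explicit formula, so each closure property below
  reduces to the usual differentiation rule and an induction on the order.\<close>

lemma Ck_on_SucI: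
  assumes "open S" "\<And>x. x \<in> S \<Longrightarrow> (f has_derivative f' x) (at x)"
    and "\<And>v. Ck_on k (\<lambda>x. f' x v) S"
  shows "Ck_on (Suc k) f S"
proof -
  have "Ck_on k (\<lambda>x. frechet_derivative f (at x) v) S" for v
    by (rule Ck_on_cong[OF assms(1) _ assms(3)[of v]]) (simp add: frechet_derivative_at[OF assms(2), symmetric])
  then show ?thesis using assms(2) by (auto simp: differentiable_def)
qed

lemma Ck_on_derivative:
  assumes "Ck_on (Suc k) f S" "x \<in> S"
  shows "(f has_derivative frechet_derivative f (at x)) (at x)"
  using assms by (simp add: frechet_derivative_works)

lemma Ck_on_const: "Ck_on k (\<lambda>x. c) S"
  by (induction k arbitrary: c) auto

lemma Ck_on_add:
  assumes "open S" "Ck_on k f S" "Ck_on k h S"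
  shows "Ck_on k (\<lambda>x. f x + h x) S"
  using assms(2,3)
proof (induction k arbitrary: f h)
  case 0
  then show ?case by (auto intro: continuous_intros)
next
  case (Suc k)
  show ?case
  proof (rule Ck_on_SucI[OF assms(1)])
    show "((\<lambda>x. f x + h x) has_derivative (\<lambda>v. frechet_derivative f (at x) v + frechet_derivative h (at x) v)) (at x)"
      if "x \<in> S" for x
      using that Suc.prems by (intro has_derivative_add Ck_on_derivative)
    show "Ck_on k (\<lambda>x. frechet_derivative f (at x) v + frechet_derivative h (at x) v) S" for v
      using Suc.prems by (intro Suc.IH) auto
  qed
qed

text \<open>The Leibniz rule pairs a derivative with an undifferentiated factor, so the induction
  has to vary both factors, and \<open>Ck_on_SucD\<close> lowers the order of the undifferentiated
  one. Scalar, matrix and matrix-vector products are all instances.\<close>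

lemma Ck_on_bilinear:
  assumes "bounded_bilinear b" "open S" "Ck_on k f S" "Ck_on k h S"
  shows "Ck_on k (\<lambda>x. b (f x) (h x)) S"
  using assms(3,4)
proof (induction k arbitrary: f h)
  case 0
  then show ?case by (auto intro: bounded_bilinear.continuous_on[OF assms(1)])
next
  case (Suc k)
  have "Ck_on k f S" "Ck_on k h S" using Suc.prems Ck_on_SucD by auto
  then show ?case using Suc.prems
    by (intro Ck_on_SucI[where f'="\<lambda>x v. b (f x) (frechet_derivative h (at x) v) + b (frechet_derivative f (at x) v) (h x)"]
        bounded_bilinear.FDERIV[OF assms(1)] assms(2) Ck_on_add Suc.IH Ck_on_derivative) auto
qed

lemma Ck_on_linear:
  assumes "bounded_linear l" "open S" "Ck_on k f S"
  shows "Ck_on k (\<lambda>x. l (f x)) S"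
  using assms(3)
proof (induction k arbitrary: f)
  case 0
  then show ?case by (auto intro: bounded_linear.continuous_on[OF assms(1)])
next
  case (Suc k)
  then show ?case
    by (intro Ck_on_SucI[where f'="\<lambda>x v. l (frechet_derivative f (at x) v)"]
        bounded_linear.has_derivative[OF assms(1)] assms(2) Suc.IH Ck_on_derivative) auto
qed

text \<open>The derivative of 1/f involves only 1/f and the derivative of f, so the induction
  hypothesis for the same f suffices.\<close>

lemma Ck_on_inverse:
  fixes f :: "'a::real_normed_vector \<Rightarrow> real"
  assumes "open S" "Ck_on k f S" "\<And>x. x \<in> S \<Longrightarrow> f x \<noteq> 0"
  shows "Ck_on k (\<lambda>x. inverse (f x)) S"
  using assms(2)
proof (induction k)
  case 0
  then show ?case using assms(3) by (auto intro!: continuous_intros)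
next
  case (Suc k)
  note IH = Suc.IH[OF Ck_on_SucD[OF Suc.prems]]
  have "Ck_on k (\<lambda>x. - (inverse (f x) * frechet_derivative f (at x) v * inverse (f x))) S" for v
    using Suc.prems IH
    by (intro Ck_on_linear[OF bounded_linear_minus[OF bounded_linear_ident] assms(1)]
          Ck_on_bilinear[OF bounded_bilinear_mult assms(1)]) auto
  then show ?case
    using assms(3) Ck_on_derivative[OF Suc.prems]
    by (intro Ck_on_SucI[where f'="\<lambda>x v. - (inverse (f x) * frechet_derivative f (at x) v * inverse (f x))"]
        assms(1) Deriv.has_derivative_inverse) auto
qed

lemma smooth_on_cong:
  "open S \<Longrightarrow> (\<And>x. x \<in> S \<Longrightarrow> f x = h x) \<Longrightarrow> smooth_on f S \<Longrightarrow> smooth_on h S"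
  unfolding smooth_on_def using Ck_on_cong by blast

lemma smooth_on_const: "smooth_on (\<lambda>x. c) S"
  by (simp add: smooth_on_def Ck_on_const)

lemma smooth_on_add:
  "open S \<Longrightarrow> smooth_on f S \<Longrightarrow> smooth_on h S \<Longrightarrow> smooth_on (\<lambda>x. f x + h x) S"
  by (simp add: smooth_on_def Ck_on_add)

lemma smooth_on_linear:
  "bounded_linear l \<Longrightarrow> open S \<Longrightarrow> smooth_on f S \<Longrightarrow> smooth_on (\<lambda>x. l (f x)) S"
  by (simp add: smooth_on_def Ck_on_linear)

lemma smooth_on_bilinear:
  "bounded_bilinear b \<Longrightarrow> open S \<Longrightarrow> smooth_on f S \<Longrightarrow> smooth_on h S \<Longrightarrow> smooth_on (\<lambda>x. b (f x) (h x)) S"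
  by (simp add: smooth_on_def Ck_on_bilinear)

lemma smooth_on_minus: "open S \<Longrightarrow> smooth_on f S \<Longrightarrow> smooth_on (\<lambda>x. - f x) S"
  by (rule smooth_on_linear[OF bounded_linear_minus[OF bounded_linear_ident]])

lemma smooth_on_diff:
  "open S \<Longrightarrow> smooth_on f S \<Longrightarrow> smooth_on h S \<Longrightarrow> smooth_on (\<lambda>x. f x - h x) S"
  using smooth_on_add[of S f "\<lambda>x. - h x"] smooth_on_minus[of S h] by simp

lemma smooth_on_sum:
  "open S \<Longrightarrow> (\<And>i. i \<in> I \<Longrightarrow> smooth_on (f i) S) \<Longrightarrow> smooth_on (\<lambda>x. \<Sum>i\<in>I. f i x) S"
  by (induction I rule: infinite_finite_induct) (auto intro: smooth_on_const smooth_on_add)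

lemma smooth_on_mult:
  fixes f h :: "'a::real_normed_vector \<Rightarrow> real"
  shows "open S \<Longrightarrow> smooth_on f S \<Longrightarrow> smooth_on h S \<Longrightarrow> smooth_on (\<lambda>x. f x * h x) S"
  by (rule smooth_on_bilinear[OF bounded_bilinear_mult])

lemma smooth_on_prod:
  fixes f :: "'i \<Rightarrow> 'a::real_normed_vector \<Rightarrow> real"
  shows "open S \<Longrightarrow> (\<And>i. i \<in> I \<Longrightarrow> smooth_on (f i) S) \<Longrightarrow> smooth_on (\<lambda>x. \<Prod>i\<in>I. f i x) S"
  by (induction I rule: infinite_finite_induct) (auto intro: smooth_on_const smooth_on_mult)

lemma smooth_on_divide:
  fixes f h :: "'a::real_normed_vector \<Rightarrow> real"
  shows "open S \<Longrightarrow> smooth_on f S \<Longrightarrow> smooth_on h S \<Longrightarrow> (\<And>x. x \<in> S \<Longrightarrow> h x \<noteq> 0) \<Longrightarrow>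
    smooth_on (\<lambda>x. f x / h x) S"
  unfolding divide_inverse
  by (rule smooth_on_mult) (simp_all add: smooth_on_def Ck_on_inverse)

lemma smooth_on_imp_differentiable: "smooth_on f S \<Longrightarrow> x \<in> S \<Longrightarrow> f differentiable (at x)"
  unfolding smooth_on_def by (metis Ck_on.simps(2))

lemma smooth_on_frechet_derivative:
  "smooth_on f S \<Longrightarrow> smooth_on (\<lambda>x. frechet_derivative f (at x) v) S"
  unfolding smooth_on_def by (metis Ck_on.simps(2))

lemma smooth_on_imp_continuous_on: "smooth_on f S \<Longrightarrow> continuous_on S f"
  unfolding smooth_on_def by (metis Ck_on.simps(1))

lemma bounded_bilinear_finite:
  fixes b :: "'a::euclidean_space \<Rightarrow> 'b::euclidean_space \<Rightarrow> 'c::euclidean_space"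
  assumes "\<And>x. linear (b x)" "\<And>y. linear (\<lambda>x. b x y)"
  shows "bounded_bilinear b"
  using assms by (simp add: bilinear_conv_bounded_bilinear[symmetric] bilinear_def)

lemma bounded_bilinear_matrix_mult:
  "bounded_bilinear ((**) :: real^'n^'m \<Rightarrow> real^'k^'n \<Rightarrow> real^'k^'m)"
  by (rule bounded_bilinear_finite; rule linearI)
    (vector matrix_matrix_mult_def sum.distrib algebra_simps sum_distrib_left)+

lemma bounded_bilinear_matrix_vector_mult:
  "bounded_bilinear ((*v) :: real^'n^'m \<Rightarrow> real^'n \<Rightarrow> real^'m)"
  by (rule bounded_bilinear_finite; rule linearI)
    (vector matrix_vector_mult_def sum.distrib algebra_simps sum_distrib_left)+

lemma bounded_linear_transpose: "bounded_linear (transpose :: real^'n^'m \<Rightarrow> real^'m^'n)"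
  by (rule linear_conv_bounded_linear[THEN iffD1], rule linearI) (vector transpose_def)+

lemma bounded_linear_trace: "bounded_linear (trace :: real^'n^'n \<Rightarrow> real)"
  by (rule linear_conv_bounded_linear[THEN iffD1], rule linearI)
    (auto simp: trace_def sum.distrib sum_distrib_left)

lemma vec_eq_sum_axis: "v = (\<Sum>i\<in>UNIV. (v $ i) *\<^sub>R axis i (1::real))" for v :: "real^'n"
  by (simp add: vec_eq_iff axis_def if_distrib [of "\<lambda>x. _ * x"] cong: if_cong)

lemma mat_eq_sum_axis: "M = (\<Sum>i\<in>UNIV. axis i (M $ i))" for M :: "real^'n^'m"
  by (simp add: vec_eq_iff axis_def sum.If_cases if_distrib[of "\<lambda>v. v $ _"] cong: if_cong)

lemma bounded_linear_axis: "bounded_linear (axis i :: real^'n \<Rightarrow> real^'n^'m)"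
  by (rule linear_conv_bounded_linear[THEN iffD1], rule linearI) (vector axis_def)+

lemma smooth_on_vec:
  fixes f :: "'a::real_normed_vector \<Rightarrow> real^'n"
  assumes "open S" "\<And>i. smooth_on (\<lambda>x. f x $ i) S"
  shows "smooth_on f S"
proof (rule smooth_on_cong[OF assms(1)])
  show "smooth_on (\<lambda>x. \<Sum>i\<in>UNIV. (f x $ i) *\<^sub>R axis i (1::real)) S"
    by (intro smooth_on_sum smooth_on_bilinear[OF bounded_bilinear_scaleR] assms smooth_on_const)
qed (simp flip: vec_eq_sum_axis)

lemma smooth_on_mat:
  fixes f :: "'a::real_normed_vector \<Rightarrow> real^'n^'m"
  assumes "open S" "\<And>i j. smooth_on (\<lambda>x. f x $ i $ j) S"
  shows "smooth_on f S"
proof (rule smooth_on_cong[OF assms(1)])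
  show "smooth_on (\<lambda>x. \<Sum>i\<in>UNIV. axis i (f x $ i)) S"
    by (intro smooth_on_sum smooth_on_linear[OF bounded_linear_axis] smooth_on_vec assms)
qed (simp flip: mat_eq_sum_axis)

section \<open>Partial derivatives of vector-valued and matrix-valued maps\<close>

definition pd :: "'n \<Rightarrow> (real^'n \<Rightarrow> 'b::real_normed_vector) \<Rightarrow> real^'n \<Rightarrow> 'b" where
  "pd i f x = frechet_derivative f (at x) (axis i 1)"

text \<open>On real functions nothing changes; the wider type of \<open>pd\<close> allows whole
  matrix fields to be differentiated without passing to entries.\<close>

lemma partial_eq_pd: "partial = pd"
  by (simp add: fun_eq_iff partial_def pd_def)

lemma has_derivative_pd: "(f has_derivative f') (at x) \<Longrightarrow> pd i f x = f' (axis i 1)"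
  by (simp add: pd_def frechet_derivative_at[symmetric])

lemma smooth_on_pd: "smooth_on f S \<Longrightarrow> smooth_on (pd i f) S"
  using smooth_on_frechet_derivative[of f S "axis i 1"] by (simp add: pd_def[abs_def])

lemma pd_cong:
  assumes "open S" "x \<in> S" "\<And>y. y \<in> S \<Longrightarrow> f y = h y"
  shows "pd i f x = pd i h x"
proof (cases "f differentiable (at x)")
  case True
  then show ?thesis
    by (simp add: pd_def frechet_derivative_transform_within_open[OF True assms])
next
  case False
  \<comment> \<open>\<open>frechet_derivative\<close> chooses among the derivatives at the point.
    The two maps have the same ones, so the chosen values agree even if there is none.\<close>
  have "(f has_derivative D) (at x) = (h has_derivative D) (at x)" for D
    using has_derivative_transform_within_open[OF _ assms(1,2)] assms(3) by metis
  then show ?thesis by (simp add: pd_def frechet_derivative_def)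
qed

lemma pd_const [simp]: "pd i (\<lambda>x. c) x = 0"
  by (simp add: pd_def)

context
  fixes x :: "real^'n"
begin

lemma pd_add: "f differentiable (at x) \<Longrightarrow> h differentiable (at x) \<Longrightarrow>
    pd i (\<lambda>y. f y + h y) x = pd i f x + pd i h x"
  unfolding frechet_derivative_works by (drule (1) has_derivative_add, drule has_derivative_pd) (simp add: pd_def)

lemma pd_diff: "f differentiable (at x) \<Longrightarrow> h differentiable (at x) \<Longrightarrow>
    pd i (\<lambda>y. f y - h y) x = pd i f x - pd i h x"
  unfolding frechet_derivative_works by (drule (1) has_derivative_diff, drule has_derivative_pd) (simp add: pd_def)

lemma pd_linear: "bounded_linear l \<Longrightarrow> f differentiable (at x) \<Longrightarrow> pd i (\<lambda>y. l (f y)) x = l (pd i f x)"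
  unfolding frechet_derivative_works
  by (drule (1) bounded_linear.has_derivative, drule has_derivative_pd) (simp add: pd_def)

lemma pd_minus: "f differentiable (at x) \<Longrightarrow> pd i (\<lambda>y. - f y) x = - pd i f x"
  by (rule pd_linear[OF bounded_linear_minus[OF bounded_linear_ident]])

lemma pd_bilinear: "bounded_bilinear b \<Longrightarrow> f differentiable (at x) \<Longrightarrow> h differentiable (at x) \<Longrightarrow>
    pd i (\<lambda>y. b (f y) (h y)) x = b (f x) (pd i h x) + b (pd i f x) (h x)"
  unfolding frechet_derivative_works
  by (drule (2) bounded_bilinear.FDERIV, drule has_derivative_pd) (simp add: pd_def)

lemma pd_sum: "(\<And>j. j \<in> I \<Longrightarrow> f j differentiable (at x)) \<Longrightarrow>
    pd i (\<lambda>y. \<Sum>j\<in>I. f j y) x = (\<Sum>j\<in>I. pd i (f j) x)"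
proof -
  assume "\<And>j. j \<in> I \<Longrightarrow> f j differentiable (at x)"
  then have "((\<lambda>y. \<Sum>j\<in>I. f j y) has_derivative (\<lambda>v. \<Sum>j\<in>I. frechet_derivative (f j) (at x) v)) (at x)"
    by (intro has_derivative_sum) (simp add: frechet_derivative_works)
  from has_derivative_pd[OF this] show ?thesis by (simp add: pd_def)
qed

lemmas pd_mult = pd_bilinear[OF bounded_bilinear_mult]
lemmas pd_mm = pd_bilinear[OF bounded_bilinear_matrix_mult]
lemmas pd_mv = pd_bilinear[OF bounded_bilinear_matrix_vector_mult]
lemmas pd_scaleR = pd_bilinear[OF bounded_bilinear_scaleR]
lemmas pd_transpose = pd_linear[OF bounded_linear_transpose]
lemmas pd_trace = pd_linear[OF bounded_linear_trace]
lemmas pd_nth = pd_linear[OF bounded_linear_vec_nth]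

lemma pd_nth2: "f differentiable (at x) \<Longrightarrow> pd i (\<lambda>y. f y $ a $ b) x = pd i f x $ a $ b"
  for f :: "real^'n \<Rightarrow> real^'m^'k"
  by (rule pd_linear[OF bounded_linear_compose[OF bounded_linear_vec_nth bounded_linear_vec_nth]])

end

lemma frechet_derivative_eq_sum_pd:
  fixes f :: "real^'n \<Rightarrow> 'b::real_normed_vector"
  assumes "f differentiable (at x)"
  shows "frechet_derivative f (at x) v = (\<Sum>i\<in>UNIV. v $ i *\<^sub>R pd i f x)"
proof -
  have "linear (frechet_derivative f (at x))" using assms by (rule linear_frechet_derivative)
  then show ?thesis
    by (subst vec_eq_sum_axis[of v]) (simp add: linear_sum linear_cmul pd_def)
qed

lemma pd_compose:
  fixes h :: "real^'m \<Rightarrow> 'b::real_normed_vector" and \<phi> :: "real^'n \<Rightarrow> real^'m"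
  assumes "\<phi> differentiable (at x)" "h differentiable (at (\<phi> x))"
  shows "pd i (\<lambda>y. h (\<phi> y)) x = (\<Sum>a\<in>UNIV. (pd i \<phi> x $ a) *\<^sub>R pd a h (\<phi> x))"
proof -
  have "((\<lambda>y. h (\<phi> y)) has_derivative (frechet_derivative h (at (\<phi> x)) \<circ> frechet_derivative \<phi> (at x))) (at x)"
    using diff_chain_at assms unfolding frechet_derivative_works comp_def by metis
  from has_derivative_pd[OF this] show ?thesis
    by (simp add: frechet_derivative_eq_sum_pd[OF assms(2)] flip: pd_def)
qed

section \<open>Symmetry of second partial derivatives\<close>

lemma has_real_derivative_along_axis:
  fixes f :: "real^'n \<Rightarrow> real"
  assumes "f differentiable (at (p + t *\<^sub>R axis i 1))"
  shows "((\<lambda>s. f (p + s *\<^sub>R axis i 1)) has_real_derivative pd i f (p + t *\<^sub>R axis i 1)) (at t)"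
proof -
  have *: "((\<lambda>s. p + s *\<^sub>R axis i (1::real)) has_derivative (\<lambda>s. s *\<^sub>R axis i 1)) (at t)"
    by (auto intro!: derivative_eq_intros)
  have "((\<lambda>s. f (p + s *\<^sub>R axis i 1)) has_derivative
      (\<lambda>s. frechet_derivative f (at (p + t *\<^sub>R axis i 1)) (s *\<^sub>R axis i 1))) (at t)"
    using diff_chain_at[OF *] assms unfolding frechet_derivative_works comp_def by metis
  moreover have "linear (frechet_derivative f (at (p + t *\<^sub>R axis i 1)))"
    using assms by (rule linear_frechet_derivative)
  ultimately show ?thesis
    by (simp add: has_field_derivative_def linear_cmul pd_def mult_commute_abs)
qed

text \<open>The mean value theorem is used twice: along axis \<open>i\<close> for the increment of
  \<open>f\<close> in direction \<open>j\<close>, then along axis \<open>j\<close> for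
  \<open>pd i f\<close>. The second difference is symmetric in \<open>i\<close> and \<open>j\<close>
  while the right side is not, which is what \<open>pd_commute_real\<close> exploits.\<close>

lemma second_difference:
  fixes f :: "real^'n \<Rightarrow> real"
  assumes f: "smooth_on f S" and ball: "ball x r \<subseteq> S" and s: "0 < s" "2 * s < r"
  obtains z where "dist z x \<le> 2 * s"
    "f (x + s *\<^sub>R axis i 1 + s *\<^sub>R axis j 1) - f (x + s *\<^sub>R axis i 1) - f (x + s *\<^sub>R axis j 1) + f x
      = s * (s * pd j (pd i f) z)"
proof -
  have norm: "dist (x + a *\<^sub>R axis i (1::real) + b *\<^sub>R axis j 1) x \<le> 2 * s"
    if "0 \<le> a" "a \<le> s" "0 \<le> b" "b \<le> s" for a b
    using that norm_triangle_ineq[of "a *\<^sub>R axis i (1::real)" "b *\<^sub>R axis j 1"]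
    by (simp add: dist_norm add.assoc norm_axis_1)
  then have inS: "x + a *\<^sub>R axis i (1::real) + b *\<^sub>R axis j 1 \<in> S"
    if "0 \<le> a" "a \<le> s" "0 \<le> b" "b \<le> s" for a b
    using that s ball by (force simp: dist_commute)
  define \<phi> where "\<phi> a = f (x + s *\<^sub>R axis j 1 + a *\<^sub>R axis i 1) - f (x + a *\<^sub>R axis i 1)" for a
  have "(\<phi> has_real_derivative (pd i f (x + s *\<^sub>R axis j 1 + a *\<^sub>R axis i 1) - pd i f (x + a *\<^sub>R axis i 1))) (at a)"
    if "0 \<le> a" "a \<le> s" for a
    unfolding \<phi>_def using inS[of a s] inS[of a 0] that s
    by (intro DERIV_diff has_real_derivative_along_axis smooth_on_imp_differentiable[OF f])
      (auto simp: add.assoc add.commute[of "s *\<^sub>R axis j 1"])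
  from MVT2[OF s(1) this] obtain a where a: "0 < a" "a < s"
    "\<phi> s - \<phi> 0 = (s - 0) * (pd i f (x + s *\<^sub>R axis j 1 + a *\<^sub>R axis i 1) - pd i f (x + a *\<^sub>R axis i 1))"
    by auto
  have "((\<lambda>b. pd i f (x + a *\<^sub>R axis i 1 + b *\<^sub>R axis j 1)) has_real_derivative
      pd j (pd i f) (x + a *\<^sub>R axis i 1 + b *\<^sub>R axis j 1)) (at b)" if "0 \<le> b" "b \<le> s" for b
    using inS[of a b] that a
    by (intro has_real_derivative_along_axis smooth_on_imp_differentiable[OF smooth_on_pd[OF f]]) auto
  from MVT2[OF s(1) this] obtain b where b: "0 < b" "b < s"
    "pd i f (x + a *\<^sub>R axis i 1 + s *\<^sub>R axis j 1) - pd i f (x + a *\<^sub>R axis i 1)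
      = s * pd j (pd i f) (x + a *\<^sub>R axis i 1 + b *\<^sub>R axis j 1)"
    by auto
  show ?thesis
  proof (rule that)
    show "dist (x + a *\<^sub>R axis i 1 + b *\<^sub>R axis j 1) x \<le> 2 * s" using norm a b by simp
    show "f (x + s *\<^sub>R axis i 1 + s *\<^sub>R axis j 1) - f (x + s *\<^sub>R axis i 1) - f (x + s *\<^sub>R axis j 1) + f x
      = s * (s * pd j (pd i f) (x + a *\<^sub>R axis i 1 + b *\<^sub>R axis j 1))"
      using a(3) b(3) by (simp add: \<phi>_def algebra_simps)
  qed
qed

lemma pd_commute_real:
  fixes f :: "real^'n \<Rightarrow> real"
  assumes "open S" "smooth_on f S" "x \<in> S"
  shows "pd i (pd j f) x = pd j (pd i f) x"
proof -
  obtain r where r: "r > 0" "ball x r \<subseteq> S" using assms openE by blast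
  \<comment> \<open>The summand 2 keeps \<open>2 * s n\<close> strictly below \<open>r\<close>
    already for n = 0.\<close>
  define s where "s n = r / (2 * (real n + 2))" for n
  have s0: "s \<longlonglongrightarrow> 0"
    unfolding s_def using LIMSEQ_ignore_initial_segment[OF lim_const_over_n[of "r / 2"], of 2]
    by (simp add: algebra_simps)
  have s: "0 < s n" "2 * s n < r" for n
    using r by (auto simp: s_def divide_simps algebra_simps add_pos_nonneg)
  have "\<exists>z w. dist z x \<le> 2 * s n \<and> dist w x \<le> 2 * s n \<and> pd j (pd i f) z = pd i (pd j f) w" for n
  proof -
    from second_difference[OF assms(2) r(2) s(1)[of n] s(2)[of n], of i j] s(1)[of n]
      second_difference[OF assms(2) r(2) s(1)[of n] s(2)[of n], of j i]
    obtain z w where "dist z x \<le> 2 * s n" "dist w x \<le> 2 * s n"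
      "s n * (s n * pd j (pd i f) z) = s n * (s n * pd i (pd j f) w)"
      by (smt (verit) add.commute add.left_commute)
    then show ?thesis using s(1)[of n] by auto
  qed
  then obtain z w where zw: "dist (z n) x \<le> 2 * s n" "dist (w n) x \<le> 2 * s n"
    "pd j (pd i f) (z n) = pd i (pd j f) (w n)" for n by metis
  have lim: "y \<longlonglongrightarrow> x" if "\<And>n. dist (y n) x \<le> 2 * s n" for y
  proof (rule metric_tendsto_imp_tendsto[OF tendsto_mult_right_zero[OF s0, of 2]])
    show "\<forall>\<^sub>F n in sequentially. dist (y n) x \<le> dist (2 * s n) 0"
      using that by (intro always_eventually allI) (simp add: abs_of_pos[OF s(1)] abs_mult)
  qed
  have cont: "isCont (pd a (pd b f)) x" for a b
    using smooth_on_imp_continuous_on[OF smooth_on_pd[OF smooth_on_pd[OF assms(2)]]] assms(1,3)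
    by (simp add: continuous_on_eq_continuous_at)
  have "(\<lambda>n. pd j (pd i f) (z n)) \<longlonglongrightarrow> pd j (pd i f) x"
    by (rule isCont_tendsto_compose[OF cont lim]) (rule zw)
  moreover have "(\<lambda>n. pd i (pd j f) (w n)) \<longlonglongrightarrow> pd i (pd j f) x"
    by (rule isCont_tendsto_compose[OF cont lim]) (rule zw)
  ultimately show ?thesis unfolding zw(3) by (rule LIMSEQ_unique[rotated])
qed

lemma pd_commute:
  fixes f :: "real^'n \<Rightarrow> 'b::euclidean_space"
  assumes "open S" "smooth_on f S" "x \<in> S"
  shows "pd i (pd j f) x = pd j (pd i f) x"
proof (rule euclidean_eqI)
  fix b :: 'b
  have inner: "pd k (\<lambda>y. h y \<bullet> b) y = pd k h y \<bullet> b" if "smooth_on h S" "y \<in> S" for k h y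
    using that by (intro pd_linear[OF bounded_linear_inner_left] smooth_on_imp_differentiable)
  have "pd k (pd l f) x \<bullet> b = pd k (pd l (\<lambda>y. f y \<bullet> b)) x" for k l
    using assms by (simp add: pd_cong[OF assms(1,3) inner] smooth_on_pd flip: inner)
  then show "pd i (pd j f) x \<bullet> b = pd j (pd i f) x \<bullet> b"
    using pd_commute_real[OF assms(1) smooth_on_linear[OF bounded_linear_inner_left assms(1,2)] assms(3)] by simp
qed

section \<open>Matrices\<close>

lemma vec_eqI: "(\<And>i. x $ i = y $ i) \<Longrightarrow> x = y" for x :: "'a^'n"
  by (simp add: vec_eq_iff)

lemma mat_eqI: "(\<And>i j. A $ i $ j = B $ i $ j) \<Longrightarrow> A = B" for A :: "'a^'n^'m"
  by (simp add: vec_eq_iff)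

lemma matrix_mult_nth: "(A ** B) $ i $ j = (\<Sum>k\<in>UNIV. A $ i $ k * B $ k $ j)"
  by (simp add: matrix_matrix_mult_def)

lemma matrix_diff_ldistrib: "A ** (B - C) = A ** B - A ** C" for A :: "real^'n^'m"
  by (vector matrix_matrix_mult_def sum_subtractf algebra_simps)

lemma matrix_add_rdistrib: "(A + B) ** C = A ** C + B ** C" for A :: "real^'n^'m"
  by (vector matrix_matrix_mult_def sum.distrib algebra_simps)

lemma matrix_diff_rdistrib: "(A - B) ** C = A ** C - B ** C" for A :: "real^'n^'m"
  by (vector matrix_matrix_mult_def sum_subtractf algebra_simps)

lemma matrix_minus_left: "(- A) ** B = - (A ** B)" for A :: "real^'n^'m"
  by (vector matrix_matrix_mult_def sum_negf)

lemma matrix_minus_right: "A ** (- B) = - (A ** B)" for A :: "real^'n^'m"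
  by (vector matrix_matrix_mult_def sum_negf)

lemma matrix_sum_left: "(\<Sum>i\<in>I. A i) ** B = (\<Sum>i\<in>I. A i ** B)" for B :: "real^'n^'m"
  by (induction I rule: infinite_finite_induct) (simp_all add: matrix_add_rdistrib)

lemma matrix_sum_right: "B ** (\<Sum>i\<in>I. A i) = (\<Sum>i\<in>I. B ** A i)" for B :: "real^'n^'m"
  by (induction I rule: infinite_finite_induct) (simp_all add: matrix_add_ldistrib)

lemma matrix_scaleR_left: "(c *\<^sub>R A) ** B = c *\<^sub>R (A ** B)" for A :: "real^'n^'m"
  by (vector matrix_matrix_mult_def sum_distrib_left algebra_simps)

lemma matrix_scaleR_right: "A ** (c *\<^sub>R B) = c *\<^sub>R (A ** B)" for A :: "real^'n^'m"
  by (vector matrix_matrix_mult_def sum_distrib_left algebra_simps)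

lemmas matrix_distribs = matrix_add_ldistrib matrix_add_rdistrib matrix_diff_ldistrib
  matrix_diff_rdistrib matrix_minus_left matrix_minus_right matrix_scaleR_left matrix_scaleR_right

lemma transpose_linear:
  "transpose (A + B) = transpose A + transpose B" "transpose (A - B) = transpose A - transpose B"
  "transpose (- A) = - transpose A" "transpose (c *\<^sub>R A) = c *\<^sub>R transpose A"
  for A B :: "real^'n^'m"
  by (simp_all add: vec_eq_iff transpose_def)

lemma matrix_vector_sum_left: "(\<Sum>i\<in>I. A i) *v v = (\<Sum>i\<in>I. A i *v v)" for v :: "real^'n"
  by (induction I rule: infinite_finite_induct) (simp_all add: matrix_vector_mult_add_rdistrib)

lemma matrix_vector_mult_minus: "(- A) *v v = - (A *v v)" for A :: "real^'n^'m"
  by (vector matrix_vector_mult_def sum_negf)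

lemma scaleR_mat1_vector: "(c *\<^sub>R mat 1) *v v = c *\<^sub>R v" for v :: "real^'n"
  by (simp flip: scaleR_matrix_vector_assoc)

lemma inner_transpose: "x \<bullet> (M *v y) = (transpose M *v x) \<bullet> y" for M :: "real^'n^'m"
  by (simp add: dot_lmul_matrix)

lemma inner_symmetric: "transpose M = M \<Longrightarrow> x \<bullet> (M *v y) = y \<bullet> (M *v x)" for M :: "real^'n^'n"
  by (metis inner_transpose inner_commute)

lemma inner_matrix_sum: "x \<bullet> (M *v y) = (\<Sum>i\<in>UNIV. \<Sum>j\<in>UNIV. x $ i * M $ i $ j * y $ j)"
  for M :: "real^'n^'m"
  by (simp add: inner_vec_def matrix_vector_mult_def sum_distrib_left mult.assoc)

section \<open>Positive semidefinite matrices\<close>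

lemma psd_cauchy_schwarz:
  fixes P :: "real^'n^'n"
  assumes sym: "transpose P = P" and psd: "\<And>v. 0 \<le> v \<bullet> (P *v v)"
  shows "(u \<bullet> (P *v v))\<^sup>2 \<le> (u \<bullet> (P *v u)) * (v \<bullet> (P *v v))"
proof -
  define a b c where "a = v \<bullet> (P *v v)" and "b = u \<bullet> (P *v v)" and "c = u \<bullet> (P *v u)"
  have quad: "0 \<le> c + 2 * t * b + t\<^sup>2 * a" for t
  proof -
    have "(u + t *\<^sub>R v) \<bullet> (P *v (u + t *\<^sub>R v)) = c + 2 * t * b + t\<^sup>2 * a"
      using inner_symmetric[OF sym, of v u]
      by (simp add: a_def b_def c_def inner_add_left inner_add_right matrix_vector_right_distrib
          matrix_vector_mult_scaleR power2_eq_square algebra_simps)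
    then show ?thesis using psd[of "u + t *\<^sub>R v"] by simp
  qed
  have a: "a \<ge> 0" using psd a_def by simp
  show ?thesis
  proof (cases "a = 0")
    case True
    \<comment> \<open>For nonzero b this t would give the remaining linear polynomial c + 2tb the
      value -1.\<close>
    then have "b = 0" using quad[of "- (c + 1) / (2 * b)"] by (cases "b = 0") (auto simp: field_simps)
    then show ?thesis using True by (simp add: a_def b_def c_def)
  next
    case False
    then have "0 \<le> c - b\<^sup>2 / a" using quad[of "- b / a"] by (simp add: power2_eq_square)
    then show ?thesis using False a by (simp add: field_simps a_def b_def c_def)
  qed
qed

text \<open>Cauchy-Schwarz against u = Pv bounds the fourth power of the length of Pv by
  zero.\<close>

lemma psd_kernel:
  fixes P :: "real^'n^'n"
  assumes "transpose P = P" "\<And>v. 0 \<le> v \<bullet> (P *v v)" "v \<bullet> (P *v v) = 0"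
  shows "P *v v = 0"
  using psd_cauchy_schwarz[OF assms(1,2), of "P *v v" v] assms(3) by simp

text \<open>A Cholesky-type elimination: each step splits off the square of one linear form.\<close>

lemma psd_sum_of_squares_aux:
  fixes P :: "real^'n^'n"
  assumes "transpose P = P" "\<And>v. 0 \<le> v \<bullet> (P *v v)"
  shows "\<exists>w::'n \<Rightarrow> real^'n. (\<forall>a b. P $ a $ b = (\<Sum>k\<in>UNIV. w k $ a * w k $ b)) \<and>
           (\<forall>i. P $ i $ i = 0 \<longrightarrow> w i = 0)"
  using assms
proof (induction "card {i. P $ i $ i \<noteq> 0}" arbitrary: P rule: less_induct)
  case less
  have diag: "axis i 1 \<bullet> (Q *v axis i 1) = Q $ i $ i" for Q :: "real^'n^'n" and i
    by (simp add: matrix_vector_mult_basis column_def inner_axis' )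
  show ?case
  proof (cases "\<exists>i. P $ i $ i \<noteq> 0")
    case False
    then have "P *v axis i 1 = 0" for i
      using False by (intro psd_kernel less.prems) (simp add: matrix_vector_mult_basis column_def inner_axis')
    then have "P = 0" by (simp add: vec_eq_iff matrix_vector_mult_basis column_def)
    then show ?thesis by (intro exI[of _ "\<lambda>_. 0"]) simp
  next
    case True
    then obtain i where i: "P $ i $ i \<noteq> 0" by blast
    define d where "d = P $ i $ i"
    have d: "d > 0" using less.prems(2)[of "axis i 1"] i by (simp only: diag d_def)
    \<comment> \<open>The Schur complement of the pivot: row and column \<open>i\<close> are
      cleared, and Cauchy-Schwarz against \<open>axis i 1\<close> keeps the rest
      semidefinite.\<close>
    define Q where "Q = (\<chi> a b. P $ a $ b - P $ a $ i * P $ b $ i / d)"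
    have symP: "P $ a $ b = P $ b $ a" for a b
      using arg_cong[OF less.prems(1), of "\<lambda>M. M $ b $ a"] by (simp add: transpose_def)
    have Qv: "v \<bullet> (Q *v v) = v \<bullet> (P *v v) - (v \<bullet> (P *v axis i 1))\<^sup>2 / d" for v
    proof -
      have "(v \<bullet> (P *v axis i 1))\<^sup>2 = (\<Sum>a\<in>UNIV. \<Sum>b\<in>UNIV. v $ a * (P $ a $ i * P $ b $ i) * v $ b)"
        by (simp add: matrix_vector_mult_basis column_def inner_vec_def power2_eq_square sum_product algebra_simps)
      then show ?thesis
        by (simp add: inner_matrix_sum Q_def algebra_simps sum_subtractf sum_divide_distrib)
    qed
    have Qpsd: "0 \<le> v \<bullet> (Q *v v)" for v
      using psd_cauchy_schwarz[OF less.prems, of v "axis i 1"] d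
      unfolding Qv diag d_def[symmetric] by (simp add: field_simps)
    have Qsym: "transpose Q = Q" by (simp add: vec_eq_iff Q_def transpose_def symP mult.commute)
    have Qii: "Q $ i $ i = 0" using d by (simp add: Q_def d_def)
    have Qjj: "Q $ j $ j = 0" if "P $ j $ j = 0" for j
    proof -
      have "Q $ j $ j \<le> 0" using that d by (simp add: Q_def)
      moreover have "Q $ j $ j \<ge> 0" using Qpsd[of "axis j 1"] by (simp only: diag)
      ultimately show ?thesis by simp
    qed
    have "card {j. Q $ j $ j \<noteq> 0} < card {j. P $ j $ j \<noteq> 0}"
      by (rule psubset_card_mono) (use i Qii Qjj in auto)
    from less.hyps[OF this Qsym Qpsd] obtain w :: "'n \<Rightarrow> real^'n" where
      w: "\<And>a b. Q $ a $ b = (\<Sum>k\<in>UNIV. w k $ a * w k $ b)" "\<And>j. Q $ j $ j = 0 \<Longrightarrow> w j = 0" by blast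
    \<comment> \<open>Slot \<open>i\<close> is free, because \<open>Q $ i $ i = 0\<close> forces
      \<open>w i = 0\<close>. This is why the statement also tracks vanishing diagonal entries, and
      why as many forms as indices are enough.\<close>
    define w' where "w' = w(i := (1 / sqrt d) *\<^sub>R column i P)"
    have "P $ a $ b = (\<Sum>k\<in>UNIV. w' k $ a * w' k $ b)" for a b
    proof -
      have "(\<Sum>k\<in>UNIV. w' k $ a * w' k $ b) = w' i $ a * w' i $ b + (\<Sum>k\<in>UNIV - {i}. w k $ a * w k $ b)"
        by (subst sum.remove[of UNIV i]) (auto simp: w'_def intro!: sum.cong)
      also have "(\<Sum>k\<in>UNIV - {i}. w k $ a * w k $ b) = Q $ a $ b"
        unfolding w(1) by (rule sum.mono_neutral_left) (auto simp: w(2)[OF Qii])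
      finally show ?thesis using d by (simp add: Q_def w'_def column_def)
    qed
    moreover have "w' j = 0" if "P $ j $ j = 0" for j
      using that w(2) Qjj i by (auto simp: w'_def)
    ultimately show ?thesis by blast
  qed
qed

lemma psd_sum_of_squares:
  fixes P :: "real^'n^'n"
  assumes "transpose P = P" "\<And>v. 0 \<le> v \<bullet> (P *v v)"
  obtains w :: "'n \<Rightarrow> real^'n" where "\<And>a b. P $ a $ b = (\<Sum>k\<in>UNIV. w k $ a * w k $ b)"
  using psd_sum_of_squares_aux[OF assms] by blast

text \<open>The diagonal entries of \<open>C ** Z ** transpose C\<close> are the sums over
  \<open>k\<close> of the squared entries of \<open>C *v w k\<close>, and this matrix is
  zero.\<close>

lemma sum_of_squares_kernel:
  fixes w :: "'i::finite \<Rightarrow> real^'n" and C Z :: "real^'n^'n"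
  assumes "\<And>a b. Z $ a $ b = (\<Sum>k\<in>UNIV. w k $ a * w k $ b)" "C ** Z = 0"
  shows "C *v w k = 0"
proof (rule vec_eqI)
  fix a
  have "(\<Sum>k\<in>UNIV. ((C *v w k) $ a)\<^sup>2) = (\<Sum>k\<in>UNIV. \<Sum>b\<in>UNIV. (\<Sum>c\<in>UNIV. C $ a $ c * (w k $ c * w k $ b)) * C $ a $ b)"
    by (simp add: power2_eq_square matrix_vector_mult_def sum_product sum_distrib_right sum_distrib_left mult_ac)
  also have "\<dots> = (\<Sum>b\<in>UNIV. \<Sum>k\<in>UNIV. (\<Sum>c\<in>UNIV. C $ a $ c * (w k $ c * w k $ b)) * C $ a $ b)"
    by (rule sum.swap)
  also have "\<dots> = (\<Sum>b\<in>UNIV. (C ** Z) $ a $ b * C $ a $ b)"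
  proof (rule sum.cong[OF refl])
    fix b
    have "(\<Sum>k\<in>UNIV. \<Sum>c\<in>UNIV. C $ a $ c * (w k $ c * w k $ b)) = (C ** Z) $ a $ b"
      unfolding matrix_mult_nth assms(1) sum_distrib_left by (rule sum.swap)
    then show "(\<Sum>k\<in>UNIV. (\<Sum>c\<in>UNIV. C $ a $ c * (w k $ c * w k $ b)) * C $ a $ b) = (C ** Z) $ a $ b * C $ a $ b"
      by (simp flip: sum_distrib_right)
  qed
  finally have "(\<Sum>k\<in>UNIV. ((C *v w k) $ a)\<^sup>2) = 0" by (simp add: assms(2))
  then show "(C *v w k) $ a = 0 $ a" by (simp add: sum_nonneg_eq_0_iff)
qed

lemma posdef_invertible:
  fixes P :: "real^'n^'n"
  assumes "\<And>v. v \<noteq> 0 \<Longrightarrow> 0 < v \<bullet> (P *v v)"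
  shows "invertible P"
proof -
  have "v = 0" if "P *v v = 0" for v using assms[of v] that by (cases "v = 0") auto
  then show ?thesis
    by (simp add: invertible_left_inverse matrix_left_invertible_ker)
qed

lemma matrix_inv_inverse:
  assumes "invertible (P :: real^'n^'n)"
  shows "P ** matrix_inv P = mat 1" "matrix_inv P ** P = mat 1"
  using someI_ex[OF assms[unfolded invertible_def]] by (auto simp: matrix_inv_def)

text \<open>With q a sum of matrices \<open>w w^T\<close>, the trace is a sum of nonnegative numbers
  \<open>w \<bullet> (D *v w)\<close>, so all of them vanish. Then the symmetrisation
  \<open>S\<close> kills every \<open>w\<close>, hence \<open>S ** q = 0\<close>. The conclusion
  speaks of the quadratic form only, because a skew part of \<open>D\<close> is invisible to
  positivity and to the trace alike.\<close>

lemma psd_trace_zero: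
  fixes q D :: "real^'n^'n"
  assumes q: "transpose q = q" "\<And>v. v \<noteq> 0 \<Longrightarrow> 0 < v \<bullet> (q *v v)"
    and D: "\<And>v. 0 \<le> v \<bullet> (D *v v)" and tr: "trace (q ** D) = 0"
  shows "v \<bullet> (D *v v) = 0"
proof -
  have "0 \<le> v \<bullet> (q *v v)" for v using q(2)[of v] by (cases "v = 0") auto
  then obtain w :: "'n \<Rightarrow> real^'n" where w: "\<And>a b. q $ a $ b = (\<Sum>k\<in>UNIV. w k $ a * w k $ b)"
    using psd_sum_of_squares q(1) by blast
  have "trace (q ** D) = (\<Sum>a\<in>UNIV. \<Sum>b\<in>UNIV. \<Sum>k\<in>UNIV. w k $ a * w k $ b * D $ b $ a)"
    by (simp add: trace_def matrix_matrix_mult_def w sum_distrib_right)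
  also have "\<dots> = (\<Sum>a\<in>UNIV. \<Sum>k\<in>UNIV. \<Sum>b\<in>UNIV. w k $ a * w k $ b * D $ b $ a)"
    by (rule sum.cong[OF refl], rule sum.swap)
  also have "\<dots> = (\<Sum>k\<in>UNIV. \<Sum>a\<in>UNIV. \<Sum>b\<in>UNIV. w k $ a * w k $ b * D $ b $ a)"
    by (rule sum.swap)
  also have "\<dots> = (\<Sum>k\<in>UNIV. w k \<bullet> (D *v w k))"
    by (rule sum.cong[OF refl], subst sum.swap) (simp add: inner_matrix_sum algebra_simps)
  finally have "(\<Sum>k\<in>UNIV. w k \<bullet> (D *v w k)) = 0" using tr by simp
  then have wD: "w k \<bullet> (D *v w k) = 0" for k
    using D by (simp add: sum_nonneg_eq_0_iff)
  define S where "S = D + transpose D"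
  have Sv: "v \<bullet> (S *v v) = 2 * (v \<bullet> (D *v v))" for v
    using inner_transpose[of v D v]
    by (simp add: S_def matrix_vector_mult_add_rdistrib inner_add_right inner_commute)
  have "transpose S = S" by (simp add: S_def vec_eq_iff transpose_def)
  then have Sw: "S *v w k = 0" for k by (rule psd_kernel) (simp_all add: Sv D wD)
  have "S ** q = 0"
  proof -
    have "(S ** q) $ a $ b = (\<Sum>c\<in>UNIV. \<Sum>k\<in>UNIV. S $ a $ c * (w k $ c * w k $ b))" for a b
      by (simp add: matrix_matrix_mult_def w sum_distrib_left)
    also have "\<dots> a b = (\<Sum>k\<in>UNIV. (S *v w k) $ a * w k $ b)" for a b
      by (subst sum.swap) (simp add: matrix_vector_mult_def sum_distrib_left mult_ac)
    finally show ?thesis by (simp add: vec_eq_iff Sw)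
  qed
  then have "S ** (q ** matrix_inv q) = 0" by (simp add: matrix_mul_assoc)
  then have "S = 0" using matrix_inv_inverse(1)[OF posdef_invertible[OF q(2)]] by simp
  then show ?thesis using Sv[of v] by simp
qed

section \<open>Smooth dependence of determinant and inverse\<close>

lemma smooth_on_det:
  fixes A :: "'a::real_normed_vector \<Rightarrow> real^'n^'n"
  assumes "open S" "\<And>i j. smooth_on (\<lambda>x. A x $ i $ j) S"
  shows "smooth_on (\<lambda>x. det (A x)) S"
  unfolding det_def using assms
  by (intro smooth_on_sum smooth_on_mult smooth_on_prod smooth_on_const) auto

text \<open>By Cramer's rule each entry of the inverse is a quotient of determinants, hence rational
  in the entries of the matrix.\<close>

lemma smooth_on_matrix_inv:
  fixes A :: "'a::real_normed_vector \<Rightarrow> real^'n^'n"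
  assumes S: "open S" and A: "smooth_on A S" and inv: "\<And>x. x \<in> S \<Longrightarrow> invertible (A x)"
  shows "smooth_on (\<lambda>x. matrix_inv (A x)) S"
proof (rule smooth_on_mat[OF S])
  fix k j
  have A': "smooth_on (\<lambda>x. A x $ i $ l) S" for i l
    by (intro smooth_on_linear[OF bounded_linear_vec_nth S] A)
  define C where "C x = (\<chi> i l. if l = k then axis j 1 $ i else A x $ i $ l)" for x
  have "smooth_on (\<lambda>x. C x $ i $ l) S" for i l
    by (cases "l = k") (simp_all add: C_def A' smooth_on_const)
  then have "smooth_on (\<lambda>x. det (C x) / det (A x)) S"
    using A' inv by (intro smooth_on_divide S smooth_on_det) (auto simp: invertible_det_nz)
  then show "smooth_on (\<lambda>x. matrix_inv (A x) $ k $ j) S"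
  proof (rule smooth_on_cong[OF S, rotated])
    fix x assume x: "x \<in> S"
    have "A x *v (matrix_inv (A x) *v axis j 1) = axis j 1"
      by (simp only: matrix_vector_mul_assoc matrix_inv_inverse(1)[OF inv[OF x]] matrix_vector_mul_lid)
    then have "matrix_inv (A x) *v axis j 1 =
        (\<chi> k. det (\<chi> i l. if l = k then axis j 1 $ i else A x $ i $ l) / det (A x))"
      using cramer inv[OF x] invertible_det_nz by blast
    from arg_cong[OF this, of "\<lambda>v. v $ k"]
    show "det (C x) / det (A x) = matrix_inv (A x) $ k $ j" by (simp add: C_def matrix_vector_mult_basis column_def)
  qed
qed

section \<open>The Levi-Civita connection in a coordinate domain\<close>

text \<open>The octahedron argument: four cyclic identities, one for each index left out of the
  cycle, combined with the antisymmetries. It is stated for bare index functions because it is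
  needed for \<open>\<nabla>R\<close> in a fixed direction of differentiation.\<close>

lemma curvature_pair_symmetry:
  fixes R :: "'i \<Rightarrow> 'i \<Rightarrow> 'i \<Rightarrow> 'i \<Rightarrow> real"
  assumes "\<And>i j k l. R j i k l = - R i j k l" "\<And>i j k l. R i j l k = - R i j k l"
    and "\<And>i j k l. R i j k l + R j k i l + R k i j l = 0"
  shows "R i j k l = R k l i j"
  using assms(3)[of i j k l] assms(3)[of j k l i] assms(3)[of k l i j] assms(3)[of l i j k]
    assms(2)[of j k i l] assms(2)[of k l i j] assms(2)[of l i j k] assms(2)[of i k j l]
    assms(1)[of i k j l] assms(2)[of i j k l] assms(2)[of j l k i] assms(1)[of j l k i]
  by linarith

locale chart_metric =
  fixes U :: "(real^'n::finite) set" and g :: "real^'n \<Rightarrow> real^'n^'n"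
  assumes open_U: "open U"
    and smooth_g: "smooth_on g U"
    and sym_g: "\<And>x. x \<in> U \<Longrightarrow> transpose (g x) = g x"
    and pos_g: "\<And>x v. x \<in> U \<Longrightarrow> v \<noteq> 0 \<Longrightarrow> 0 < v \<bullet> (g x *v v)"
begin

abbreviation q :: "real^'n \<Rightarrow> real^'n^'n" where "q x \<equiv> matrix_inv (g x)"

text \<open>Connection and curvature are endomorphism-valued forms: form indices are arguments, and
  the two others are matrix positions, so that products of Christoffel symbols become matrix
  products.\<close>

definition \<Gamma> :: "'n \<Rightarrow> real^'n \<Rightarrow> real^'n^'n" where
  "\<Gamma> i x = (\<chi> l k. christoffel g l i k x)"

definition Rm :: "'n \<Rightarrow> 'n \<Rightarrow> real^'n \<Rightarrow> real^'n^'n" where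
  "Rm i j x = (\<chi> l k. riem g l i j k x)"

text \<open>Covariant derivative of a section of the endomorphism bundle; further indices of \<open>M\<close> are
  treated as labels.\<close>

definition D :: "'n \<Rightarrow> (real^'n \<Rightarrow> real^'n^'n) \<Rightarrow> real^'n \<Rightarrow> real^'n^'n" where
  "D m M x = pd m M x + \<Gamma> m x ** M x - M x ** \<Gamma> m x"

lemma smooth_imp_diff: "smooth_on f U \<Longrightarrow> x \<in> U \<Longrightarrow> f differentiable (at x)"
  by (rule smooth_on_imp_differentiable)

lemmas smooth_mm = smooth_on_bilinear[OF bounded_bilinear_matrix_mult open_U]
lemmas smooth_mv = smooth_on_bilinear[OF bounded_bilinear_matrix_vector_mult open_U]
lemmas smooth_transpose = smooth_on_linear[OF bounded_linear_transpose open_U]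
lemmas smooth_simps = smooth_mm smooth_mv smooth_transpose smooth_on_const
  smooth_on_add[OF open_U] smooth_on_diff[OF open_U] smooth_on_minus[OF open_U] smooth_on_pd
  smooth_on_mult[OF open_U] smooth_on_bilinear[OF bounded_bilinear_scaleR open_U]
  smooth_on_linear[OF bounded_linear_vec_nth open_U] smooth_on_sum[OF open_U]
  smooth_on_linear[OF bounded_linear_trace open_U]

lemmas pdU = pd_add pd_diff pd_minus pd_mm pd_mv pd_mult pd_scaleR pd_transpose pd_sum

lemmas pd_U_cong = pd_cong[OF open_U]

lemma invertible_g: "x \<in> U \<Longrightarrow> invertible (g x)"
  using posdef_invertible pos_g by blast

lemma q_g: "x \<in> U \<Longrightarrow> q x ** g x = mat 1" and g_q: "x \<in> U \<Longrightarrow> g x ** q x = mat 1"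
  using matrix_inv_inverse[OF invertible_g] by auto

lemma smooth_q: "smooth_on q U"
  by (rule smooth_on_matrix_inv[OF open_U smooth_g invertible_g])

lemma sym_q: "x \<in> U \<Longrightarrow> transpose (q x) = q x"
proof -
  assume x: "x \<in> U"
  have "transpose (q x) = transpose (q x) ** (g x ** q x)" by (simp add: g_q x)
  also have "\<dots> = transpose (g x ** q x) ** q x"
    by (simp add: matrix_transpose_mul sym_g x matrix_mul_assoc)
  finally show ?thesis by (simp add: g_q x)
qed

lemma pos_q: "x \<in> U \<Longrightarrow> v \<noteq> 0 \<Longrightarrow> 0 < v \<bullet> (q x *v v)"
proof -
  assume x: "x \<in> U" and v: "v \<noteq> 0"
  have v': "v = g x *v (q x *v v)" by (simp add: matrix_vector_mul_assoc g_q x)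
  then have "q x *v v \<noteq> 0" using v by auto
  from pos_g[OF x this] show ?thesis using v' by (simp add: inner_commute)
qed

lemma sym_g_nth: "x \<in> U \<Longrightarrow> g x $ i $ j = g x $ j $ i"
  using arg_cong[OF sym_g, of x "\<lambda>M. M $ j $ i"] by (simp add: transpose_def)

lemma sym_q_nth: "x \<in> U \<Longrightarrow> q x $ i $ j = q x $ j $ i"
  using arg_cong[OF sym_q, of x "\<lambda>M. M $ j $ i"] by (simp add: transpose_def)

lemma pd_sym_g: "x \<in> U \<Longrightarrow> pd i g x $ a $ b = pd i g x $ b $ a"
proof -
  assume x: "x \<in> U"
  have "pd i g x = pd i (\<lambda>y. transpose (g y)) x" by (rule pd_U_cong[OF x]) (simp add: sym_g)
  also have "\<dots> = transpose (pd i g x)" by (rule pd_transpose[OF smooth_imp_diff[OF smooth_g x]])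
  finally have "pd i g x = transpose (pd i g x)" .
  from arg_cong[OF this, of "\<lambda>M. M $ a $ b"] show ?thesis by (simp add: transpose_def)
qed

lemma christoffel_pd: "x \<in> U \<Longrightarrow> christoffel g k i j x = (\<Sum>l\<in>UNIV. q x $ k $ l *
    ((pd i g x $ j $ l + pd j g x $ i $ l - pd l g x $ i $ j) / 2))"
  unfolding christoffel_def partial_eq_pd
  by (simp add: pd_nth2 smooth_imp_diff[OF smooth_g] sum_distrib_left field_simps)

lemma \<Gamma>_sym: "x \<in> U \<Longrightarrow> \<Gamma> i x $ l $ k = \<Gamma> k x $ l $ i"
  by (simp add: \<Gamma>_def christoffel_pd pd_sym_g[of x _ i k] add.commute)

lemma smooth_\<Gamma>: "smooth_on (\<Gamma> i) U"
proof (rule smooth_on_mat[OF open_U])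
  fix l k
  have "smooth_on (\<lambda>x. \<Sum>m\<in>UNIV. q x $ l $ m *
      ((pd i g x $ k $ m + pd k g x $ i $ m - pd m g x $ i $ k) * (1/2))) U"
    by (intro smooth_on_sum smooth_simps open_U smooth_q smooth_g)
  then show "smooth_on (\<lambda>x. \<Gamma> i x $ l $ k) U"
    by (rule smooth_on_cong[OF open_U, rotated]) (simp add: \<Gamma>_def christoffel_pd)
qed

lemma g_\<Gamma>: "x \<in> U \<Longrightarrow> (g x ** \<Gamma> i x) $ m $ k = (pd i g x $ k $ m + pd k g x $ i $ m - pd m g x $ i $ k) / 2"
proof -
  assume x: "x \<in> U"
  define v where "v = (\<chi> l. (pd i g x $ k $ l + pd k g x $ i $ l - pd l g x $ i $ k) / 2)"
  have "(g x ** \<Gamma> i x) $ m $ k = (g x *v (q x *v v)) $ m"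
    by (simp add: matrix_mult_nth matrix_vector_mult_def v_def \<Gamma>_def christoffel_pd x)
  then show ?thesis by (simp add: matrix_vector_mul_assoc g_q x) (simp add: v_def)
qed

lemma pd_g: "x \<in> U \<Longrightarrow> pd i g x = transpose (\<Gamma> i x) ** g x + g x ** \<Gamma> i x"
proof (rule mat_eqI)
  fix a b assume x: "x \<in> U"
  have "transpose (\<Gamma> i x) ** g x = transpose (g x ** \<Gamma> i x)"
    by (simp add: matrix_transpose_mul sym_g x)
  then have "(transpose (\<Gamma> i x) ** g x) $ a $ b = (g x ** \<Gamma> i x) $ b $ a"
    by (simp add: transpose_def)
  then show "pd i g x $ a $ b = (transpose (\<Gamma> i x) ** g x + g x ** \<Gamma> i x) $ a $ b"
    using pd_sym_g[OF x] by (simp add: g_\<Gamma> x field_simps)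
qed

text \<open>Symmetry and metric compatibility determine \<open>g ** L i\<close> by the Koszul
  formula \<open>g_\<Gamma>\<close>. In the change of charts this spares transforming the formula
  for the Christoffel symbols directly.\<close>

lemma \<Gamma>_unique:
  assumes x: "x \<in> U"
    and sym: "\<And>i k l. L i $ l $ k = L k $ l $ i"
    and met: "\<And>i. pd i g x = transpose (L i) ** g x + g x ** L i"
  shows "\<Gamma> i x = L i"
proof -
  have sym': "(g x ** L i) $ m $ k = (g x ** L k) $ m $ i" for i k m
    by (simp add: matrix_mult_nth sym[of i _ k])
  have "transpose (L i) ** g x = transpose (g x ** L i)" for i
    by (simp add: matrix_transpose_mul sym_g x)
  then have met': "pd i g x $ a $ b = (g x ** L i) $ b $ a + (g x ** L i) $ a $ b" for i a b
    by (simp add: met transpose_def)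
  have "g x ** \<Gamma> i x = g x ** L i"
  proof (rule mat_eqI)
    fix m k
    show "(g x ** \<Gamma> i x) $ m $ k = (g x ** L i) $ m $ k"
      unfolding g_\<Gamma>[OF x] met' using sym'[of i m k] sym'[of i k m] sym'[of k i m] by (simp add: field_simps)
  qed
  then have "q x ** (g x ** \<Gamma> i x) = q x ** (g x ** L i)" by simp
  then show ?thesis by (simp add: matrix_mul_assoc q_g x)
qed

text \<open>The inverse metric is parallel as well: differentiate \<open>q ** g = mat 1\<close> and
  insert \<open>pd_g\<close>.\<close>

lemma pd_q: "x \<in> U \<Longrightarrow> pd i q x = - (\<Gamma> i x ** q x) - q x ** transpose (\<Gamma> i x)"
proof -
  assume x: "x \<in> U"
  have "pd i (\<lambda>y. q y ** g y) x = pd i (\<lambda>y. mat 1) x" by (rule pd_U_cong[OF x]) (simp add: q_g)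
  then have "q x ** pd i g x + pd i q x ** g x = 0"
    by (simp add: pd_mm smooth_imp_diff smooth_q smooth_g x)
  then have "(q x ** pd i g x + pd i q x ** g x) ** q x = 0" by simp
  then have "q x ** pd i g x ** q x + pd i q x = 0"
    by (simp add: matrix_add_rdistrib) (simp add: g_q x flip: matrix_mul_assoc)
  moreover have "q x ** pd i g x ** q x = q x ** transpose (\<Gamma> i x) ** (g x ** q x) + (q x ** g x) ** \<Gamma> i x ** q x"
    by (simp add: pd_g x matrix_distribs matrix_mul_assoc)
  ultimately show ?thesis by (simp add: g_q q_g x algebra_simps eq_neg_iff_add_eq_0)
qed

text \<open>Cartan's structure equation, from which all symmetries of the curvature are
  derived.\<close>

lemma Rm_eq: "x \<in> U \<Longrightarrow> Rm i j x = pd i (\<Gamma> j) x - pd j (\<Gamma> i) x + \<Gamma> i x ** \<Gamma> j x - \<Gamma> j x ** \<Gamma> i x"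
proof (rule mat_eqI)
  fix l k assume x: "x \<in> U"
  have "partial a (christoffel g l b k) x = pd a (\<Gamma> b) x $ l $ k" for a b
    using pd_nth2[OF smooth_imp_diff[OF smooth_\<Gamma> x], of a b l k]
    by (simp add: partial_eq_pd \<Gamma>_def)
  then show "Rm i j x $ l $ k =
      (pd i (\<Gamma> j) x - pd j (\<Gamma> i) x + \<Gamma> i x ** \<Gamma> j x - \<Gamma> j x ** \<Gamma> i x) $ l $ k"
    by (simp add: Rm_def riem_def matrix_mult_nth sum_subtractf) (simp add: \<Gamma>_def)
qed

lemma smooth_Rm: "smooth_on (Rm i j) U"
  by (rule smooth_on_cong[OF open_U Rm_eq[symmetric]]) (simp_all add: smooth_simps smooth_\<Gamma>)

lemma smooth_D: "smooth_on M U \<Longrightarrow> smooth_on (D m M) U"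
  by (simp add: D_def[abs_def] smooth_simps smooth_\<Gamma>)

section \<open>Symmetries of the curvature tensor\<close>

lemma Rm_antisym: "x \<in> U \<Longrightarrow> Rm j i x = - Rm i j x"
  by (simp add: Rm_eq)

text \<open>Torsion-freeness: \<open>\<Gamma>\<close> and its partial derivatives are symmetric in
  the lower indices, so the terms of the cyclic sum cancel in pairs.\<close>

lemma Rm_bianchi1: "x \<in> U \<Longrightarrow> Rm i j x $ l $ k + Rm j k x $ l $ i + Rm k i x $ l $ j = 0"
proof -
  assume x: "x \<in> U"
  have "pd a (\<Gamma> b) x $ l $ c = pd a (\<Gamma> c) x $ l $ b" for a b c
  proof -
    have "pd a (\<lambda>y. \<Gamma> b y $ l $ c) x = pd a (\<lambda>y. \<Gamma> c y $ l $ b) x"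
      by (rule pd_U_cong[OF x]) (rule \<Gamma>_sym)
    then show ?thesis by (simp add: pd_nth2 smooth_imp_diff[OF smooth_\<Gamma> x])
  qed
  moreover have "(\<Gamma> a x ** \<Gamma> b x) $ l $ c = (\<Gamma> a x ** \<Gamma> c x) $ l $ b" for a b c
    by (simp add: matrix_mult_nth \<Gamma>_sym[OF x, of b _ c])
  ultimately show ?thesis
    by (simp add: Rm_eq x)
qed

definition skew_at :: "real^'n \<Rightarrow> real^'n^'n \<Rightarrow> bool" where
  "skew_at x M \<longleftrightarrow> transpose M ** g x + g x ** M = 0"

text \<open>Curvature annihilates the metric. This is the commutation of second partial derivatives
  of \<open>g\<close>, once first derivatives are expressed through \<open>pd_g\<close>.\<close>

lemma skew_Rm: "x \<in> U \<Longrightarrow> skew_at x (Rm i j x)"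
proof -
  assume x: "x \<in> U"
  have pdpd: "pd a (pd b g) x = transpose (pd a (\<Gamma> b) x) ** g x + transpose (\<Gamma> b x) ** pd a g x
      + pd a g x ** \<Gamma> b x + g x ** pd a (\<Gamma> b) x" for a b
  proof -
    have "pd a (pd b g) x = pd a (\<lambda>y. transpose (\<Gamma> b y) ** g y + g y ** \<Gamma> b y) x"
      by (rule pd_U_cong[OF x]) (rule pd_g)
    then show ?thesis
      by (simp add: pdU smooth_imp_diff smooth_simps smooth_\<Gamma> smooth_g x algebra_simps)
  qed
  show ?thesis
    using pd_commute[OF open_U smooth_g x, of i j]
    unfolding pdpd pd_g[OF x] skew_at_def Rm_eq[OF x]
    by (simp add: matrix_distribs transpose_linear matrix_transpose_mul matrix_mul_assoc algebra_simps)
qed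

lemma skew_at_trace: "x \<in> U \<Longrightarrow> skew_at x M \<Longrightarrow> trace M = 0"
proof -
  assume x: "x \<in> U" and "skew_at x M"
  then have "transpose M ** g x = - (g x ** M)" by (simp add: skew_at_def eq_neg_iff_add_eq_0)
  then have "trace (transpose M ** g x ** q x) = - trace (g x ** M ** q x)"
    by (simp add: matrix_minus_left trace_def sum_negf)
  moreover have "trace (transpose M ** g x ** q x) = trace M"
    by (simp add: g_q x flip: matrix_mul_assoc) (simp add: trace_def transpose_def)
  moreover have "trace (g x ** M ** q x) = trace (q x ** g x ** M)"
    by (simp add: matrix_mul_assoc trace_mul_sym[of _ "q x"])
  ultimately show ?thesis by (simp add: q_g x)
qed

lemma skew_at_raise: "x \<in> U \<Longrightarrow> skew_at x M \<Longrightarrow> (M ** q x) $ a $ b = - (M ** q x) $ b $ a"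
proof -
  assume x: "x \<in> U" and "skew_at x M"
  then have "q x ** (transpose M ** g x + g x ** M) ** q x = 0" by (simp add: skew_at_def)
  moreover have "q x ** (transpose M ** g x + g x ** M) ** q x
      = q x ** transpose M ** (g x ** q x) + (q x ** g x) ** M ** q x"
    by (simp add: matrix_distribs matrix_mul_assoc)
  moreover have "q x ** transpose M = transpose (M ** q x)"
    by (simp add: matrix_transpose_mul sym_q x)
  ultimately have "transpose (M ** q x) + M ** q x = 0" by (simp add: q_g g_q x)
  from arg_cong[OF this, of "\<lambda>A. A $ a $ b"] show ?thesis by (simp add: transpose_def)
qed

lemma skew_at_D:
  assumes x: "x \<in> U" and M: "smooth_on M U" "\<And>y. y \<in> U \<Longrightarrow> skew_at y (M y)"
  shows "skew_at x (D m M x)"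
proof -
  have "pd m (\<lambda>y. transpose (M y) ** g y + g y ** M y) x = pd m (\<lambda>y. 0) x"
    by (rule pd_U_cong[OF x]) (use M in \<open>simp add: skew_at_def\<close>)
  then have *: "transpose (pd m M x) ** g x + transpose (M x) ** pd m g x + pd m g x ** M x + g x ** pd m M x = 0"
    by (simp add: pdU smooth_imp_diff smooth_simps M smooth_g x algebra_simps)
  have T: "transpose (M x) ** g x = - (g x ** M x)"
    using M(2)[OF x] by (simp add: skew_at_def eq_neg_iff_add_eq_0)
  have 1: "transpose (M x) ** g x ** \<Gamma> m x = - (g x ** M x ** \<Gamma> m x)"
    using T by (simp add: matrix_distribs)
  have 2: "transpose (\<Gamma> m x) ** transpose (M x) ** g x = - (transpose (\<Gamma> m x) ** g x ** M x)"
    using T by (simp add: matrix_distribs flip: matrix_mul_assoc)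
  show ?thesis
    using * unfolding skew_at_def D_def pd_g[OF x]
    by (simp add: matrix_distribs transpose_linear matrix_transpose_mul matrix_mul_assoc 1 2 algebra_simps)
qed

section \<open>The covariant derivative as a derivation; Ricci identity and second Bianchi
  identity\<close>

lemma D_mult:
  assumes "x \<in> U" "smooth_on M U" "smooth_on N U"
  shows "D m (\<lambda>y. M y ** N y) x = D m M x ** N x + M x ** D m N x"
  using assms unfolding D_def
  by (simp add: pd_mm smooth_imp_diff matrix_distribs matrix_mul_assoc algebra_simps)

lemma D_cong: "x \<in> U \<Longrightarrow> (\<And>y. y \<in> U \<Longrightarrow> M y = N y) \<Longrightarrow> D m M x = D m N x"
  unfolding D_def using pd_U_cong[of x M N m] by simp

lemma trace_D: "x \<in> U \<Longrightarrow> smooth_on M U \<Longrightarrow> trace (D m M x) = pd m (\<lambda>y. trace (M y)) x"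
  unfolding D_def by (simp add: trace_add trace_sub trace_mul_sym[of "\<Gamma> m x"] pd_trace smooth_imp_diff)

text \<open>Because \<open>D\<close> ignores labels, no correction for \<open>i\<close> and
  \<open>j\<close> appears, and the curvature acts on an endomorphism as a commutator.\<close>

lemma D_commute:
  assumes x: "x \<in> U" and M: "smooth_on M U"
  shows "D i (D j M) x - D j (D i M) x = Rm i j x ** M x - M x ** Rm i j x"
proof -
  have DD: "D a (D b M) x = pd a (pd b M) x + pd a (\<Gamma> b) x ** M x + \<Gamma> b x ** pd a M x
      - pd a M x ** \<Gamma> b x - M x ** pd a (\<Gamma> b) x
      + \<Gamma> a x ** (pd b M x + \<Gamma> b x ** M x - M x ** \<Gamma> b x)
      - (pd b M x + \<Gamma> b x ** M x - M x ** \<Gamma> b x) ** \<Gamma> a x" for a b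
    unfolding D_def[abs_def]
    by (simp add: pdU smooth_imp_diff smooth_simps M smooth_\<Gamma> x algebra_simps)
  show ?thesis
    unfolding DD using pd_commute[OF open_U M x, of i j] by (simp add: Rm_eq x matrix_distribs matrix_mul_assoc algebra_simps)
qed

text \<open>The exterior covariant derivative of the curvature form vanishes. Label corrections may
  be omitted here: in the cyclic sum they cancel by the symmetry of \<open>\<Gamma>\<close>, which
  is how \<open>nR_bianchi2\<close> follows.\<close>

lemma Rm_bianchi2_labels:
  assumes x: "x \<in> U"
  shows "D m (Rm i j) x + D i (Rm j m) x + D j (Rm m i) x = 0"
proof -
  have pd_Rm: "pd a (Rm b c) x = pd a (pd b (\<Gamma> c)) x - pd a (pd c (\<Gamma> b)) x
      + pd a (\<Gamma> b) x ** \<Gamma> c x + \<Gamma> b x ** pd a (\<Gamma> c) x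
      - pd a (\<Gamma> c) x ** \<Gamma> b x - \<Gamma> c x ** pd a (\<Gamma> b) x" for a b c
    by (subst pd_U_cong[OF x Rm_eq])
      (simp_all add: pdU smooth_imp_diff smooth_simps smooth_\<Gamma> x algebra_simps)
  show ?thesis unfolding D_def pd_Rm
    using pd_commute[OF open_U smooth_\<Gamma> x, of m i j] pd_commute[OF open_U smooth_\<Gamma> x, of m j i]
      pd_commute[OF open_U smooth_\<Gamma> x, of i j m]
    by (simp add: Rm_eq x matrix_distribs matrix_mul_assoc algebra_simps)
qed

text \<open>The full covariant derivative \<open>\<nabla>\<^sub>mR\<^sub>i\<^sub>j\<close> corrects the label indices of \<open>D\<close>.\<close>

definition nR :: "'n \<Rightarrow> 'n \<Rightarrow> 'n \<Rightarrow> real^'n \<Rightarrow> real^'n^'n" where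
  "nR m i j x = D m (Rm i j) x - (\<Sum>p\<in>UNIV. \<Gamma> m x $ p $ i *\<^sub>R Rm p j x) - (\<Sum>p\<in>UNIV. \<Gamma> m x $ p $ j *\<^sub>R Rm i p x)"

lemma nR_nth: "x \<in> U \<Longrightarrow> nR m i j x $ l $ k = cov_riem g m l i j k x"
proof -
  assume x: "x \<in> U"
  have "partial m (riem g l i j k) x = pd m (Rm i j) x $ l $ k"
    using pd_nth2[OF smooth_imp_diff[OF smooth_Rm x], of m i j l k]
    by (simp add: partial_eq_pd Rm_def)
  then show ?thesis
    by (simp add: nR_def D_def cov_riem_def matrix_mult_nth sum_subtractf sum.distrib)
      (simp add: \<Gamma>_def Rm_def algebra_simps)
qed

lemma nR_antisym: "x \<in> U \<Longrightarrow> nR m j i x = - nR m i j x"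
proof -
  assume x: "x \<in> U"
  have "pd m (Rm j i) x = pd m (\<lambda>y. - Rm i j y) x" by (rule pd_U_cong[OF x]) (rule Rm_antisym)
  then have "D m (Rm j i) x = - D m (Rm i j) x"
    using x by (simp add: D_def pd_minus smooth_imp_diff smooth_Rm Rm_antisym[of x j i] matrix_distribs)
  then show ?thesis
    by (simp add: nR_def Rm_antisym[OF x, of _ i] Rm_antisym[OF x, of j] sum_negf)
qed

lemma nR_bianchi2: "x \<in> U \<Longrightarrow> nR m i j x + nR i j m x + nR j m i x = 0"
proof -
  assume x: "x \<in> U"
  show ?thesis
    using Rm_bianchi2_labels[OF x, of m i j]
    by (simp add: nR_def Rm_antisym[OF x, of _ m] Rm_antisym[OF x, of _ i] Rm_antisym[OF x, of _ j]
        \<Gamma>_sym[OF x, of m _ i] \<Gamma>_sym[OF x, of j _ i] \<Gamma>_sym[OF x, of m _ j] sum_negf algebra_simps)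
qed

lemma skew_nR: "x \<in> U \<Longrightarrow> skew_at x (nR m i j x)"
proof -
  assume x: "x \<in> U"
  have lin: "skew_at x (A - B)" if "skew_at x A" "skew_at x B" for A B
  proof -
    have "transpose (A - B) ** g x + g x ** (A - B)
        = (transpose A ** g x + g x ** A) - (transpose B ** g x + g x ** B)"
      by (simp add: matrix_distribs transpose_linear algebra_simps)
    then show ?thesis using that by (simp add: skew_at_def)
  qed
  have add: "skew_at x (A + B)" if "skew_at x A" "skew_at x B" for A B
  proof -
    have "transpose (A + B) ** g x + g x ** (A + B)
        = (transpose A ** g x + g x ** A) + (transpose B ** g x + g x ** B)"
      by (simp add: matrix_distribs transpose_linear algebra_simps)
    then show ?thesis using that by (simp add: skew_at_def)
  qed
  have scale: "skew_at x (c *\<^sub>R A)" if "skew_at x A" for A c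
    using that by (simp add: skew_at_def matrix_distribs transpose_linear flip: scaleR_add_right)
  have zero: "skew_at x 0" by (simp add: skew_at_def vec_eq_iff transpose_def matrix_matrix_mult_def)
  have sum: "skew_at x (\<Sum>p\<in>I. A p)" if "\<And>p. skew_at x (A p)" for A and I :: "'n set"
    by (induction I rule: infinite_finite_induct) (simp_all add: zero add that)
  show ?thesis unfolding nR_def
    by (intro lin sum scale skew_Rm skew_at_D smooth_Rm x)
qed

text \<open>The first Bianchi identity permutes labels with a matrix index, but \<open>D\<close>
  corrects only the latter. The right side is the resulting defect; the label corrections in
  \<open>nR\<close> cancel it in \<open>nR_bianchi1\<close>.\<close>

lemma D_bianchi1: "x \<in> U \<Longrightarrow> D m (Rm i j) x $ l $ k + D m (Rm j k) x $ l $ i + D m (Rm k i) x $ l $ j =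
   - (\<Sum>p\<in>UNIV. Rm i j x $ l $ p * \<Gamma> m x $ p $ k + Rm j k x $ l $ p * \<Gamma> m x $ p $ i + Rm k i x $ l $ p * \<Gamma> m x $ p $ j)"
proof -
  assume x: "x \<in> U"
  have "pd m (\<lambda>y. Rm i j y $ l $ k + Rm j k y $ l $ i + Rm k i y $ l $ j) x = pd m (\<lambda>y. 0) x"
    by (rule pd_U_cong[OF x]) (rule Rm_bianchi1)
  then have 1: "pd m (Rm i j) x $ l $ k + pd m (Rm j k) x $ l $ i + pd m (Rm k i) x $ l $ j = 0"
    by (simp add: pd_add pd_nth2 smooth_imp_diff smooth_simps smooth_Rm x)
  have "(\<Gamma> m x ** Rm i j x) $ l $ k + (\<Gamma> m x ** Rm j k x) $ l $ i + (\<Gamma> m x ** Rm k i x) $ l $ j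
      = (\<Sum>p\<in>UNIV. \<Gamma> m x $ l $ p * (Rm i j x $ p $ k + Rm j k x $ p $ i + Rm k i x $ p $ j))"
    by (simp add: matrix_mult_nth sum.distrib algebra_simps)
  then show ?thesis using 1 by (simp add: D_def Rm_bianchi1 x matrix_mult_nth sum.distrib)
qed

lemma nR_bianchi1: "x \<in> U \<Longrightarrow> nR m i j x $ l $ k + nR m j k x $ l $ i + nR m k i x $ l $ j = 0"
proof -
  assume x: "x \<in> U"
  have B: "Rm i j x $ l $ p = - Rm j p x $ l $ i - Rm p i x $ l $ j" for i j p
    using Rm_bianchi1[OF x, of i j l p] by simp
  show ?thesis
    using D_bianchi1[OF x, of m i j l k]
    by (simp add: nR_def B[of i j] B[of j k] B[of k i] sum.distrib sum_subtractf sum_negf algebra_simps)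
qed

lemma skew_at_lower: "skew_at x M \<Longrightarrow> x \<in> U \<Longrightarrow> (g x ** M) $ l $ k = - (g x ** M) $ k $ l"
proof -
  assume "skew_at x M" and x: "x \<in> U"
  then have "transpose (g x ** M) + g x ** M = 0"
    by (simp add: skew_at_def matrix_transpose_mul sym_g)
  from arg_cong[OF this, of "\<lambda>A. A $ l $ k"] show ?thesis by (simp add: transpose_def)
qed

lemma pair_symmetry:
  assumes x: "x \<in> U" and anti: "\<And>i j. T j i = - T i j" and skew: "\<And>i j. skew_at x (T i j)"
    and b1: "\<And>i j k l. T i j $ l $ k + T j k $ l $ i + T k i $ l $ j = 0"
  shows "(g x ** T i j) $ l $ k = (g x ** T k l) $ j $ i"
proof (rule curvature_pair_symmetry[of "\<lambda>i j k l. (g x ** T i j) $ l $ k"])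
  show "(g x ** T j i) $ l $ k = - (g x ** T i j) $ l $ k" for i j k l
    by (simp add: anti[of j i] matrix_distribs)
  show "(g x ** T i j) $ k $ l = - (g x ** T i j) $ l $ k" for i j k l
    by (rule skew_at_lower[OF skew x])
  show "(g x ** T i j) $ l $ k + (g x ** T j k) $ l $ i + (g x ** T k i) $ l $ j = 0" for i j k l
  proof -
    have "(g x ** T i j) $ l $ k + (g x ** T j k) $ l $ i + (g x ** T k i) $ l $ j
      = (\<Sum>p\<in>UNIV. g x $ l $ p * (T i j $ p $ k + T j k $ p $ i + T k i $ p $ j))"
      by (simp add: matrix_mult_nth sum.distrib algebra_simps)
    then show ?thesis by (simp add: b1)
  qed
qed

lemmas nR_pair_symmetry = pair_symmetry[OF _ nR_antisym skew_nR nR_bianchi1]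

end

section \<open>Ricci curvature and the contracted Bianchi identities\<close>

context chart_metric
begin

abbreviation ric :: "real^'n \<Rightarrow> real^'n^'n" where "ric \<equiv> ricci g"

definition \<rho> :: "real^'n \<Rightarrow> real^'n^'n" where "\<rho> x = q x ** ric x"

definition nric :: "'n \<Rightarrow> real^'n \<Rightarrow> real^'n^'n" where
  "nric m x = pd m ric x - transpose (\<Gamma> m x) ** ric x - ric x ** \<Gamma> m x"

abbreviation B :: "'n \<Rightarrow> real^'n \<Rightarrow> real^'n^'n" where "B i \<equiv> D i \<rho>"

lemma ric_nth: "ric x $ j $ k = (\<Sum>i\<in>UNIV. Rm i j x $ i $ k)"
  by (simp add: ricci_def Rm_def)

lemma smooth_ric: "smooth_on ric U"
proof (rule smooth_on_mat[OF open_U])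
  show "smooth_on (\<lambda>x. ric x $ j $ k) U" for j k
    unfolding ric_nth by (intro smooth_simps smooth_Rm)
qed

lemma smooth_\<rho>: "smooth_on \<rho> U"
  unfolding \<rho>_def[abs_def] by (intro smooth_simps smooth_ric smooth_q)

lemma smooth_B: "smooth_on (B i) U"
  by (rule smooth_D[OF smooth_\<rho>])

lemma sym_ric_nth: "x \<in> U \<Longrightarrow> ric x $ j $ k = ric x $ k $ j"
proof -
  assume x: "x \<in> U"
  have "(\<Sum>i\<in>UNIV. Rm i j x $ i $ k + Rm j k x $ i $ i + Rm k i x $ i $ j) = 0"
    by (simp add: Rm_bianchi1 x)
  moreover have "(\<Sum>i\<in>UNIV. Rm j k x $ i $ i) = 0"
    using skew_at_trace[OF x skew_Rm[OF x]] by (simp add: trace_def)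
  moreover have "Rm k i x $ i $ j = - Rm i k x $ i $ j" for i
    by (simp add: Rm_antisym[OF x, of k i])
  ultimately show ?thesis by (simp add: ric_nth sum.distrib sum_subtractf)
qed

lemma sym_ric: "x \<in> U \<Longrightarrow> transpose (ric x) = ric x"
  by (simp add: vec_eq_iff transpose_def sym_ric_nth)

lemma g_\<rho>: "x \<in> U \<Longrightarrow> g x ** \<rho> x = ric x"
  by (simp add: \<rho>_def matrix_mul_assoc g_q)

lemma pd_ric_nth: "x \<in> U \<Longrightarrow> pd m ric x $ j $ k = (\<Sum>i\<in>UNIV. pd m (Rm i j) x $ i $ k)"
proof -
  assume x: "x \<in> U"
  have "pd m ric x $ j $ k = pd m (\<lambda>y. ric y $ j $ k) x"
    by (rule pd_nth2[OF smooth_imp_diff[OF smooth_ric x], symmetric])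
  also have "\<dots> = (\<Sum>i\<in>UNIV. pd m (\<lambda>y. Rm i j y $ i $ k) x)"
    unfolding ric_nth by (intro pd_sum smooth_imp_diff x smooth_simps smooth_Rm)
  finally show ?thesis by (simp add: pd_nth2 smooth_imp_diff smooth_Rm x)
qed

text \<open>Contraction commutes with covariant differentiation: under the sum, the correction of
  the label \<open>i\<close> in \<open>nR\<close> cancels the left multiplication by
  \<open>\<Gamma> m\<close> in \<open>D\<close>.\<close>

lemma nric_eq_sum: "x \<in> U \<Longrightarrow> (\<Sum>i\<in>UNIV. nR m i j x $ i $ k) = nric m x $ j $ k"
proof -
  assume x: "x \<in> U"
  have 1: "(\<Sum>i\<in>UNIV. \<Sum>p\<in>UNIV. \<Gamma> m x $ i $ p * Rm i j x $ p $ k)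
      = (\<Sum>i\<in>UNIV. \<Sum>p\<in>UNIV. \<Gamma> m x $ p $ i * Rm p j x $ i $ k)" for j k
    by (rule sum.swap)
  have 2: "(\<Sum>i\<in>UNIV. (Rm i j x ** \<Gamma> m x) $ i $ k) = (ric x ** \<Gamma> m x) $ j $ k"
    unfolding matrix_mult_nth ric_nth sum_distrib_right by (rule sum.swap)
  have 3: "(\<Sum>i\<in>UNIV. \<Sum>p\<in>UNIV. \<Gamma> m x $ p $ j * Rm i p x $ i $ k) = (transpose (\<Gamma> m x) ** ric x) $ j $ k"
    unfolding matrix_mult_nth ric_nth sum_distrib_left transpose_def by (subst sum.swap) simp
  have "(\<Sum>i\<in>UNIV. (\<Gamma> m x ** Rm i j x) $ i $ k) = (\<Sum>i\<in>UNIV. \<Sum>p\<in>UNIV. \<Gamma> m x $ p $ i * Rm p j x $ i $ k)"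
  proof -
    have "(\<Sum>i\<in>UNIV. \<Sum>p\<in>UNIV. \<Gamma> m x $ i $ p * Rm i j x $ p $ k)
      = (\<Sum>p\<in>UNIV. \<Sum>i\<in>UNIV. \<Gamma> m x $ i $ p * Rm i j x $ p $ k)" by (rule sum.swap)
    then show ?thesis by (simp add: matrix_mult_nth)
  qed
  then show ?thesis
    by (simp add: nR_def D_def nric_def sum.distrib sum_subtractf pd_ric_nth x 2 3)
qed

lemma nric_sym: "x \<in> U \<Longrightarrow> nric m x $ j $ k = nric m x $ k $ j"
proof -
  assume x: "x \<in> U"
  have "pd m ric x = pd m (\<lambda>y. transpose (ric y)) x" by (rule pd_U_cong[OF x]) (simp add: sym_ric)
  also have "\<dots> = transpose (pd m ric x)" by (rule pd_transpose[OF smooth_imp_diff[OF smooth_ric x]])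
  finally have "transpose (nric m x) = nric m x"
    by (simp add: nric_def transpose_linear matrix_transpose_mul sym_ric x)
  from arg_cong[OF this, of "\<lambda>M. M $ k $ j"] show ?thesis by (simp add: transpose_def)
qed

lemma B_eq: "x \<in> U \<Longrightarrow> B m x = q x ** nric m x"
  unfolding D_def \<rho>_def[abs_def] nric_def
  by (simp add: pd_mm smooth_imp_diff smooth_q smooth_ric pd_q matrix_distribs matrix_mul_assoc algebra_simps)

lemma g_B: "x \<in> U \<Longrightarrow> g x ** B m x = nric m x"
  by (simp add: B_eq matrix_mul_assoc g_q)

lemma scal_eq_trace: "x \<in> U \<Longrightarrow> scal g x = trace (\<rho> x)"
  unfolding scal_def trace_def \<rho>_def matrix_mult_nth
  by (intro sum.cong refl) (simp add: sym_ric_nth)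

lemma pd_scal: "x \<in> U \<Longrightarrow> pd m (scal g) x = trace (B m x)"
  by (simp add: trace_D smooth_\<rho> pd_U_cong[OF _ scal_eq_trace])

lemma div_nR: "x \<in> U \<Longrightarrow> (\<Sum>i\<in>UNIV. nR i j m x $ i $ k) = nric j x $ m $ k - nric m x $ j $ k"
proof -
  assume x: "x \<in> U"
  have "nR i j m x $ i $ k = nR j i m x $ i $ k - nR m i j x $ i $ k" for i
    using arg_cong[OF nR_bianchi2[OF x, of m i j], of "\<lambda>A. A $ i $ k"] nR_antisym[OF x, of j m i]
    by simp
  then show ?thesis by (simp add: sum_subtractf nric_eq_sum x)
qed

text \<open>A second trace of \<open>div_nR\<close> yields \<open>S\<close> minus the derivative of
  the scalar curvature. On the other side, skewness of \<open>\<nabla>R\<close> in the raised pair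
  of indices reduces the double trace to \<open>- S\<close>.\<close>

lemma pd_scal_eq_div: "x \<in> U \<Longrightarrow> pd m (scal g) x = 2 * (\<Sum>j\<in>UNIV. B j x $ j $ m)"
proof -
  assume x: "x \<in> U"
  define S where "S = (\<Sum>j\<in>UNIV. B j x $ j $ m)"
  have S: "S = (\<Sum>j\<in>UNIV. \<Sum>k\<in>UNIV. q x $ j $ k * nric j x $ k $ m)"
    by (simp add: S_def B_eq x matrix_mult_nth)
  have 1: "(\<Sum>j\<in>UNIV. \<Sum>k\<in>UNIV. nric j x $ m $ k * q x $ k $ j) = S"
    unfolding S by (intro sum.cong refl) (simp add: nric_sym[OF x, of _ m] sym_q_nth[OF x] mult.commute)
  have 2: "(\<Sum>j\<in>UNIV. \<Sum>k\<in>UNIV. nric m x $ j $ k * q x $ k $ j) = pd m (scal g) x"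
    by (subst pd_scal[OF x], subst B_eq[OF x], subst trace_mul_sym) (simp add: trace_def matrix_mult_nth)
  have "(\<Sum>j\<in>UNIV. \<Sum>k\<in>UNIV. (\<Sum>i\<in>UNIV. nR i j m x $ i $ k) * q x $ k $ j)
      = (\<Sum>j\<in>UNIV. \<Sum>i\<in>UNIV. (nR i j m x ** q x) $ i $ j)"
    by (rule sum.cong[OF refl], subst sum_distrib_right, subst sum.swap) (simp add: matrix_mult_nth)
  also have "\<dots> = - (\<Sum>j\<in>UNIV. \<Sum>i\<in>UNIV. (nR i j m x ** q x) $ j $ i)"
    unfolding sum_negf[symmetric] by (intro sum.cong refl skew_at_raise skew_nR x)
  also have "(\<Sum>j\<in>UNIV. \<Sum>i\<in>UNIV. (nR i j m x ** q x) $ j $ i)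
      = (\<Sum>i\<in>UNIV. \<Sum>k\<in>UNIV. (\<Sum>j\<in>UNIV. nR i j m x $ j $ k) * q x $ k $ i)"
    unfolding matrix_mult_nth sum_distrib_right
    by (subst sum.swap, rule sum.cong[OF refl], rule sum.swap)
  also have "\<dots> = S" unfolding nric_eq_sum[OF x] by (rule 1)
  finally have "S - pd m (scal g) x = - S"
    unfolding div_nR[OF x] left_diff_distrib sum_subtractf 1 2 .
  then show ?thesis by (simp add: S_def)
qed

text \<open>The matrix \<open>g\<^sup>i\<^sup>a \<nabla>\<^sub>iR\<^sub>a\<^sub>k\<close>; up to sign its entries are those of \<open>d\<^sup>*R\<close>.\<close>

definition divR :: "'n \<Rightarrow> real^'n \<Rightarrow> real^'n^'n" where
  "divR k x = (\<Sum>i\<in>UNIV. \<Sum>a\<in>UNIV. q x $ i $ a *\<^sub>R nR i a k x)"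

lemma curvature_codiff_eq: "x \<in> U \<Longrightarrow> curvature_codiff g l j k x = - divR j x $ l $ k"
  by (simp add: curvature_codiff_def divR_def nR_nth)

text \<open>\<open>div_nR\<close> contracts the derivative with the output index of the curvature,
  whereas \<open>divR\<close> contracts it with a form index. Pair symmetry of
  \<open>\<nabla>R\<close> carries one into the other.\<close>

lemma g_divR: "x \<in> U \<Longrightarrow> (g x ** divR k x) $ m $ j = nric m x $ j $ k - nric j x $ m $ k"
proof -
  assume x: "x \<in> U"
  have "(\<Sum>i\<in>UNIV. nR i j m x $ i $ k) = (\<Sum>i\<in>UNIV. (q x ** (g x ** nR i j m x)) $ i $ k)"
    by (simp add: matrix_mul_assoc q_g x)
  also have "\<dots> = (\<Sum>i\<in>UNIV. \<Sum>a\<in>UNIV. q x $ i $ a * (g x ** nR i j m x) $ a $ k)"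
    by (simp add: matrix_mult_nth[of "q x"])
  also have "\<dots> = (\<Sum>i\<in>UNIV. \<Sum>a\<in>UNIV. q x $ i $ a * - (g x ** nR i a k x) $ m $ j)"
  proof (intro sum.cong refl)
    fix i a
    have "(g x ** nR i j m x) $ a $ k = (g x ** nR i k a x) $ m $ j"
      by (rule nR_pair_symmetry[OF x x x x])
    then show "q x $ i $ a * (g x ** nR i j m x) $ a $ k = q x $ i $ a * - (g x ** nR i a k x) $ m $ j"
      by (simp add: nR_antisym[OF x, of i k a] matrix_distribs)
  qed
  also have "\<dots> = - (g x ** divR k x) $ m $ j"
    by (simp add: divR_def matrix_sum_right matrix_distribs sum_negf)
  finally show ?thesis by (simp add: div_nR x)
qed

end

section \<open>The soliton equation\<close>

locale chart_soliton = chart_metric U g for U :: "(real^'n::finite) set" and g +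
  fixes F :: "real^'n \<Rightarrow> real" and lam :: real
  assumes smooth_F: "smooth_on F U"
    and soliton: "\<And>x. x \<in> U \<Longrightarrow> ricci g x + hess g F x = lam *\<^sub>R g x"
begin

abbreviation N :: "real^'n \<Rightarrow> real^'n" where "N \<equiv> grad g F"

text \<open>The Hessian of \<open>F\<close> as an endomorphism, with the soliton equation already
  inserted: \<open>pd_N\<close> says that the covariant derivative of \<open>N\<close> in direction
  \<open>i\<close> is \<open>H x *v axis i 1\<close>.\<close>

definition H :: "real^'n \<Rightarrow> real^'n^'n" where "H x = lam *\<^sub>R mat 1 - \<rho> x"

lemma N_eq: "N x = q x *v (\<chi> i. pd i F x)"
  by (simp add: grad_def partial_eq_pd)

lemma smooth_dF: "smooth_on (\<lambda>x. \<chi> i. pd i F x) U"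
  by (rule smooth_on_vec[OF open_U]) (simp add: smooth_on_pd smooth_F)

lemma smooth_N: "smooth_on N U"
  unfolding N_eq[abs_def] by (intro smooth_mv smooth_q smooth_dF)

lemma smooth_H: "smooth_on H U"
  unfolding H_def[abs_def] by (intro smooth_simps smooth_\<rho>)

lemma pd_N: "x \<in> U \<Longrightarrow> pd i N x = H x *v axis i 1 - \<Gamma> i x *v N x"
proof -
  assume x: "x \<in> U"
  define dF where "dF = (\<lambda>x. \<chi> i. pd i F x)"
  have dF: "dF differentiable (at x)" unfolding dF_def by (rule smooth_imp_diff[OF smooth_dF x])
  have "pd i dF x $ j = pd i (\<lambda>y. dF y $ j) x" for j
    by (rule pd_nth[OF dF, symmetric])
  then have pd_dF: "pd i dF x $ j = pd i (pd j F) x" for j by (simp add: dF_def)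
  have dF_nth: "dF y $ k = pd k F y" for y k by (simp add: dF_def)
  have "pd i dF x - transpose (\<Gamma> i x) *v dF x = hess g F x $ i"
    by (rule vec_eqI) (simp add: pd_dF hess_def partial_eq_pd matrix_vector_mult_def transpose_def dF_nth \<Gamma>_def
        del: transpose_matrix_vector)
  also have "\<dots> = (lam *\<^sub>R g x - ric x) *v axis i 1"
  proof (rule vec_eqI)
    fix j
    show "hess g F x $ i $ j = ((lam *\<^sub>R g x - ric x) *v axis i 1) $ j"
      using arg_cong[OF soliton[OF x], of "\<lambda>M. M $ i $ j"] sym_g_nth[OF x, of i j] sym_ric_nth[OF x, of i j]
      by (simp add: matrix_vector_mult_basis column_def)
  qed
  finally have *: "pd i dF x = (lam *\<^sub>R g x - ric x) *v axis i 1 + transpose (\<Gamma> i x) *v dF x"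
    by (simp add: algebra_simps)
  have "pd i N x = q x *v pd i dF x + pd i q x *v dF x"
    unfolding N_eq[abs_def] dF_def[symmetric]
    by (simp add: pd_mv smooth_imp_diff smooth_q x dF flip: dF_def[THEN fun_cong])
  also have "\<dots> = (q x ** (lam *\<^sub>R g x - ric x)) *v axis i 1 - (\<Gamma> i x ** q x) *v dF x"
  proof -
    have "q x *v (A *v e + C *v w) + (- (G ** q x) - q x ** C) *v w = (q x ** A) *v e - (G ** q x) *v w"
      for A C G :: "real^'n^'n" and e w
      by (simp add: algebra_simps matrix_vector_mult_minus del: transpose_matrix_vector flip: matrix_vector_mul_assoc)
    then show ?thesis unfolding * pd_q[OF x] .
  qed
  also have "q x ** (lam *\<^sub>R g x - ric x) = H x"
    by (simp add: H_def \<rho>_def matrix_distribs q_g x)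
  finally show ?thesis by (simp only: N_eq[of x] dF_def matrix_vector_mul_assoc)
qed

lemma \<Gamma>_axis_sym: "x \<in> U \<Longrightarrow> \<Gamma> i x *v axis j 1 = \<Gamma> j x *v axis i 1"
  by (rule vec_eqI) (simp add: matrix_vector_mult_basis column_def \<Gamma>_sym[of x i _ j])

lemma pd_H: "x \<in> U \<Longrightarrow> pd i H x = - pd i \<rho> x"
  unfolding H_def[abs_def] by (simp add: pd_diff smooth_imp_diff smooth_on_const smooth_\<rho>)

text \<open>The Ricci identity for \<open>\<nabla>f\<close>, with the Hessian eliminated by the soliton equation.\<close>

lemma Rm_N: "x \<in> U \<Longrightarrow> Rm i j x *v N x = B j x *v axis i 1 - B i x *v axis j 1"
proof -
  assume x: "x \<in> U"
  have pdpd: "pd a (pd b N) x = - (pd a \<rho> x *v axis b 1) - pd a (\<Gamma> b) x *v N x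
     - \<Gamma> b x *v (H x *v axis a 1 - \<Gamma> a x *v N x)" for a b
  proof -
    have "pd a (pd b N) x = pd a (\<lambda>y. H y *v axis b 1 - \<Gamma> b y *v N y) x"
      by (rule pd_U_cong[OF x]) (rule pd_N)
    also have "\<dots> = pd a H x *v axis b 1 - (\<Gamma> b x *v pd a N x + pd a (\<Gamma> b) x *v N x)"
      using x by (simp add: pd_diff pd_mv smooth_imp_diff smooth_simps smooth_H smooth_N smooth_\<Gamma>
)
    finally show ?thesis by (simp add: pd_H pd_N x matrix_vector_mult_minus algebra_simps)
  qed
  define u v where "u = axis i (1::real)" and "v = axis j (1::real)"
  have "pd i (pd j N) x = pd j (pd i N) x" by (rule pd_commute[OF open_U smooth_N x])
  then have "pd i (\<Gamma> j) x *v N x - pd j (\<Gamma> i) x *v N x + \<Gamma> i x *v (\<Gamma> j x *v N x) - \<Gamma> j x *v (\<Gamma> i x *v N x)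
     = pd j \<rho> x *v u - pd i \<rho> x *v v + \<Gamma> i x *v (H x *v v) - \<Gamma> j x *v (H x *v u)"
    unfolding pdpd u_def[symmetric] v_def[symmetric] by (simp add: algebra_simps)
  moreover have "\<Gamma> i x *v v = \<Gamma> j x *v u" unfolding u_def v_def by (rule \<Gamma>_axis_sym[OF x])
  ultimately show ?thesis
    unfolding u_def[symmetric] v_def[symmetric]
    by (simp add: Rm_eq[OF x] D_def H_def scaleR_mat1_vector algebra_simps flip: matrix_vector_mul_assoc)
qed

lemma ric_N_eq_sum: "(ric x *v N x) $ j = (\<Sum>i\<in>UNIV. (Rm i j x *v N x) $ i)"
  unfolding matrix_vector_mult_def ric_nth by (simp add: sum_distrib_right) (rule sum.swap)

lemma pd_scal_soliton: "x \<in> U \<Longrightarrow> pd j (scal g) x = 2 * (ric x *v N x) $ j"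
proof -
  assume x: "x \<in> U"
  have "(ric x *v N x) $ j = trace (B j x) - (\<Sum>i\<in>UNIV. B i x $ i $ j)"
    unfolding ric_N_eq_sum Rm_N[OF x]
    by (simp add: matrix_vector_mult_basis column_def sum_subtractf trace_def)
  then show ?thesis using pd_scal[OF x, of j] pd_scal_eq_div[OF x, of j] by simp
qed

section \<open>Radial curvature: the operator sending E to R(E,N)N\<close>

definition radial :: "real^'n \<Rightarrow> real^'n^'n" where
  "radial x = (\<chi> l i. \<Sum>j\<in>UNIV. N x $ j * (Rm i j x *v N x) $ l)"

lemma radial_sec_eq: "x \<in> U \<Longrightarrow> radial_sec g F E x = E \<bullet> ((g x ** radial x) *v E)"
proof -
  assume x: "x \<in> U"
  have "curvature g E (N x) (N x) x = radial x *v E"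
    by (rule vec_eqI) (simp add: curvature_def radial_def matrix_vector_mult_def Rm_def
        sum_distrib_left sum_distrib_right mult_ac)
  then have "radial_sec g F E x = (radial x *v E) \<bullet> (g x *v E)" by (simp add: radial_sec_def)
  then show ?thesis using inner_symmetric[OF sym_g[OF x]]
    by (simp add: matrix_vector_mul_assoc[symmetric])
qed

lemma trace_radial: "trace (radial x) = N x \<bullet> (ric x *v N x)"
  unfolding inner_vec_def ric_N_eq_sum
  by (simp add: trace_def radial_def sum_distrib_left) (rule sum.swap)

lemma trace_q_g_radial: "x \<in> U \<Longrightarrow> trace (q x ** (g x ** radial x)) = N x \<bullet> (ric x *v N x)"
  by (simp add: matrix_mul_assoc q_g trace_radial)

lemma radial_flat_if_nonneg:
  assumes x: "x \<in> U" and "N x \<bullet> (ric x *v N x) = 0" and "\<And>E. 0 \<le> radial_sec g F E x"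
  shows "radial_sec g F E x = 0"
  unfolding radial_sec_eq[OF x]
  by (rule psd_trace_zero[OF sym_q[OF x] pos_q[OF x]])
    (use assms in \<open>simp_all add: trace_q_g_radial flip: radial_sec_eq\<close>)

lemma radial_flat_if_nonpos:
  assumes x: "x \<in> U" and "N x \<bullet> (ric x *v N x) = 0" and "\<And>E. radial_sec g F E x \<le> 0"
  shows "radial_sec g F E x = 0"
proof -
  have "E \<bullet> ((- (g x ** radial x)) *v E) = 0"
  proof (rule psd_trace_zero[OF sym_q[OF x] pos_q[OF x]])
    show "0 \<le> v \<bullet> ((- (g x ** radial x)) *v v)" for v
      using assms(3)[of v] by (simp add: radial_sec_eq x matrix_vector_mult_minus)
    show "trace (q x ** - (g x ** radial x)) = 0"
      using trace_q_g_radial[OF x] assms(2) by (simp add: matrix_minus_right trace_def sum_negf)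
  qed
  then show ?thesis by (simp add: radial_sec_eq x matrix_vector_mult_minus)
qed

text \<open>Radial flatness is a condition on a quadratic form, so polarisation shows only that
  \<open>g ** radial\<close> is skew. That is enough, since the trace of a skew matrix against the
  symmetric \<open>q\<close> vanishes.\<close>

lemma ric_N_N_if_radially_flat:
  assumes x: "x \<in> U" and flat: "\<And>E. radial_sec g F E x = 0"
  shows "N x \<bullet> (ric x *v N x) = 0"
proof -
  define S where "S = g x ** radial x"
  have S0: "E \<bullet> (S *v E) = 0" for E using flat by (simp add: radial_sec_eq x S_def)
  have ax: "axis a 1 \<bullet> (S *v axis b 1) = S $ a $ b" for a b
    by (simp add: matrix_vector_mult_basis column_def inner_axis')
  have anti: "S $ a $ b = - S $ b $ a" for a b
    using S0[of "axis a 1 + axis b 1"] S0[of "axis a 1"] S0[of "axis b 1"]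
    by (simp add: matrix_vector_right_distrib inner_add_left inner_add_right ax)
  have "transpose S = - S"
    by (rule mat_eqI) (simp add: transpose_def, rule anti)
  then have "trace (transpose (q x ** S)) = - trace (S ** q x)"
    by (simp add: matrix_transpose_mul sym_q x matrix_minus_left trace_def sum_negf)
  moreover have "trace (transpose (q x ** S)) = trace (q x ** S)" by (simp add: trace_def transpose_def)
  ultimately have "trace (q x ** S) = 0" using trace_mul_sym[of "q x" S] by simp
  then show ?thesis using trace_q_g_radial[OF x] by (simp add: S_def)
qed

lemma ric_N_zero_if_radially_flat:
  assumes x: "x \<in> U" and flat: "\<And>E. radial_sec g F E x = 0"
    and "(\<forall>v. 0 \<le> v \<bullet> (ric x *v v)) \<or> (\<forall>v. v \<bullet> (ric x *v v) \<le> 0)"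
  shows "ric x *v N x = 0"
  using assms(3)
proof
  assume "\<forall>v. 0 \<le> v \<bullet> (ric x *v v)"
  then show ?thesis
    by (intro psd_kernel sym_ric x ric_N_N_if_radially_flat flat) auto
next
  assume *: "\<forall>v. v \<bullet> (ric x *v v) \<le> 0"
  have "(- ric x) *v N x = 0"
    by (rule psd_kernel) (use * in \<open>simp_all add: transpose_linear sym_ric x matrix_vector_mult_minus ric_N_N_if_radially_flat flat\<close>)
  then show ?thesis by (simp add: matrix_vector_mult_minus)
qed

lemma Rm_N_zero_if_harmonic:
  assumes x: "x \<in> U" and harm: "\<And>l j k. curvature_codiff g l j k x = 0"
  shows "Rm i j x *v N x = 0"
proof -
  have "divR k x = 0" for k
    using harm by (simp add: vec_eq_iff curvature_codiff_eq x)
  then have cod: "nric m x $ j $ k = nric j x $ m $ k" for m j k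
    using g_divR[OF x, of k m j] by simp
  have "nric j x *v axis i 1 = nric i x *v axis j 1"
    by (rule vec_eqI) (simp add: matrix_vector_mult_basis column_def cod[of j] cod[of i] nric_sym[OF x, of _ i j])
  then show ?thesis by (simp add: Rm_N x B_eq flip: matrix_vector_mul_assoc)
qed

lemma harmonic_consequences:
  assumes x: "x \<in> U" and harm: "\<And>l j k. curvature_codiff g l j k x = 0"
  shows "radial_sec g F E x = 0" "ric x *v N x = 0"
proof -
  note R = Rm_N_zero_if_harmonic[OF x harm]
  have "radial x = 0" by (simp add: vec_eq_iff radial_def R)
  then show "radial_sec g F E x = 0" by (simp add: radial_sec_eq x)
  show "ric x *v N x = 0" by (rule vec_eqI) (simp add: ric_N_eq_sum R)
qed

lemma ric_N_zero_if_scal_constant: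
  assumes x: "x \<in> U" and s: "\<And>y. y \<in> U \<Longrightarrow> scal g y = s"
  shows "ric x *v N x = 0"
proof (rule vec_eqI)
  fix j
  have "pd j (scal g) x = pd j (\<lambda>_. s) x" by (rule pd_U_cong[OF x s])
  then show "(ric x *v N x) $ j = 0 $ j" using pd_scal_soliton[OF x, of j] by simp
qed

end

section \<open>Ricci tensor between zero and the soliton constant\<close>

text \<open>In terms of eigenvalues: numbers \<open>\<mu>\<close> in [0,c] with vanishing sum of
  \<open>c \<mu> - \<mu>^2\<close> are all 0 or c. Instead of diagonalising, Cauchy-Schwarz for
  \<open>P\<close> with \<open>w = q *v (P *v v)\<close> gives \<open>a^2 \<le> b c a\<close>, so
  \<open>Z\<close> is semidefinite, and its trace against \<open>q\<close> is zero.\<close>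

lemma form_bounds_imp_quadratic:
  fixes g P :: "real^'n^'n"
  defines "q \<equiv> matrix_inv g"
  assumes sym_g: "transpose g = g" and pos_g: "\<And>v. v \<noteq> 0 \<Longrightarrow> 0 < v \<bullet> (g *v v)"
    and sym_q: "transpose q = q" and pos_q: "\<And>v. v \<noteq> 0 \<Longrightarrow> 0 < v \<bullet> (q *v v)"
    and sym_P: "transpose P = P" and P0: "\<And>v. 0 \<le> v \<bullet> (P *v v)"
    and P1: "\<And>v. v \<bullet> (P *v v) \<le> c * (v \<bullet> (g *v v))"
    and tr: "trace (q ** (P ** q ** P)) = c * trace (q ** P)"
  shows "P ** q ** P = c *\<^sub>R P"
proof -
  define Z where "Z = c *\<^sub>R P - P ** q ** P"
  have gq: "g ** q = mat 1" using matrix_inv_inverse(1)[OF posdef_invertible[OF pos_g]] by (simp add: q_def)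
  have "transpose Z = Z"
    by (simp add: Z_def transpose_linear matrix_transpose_mul sym_P sym_q matrix_mul_assoc)
  moreover have Z0: "0 \<le> v \<bullet> (Z *v v)" for v
  proof -
    define w where "w = q *v (P *v v)"
    define a b where "a = v \<bullet> (P *v w)" and "b = v \<bullet> (P *v v)"
    have ww: "w \<bullet> (g *v w) = a"
      using inner_symmetric[OF sym_P, of w v] unfolding a_def
      by (simp add: w_def matrix_vector_mul_assoc gq matrix_mul_assoc)
    have "a\<^sup>2 \<le> b * (w \<bullet> (P *v w))"
      unfolding a_def b_def by (rule psd_cauchy_schwarz[OF sym_P P0])
    also have "\<dots> \<le> b * (c * a)"
      using P1[of w] P0[of v] by (intro mult_left_mono) (simp_all add: ww b_def)
    finally have "a * a \<le> a * (c * b)" by (simp add: power2_eq_square mult_ac)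
    moreover have "0 \<le> a" using ww pos_g[of w] by (cases "w = 0") auto
    moreover have "0 \<le> c * b"
    proof (cases "v = 0")
      case False
      have "0 \<le> c * (v \<bullet> (g *v v))" using P0[of v] P1[of v] by linarith
      then have "0 \<le> c" using pos_g[OF False] by (simp add: zero_le_mult_iff)
      then show ?thesis using P0[of v] by (simp add: b_def)
    qed (simp add: b_def)
    ultimately have "a \<le> c * b" by (cases "a = 0") auto
    then show ?thesis
      by (simp add: Z_def a_def b_def w_def matrix_vector_mult_diff_rdistrib inner_diff_right
          matrix_vector_mul_assoc matrix_mul_assoc flip: scaleR_matrix_vector_assoc)
  qed
  moreover have "v \<bullet> (Z *v v) = 0" for v
  proof (rule psd_trace_zero[OF sym_q pos_q Z0])
    show "trace (q ** Z) = 0"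
      using tr by (simp add: Z_def matrix_distribs trace_sub) (simp add: trace_def sum_distrib_left)
  qed
  ultimately have Zv: "Z *v v = 0" for v by (intro psd_kernel)
  have "Z = 0" by (simp add: matrix_eq Zv)
  then show ?thesis by (simp add: Z_def)
qed

text \<open>The index set is split into two kinds; \<open>b\<close> pairs only different kinds in its last two slots.\<close>

lemma two_kinds_symmetric:
  fixes b :: "'i::finite \<Rightarrow> 'i \<Rightarrow> 'i \<Rightarrow> real" and kind :: "'i \<Rightarrow> bool"
  assumes sym: "\<And>i j k. b i j k = b i k j"
    and zero: "\<And>i j k. kind j = kind k \<Longrightarrow> b i j k = 0"
    and norm: "(\<Sum>i\<in>UNIV. \<Sum>j\<in>UNIV. \<Sum>k\<in>UNIV. (b i j k)\<^sup>2) = 2 * (\<Sum>i\<in>UNIV. \<Sum>j\<in>UNIV. \<Sum>k\<in>UNIV. b i j k * b j i k)"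
    and "kind i = kind j"
  shows "b i j k = b j i k"
proof -
  define e :: "'i \<Rightarrow> 'i \<Rightarrow> real" where "e i j = of_bool (kind i = kind j)" for i j
  define T where "T f = (\<Sum>i\<in>UNIV. \<Sum>j\<in>UNIV. \<Sum>k\<in>UNIV. f i j k)" for f :: "'i \<Rightarrow> 'i \<Rightarrow> 'i \<Rightarrow> real"
  have lin: "T (\<lambda>i j k. f i j k + h i j k) = T f + T h" for f h
    by (simp add: T_def sum.distrib)
  have scale: "T (\<lambda>i j k. c * f i j k) = c * T f" for c f
    by (simp add: T_def sum_distrib_left)
  have swap12: "T (\<lambda>i j k. f j i k) = T f" for f unfolding T_def by (rule sum.swap)
  have swap23: "T (\<lambda>i j k. f i k j) = T f" for f unfolding T_def by (intro sum.cong refl sum.swap)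
  define S where "S = T (\<lambda>i j k. e i j * (b i j k)\<^sup>2)"
  define Q where "Q = T (\<lambda>i j k. b i j k * b j i k)"
  have "T (\<lambda>i j k. (b i j k)\<^sup>2) = T (\<lambda>i j k. e i j * (b i j k)\<^sup>2 + e i k * (b i k j)\<^sup>2)"
  proof -
    \<comment> \<open>Where \<open>b i j k\<close> is nonzero, \<open>j\<close> and \<open>k\<close>
      are of different kinds; there being only two, \<open>i\<close> agrees with exactly one of
      them.\<close>
    have "(b i j k)\<^sup>2 = e i j * (b i j k)\<^sup>2 + e i k * (b i k j)\<^sup>2" for i j k
      using zero[of j k i] sym[of i k j] by (cases "kind j = kind k") (auto simp: e_def)
    then show ?thesis by (intro arg_cong[of _ _ T] ext)
  qed
  also have "\<dots> = 2 * S" unfolding lin swap23[of "\<lambda>i j k. e i j * (b i j k)\<^sup>2"] S_def by simp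
  finally have SQ: "S = Q" using norm by (simp add: T_def Q_def)
  \<comment> \<open>The cross term needs no factor \<open>e\<close>: if \<open>i\<close> and
    \<open>j\<close> differ in kind, then \<open>k\<close> agrees with one of them and one of the
    two factors vanishes.\<close>
  have "e i j * (b i j k - b j i k)\<^sup>2 = e i j * (b i j k)\<^sup>2 + (e j i * (b j i k)\<^sup>2 + (- 2) * (b i j k * b j i k))" for i j k
    using zero[of j k i] zero[of i k j] by (auto simp: e_def power2_eq_square algebra_simps)
  then have "T (\<lambda>i j k. e i j * (b i j k - b j i k)\<^sup>2)
      = T (\<lambda>i j k. e i j * (b i j k)\<^sup>2 + (e j i * (b j i k)\<^sup>2 + (- 2) * (b i j k * b j i k)))"
    by (intro arg_cong[of _ _ T] ext)
  also have "\<dots> = S + (S + (- 2) * Q)"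
    unfolding S_def Q_def lin scale swap12[of "\<lambda>i j k. e i j * (b i j k)\<^sup>2"] ..
  finally have "T (\<lambda>i j k. e i j * (b i j k - b j i k)\<^sup>2) = 0" using SQ by simp
  moreover have T0: "h i j k = 0" if "T h = 0" "\<And>i j k. 0 \<le> h i j k" for h
    using that unfolding T_def by (simp add: sum_nonneg_eq_0_iff sum_nonneg)
  ultimately have "e i j * (b i j k - b j i k)\<^sup>2 = 0"
    by (intro T0[of "\<lambda>i j k. e i j * (b i j k - b j i k)\<^sup>2"]) (simp_all add: e_def)
  then show ?thesis using assms(4) by (simp add: e_def)
qed

section \<open>Constant scalar curvature and the bounds: the Ricci endomorphism as a multiple of a
  projection\<close>

context chart_soliton
begin

text \<open>The product rule applied to \<open>\<rho> *v N = 0\<close>, with \<open>H\<close> as the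
  covariant derivative of \<open>N\<close>.\<close>

lemma B_N_if_ric_N:
  assumes ric_N: "\<And>x. x \<in> U \<Longrightarrow> ric x *v N x = 0" and x: "x \<in> U"
  shows "B i x *v N x = - (\<rho> x *v (H x *v axis i 1))"
proof -
  have \<rho>_N: "\<rho> y *v N y = 0" if "y \<in> U" for y
    using that by (simp add: \<rho>_def ric_N flip: matrix_vector_mul_assoc)
  have "pd i (\<lambda>y. \<rho> y *v N y) x = pd i (\<lambda>_. 0) x" by (rule pd_U_cong[OF x \<rho>_N])
  then have "\<rho> x *v (H x *v axis i 1 - \<Gamma> i x *v N x) + pd i \<rho> x *v N x = 0"
    using x by (simp add: pd_mv smooth_imp_diff smooth_\<rho> smooth_N pd_N)
  then have "pd i \<rho> x *v N x - \<rho> x *v (\<Gamma> i x *v N x) = - (\<rho> x *v (H x *v axis i 1))"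
    by (simp add: matrix_vector_mult_diff_distrib eq_neg_iff_add_eq_0 algebra_simps)
  then show ?thesis
    by (simp add: D_def matrix_vector_mult_diff_rdistrib matrix_vector_mult_add_rdistrib \<rho>_N x
        flip: matrix_vector_mul_assoc)
qed

text \<open>The divergence of the vanishing vector field \<open>Ric(\<nabla>f)\<close>.\<close>

lemma trace_\<rho>_\<rho>:
  assumes ric_N: "\<And>x. x \<in> U \<Longrightarrow> ric x *v N x = 0" and x: "x \<in> U"
  shows "trace (\<rho> x ** \<rho> x) = lam * trace (\<rho> x)"
proof -
  \<comment> \<open>Ric(N) = 0 makes the scalar curvature locally constant and hence
    \<open>\<rho>\<close> divergence free. What remains of the divergence of
    \<open>\<rho> *v N\<close> is the trace of \<open>\<rho> ** H\<close>.\<close>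
  have div: "(\<Sum>i\<in>UNIV. B i x $ i $ k) = 0" for k
    using pd_scal_soliton[OF x, of k] pd_scal_eq_div[OF x, of k] by (simp add: ric_N x)
  have "trace (\<rho> x ** H x) = (\<Sum>i\<in>UNIV. (\<rho> x *v (H x *v axis i 1)) $ i)"
    unfolding matrix_vector_mul_assoc unfolding matrix_vector_mult_basis
    by (simp add: trace_def column_def)
  also have "\<dots> = - (\<Sum>i\<in>UNIV. (B i x *v N x) $ i)"
    by (simp add: B_N_if_ric_N[OF ric_N x] sum_negf)
  also have "(\<Sum>i\<in>UNIV. (B i x *v N x) $ i) = (\<Sum>k\<in>UNIV. (\<Sum>i\<in>UNIV. B i x $ i $ k) * N x $ k)"
    by (simp add: matrix_vector_mult_def sum_distrib_right) (rule sum.swap)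
  finally have "trace (\<rho> x ** H x) = 0" by (simp add: div)
  then show ?thesis
    by (simp add: H_def matrix_distribs trace_sub) (simp add: trace_def sum_distrib_left)
qed

lemma \<rho>_\<rho>_if_bounds:
  assumes ric_N: "\<And>x. x \<in> U \<Longrightarrow> ric x *v N x = 0" and x: "x \<in> U"
    and bounds: "(form_le 0 (ric x) \<and> form_le (ric x) (lam *\<^sub>R g x)) \<or>
      (form_le (lam *\<^sub>R g x) (ric x) \<and> form_le (ric x) 0)"
  shows "\<rho> x ** \<rho> x = lam *\<^sub>R \<rho> x"
proof -
  have tr: "trace (q x ** (ric x ** q x ** ric x)) = lam * trace (q x ** ric x)"
    using trace_\<rho>_\<rho>[OF ric_N x] by (simp add: \<rho>_def matrix_mul_assoc)
  note quadratic = form_bounds_imp_quadratic[OF sym_g[OF x] pos_g[OF x] sym_q[OF x] pos_q[OF x]]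
  have scale: "v \<bullet> ((c *\<^sub>R g x) *v v) = c * (v \<bullet> (g x *v v))" for c v
    by (simp flip: scaleR_matrix_vector_assoc)
  have "ric x ** q x ** ric x = lam *\<^sub>R ric x"
    using bounds
  proof
    assume "form_le 0 (ric x) \<and> form_le (ric x) (lam *\<^sub>R g x)"
    then show ?thesis
      by (intro quadratic sym_ric x tr) (auto simp: form_le_def scale)
  next
    assume *: "form_le (lam *\<^sub>R g x) (ric x) \<and> form_le (ric x) 0"
    have neg: "trace (- A) = - trace A" for A :: "real^'n^'n" by (simp add: trace_def sum_negf)
    \<comment> \<open>For the reversed bounds, \<open>- ric x\<close> lies between zero and
      \<open>- lam\<close> times the metric, while the metric itself stays positive.\<close>
    have "(- ric x) ** q x ** (- ric x) = (- lam) *\<^sub>R (- ric x)"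
    proof (rule quadratic)
      show "transpose (- ric x) = - ric x" by (simp add: transpose_linear sym_ric x)
      show "0 \<le> v \<bullet> ((- ric x) *v v)" "v \<bullet> ((- ric x) *v v) \<le> - lam * (v \<bullet> (g x *v v))" for v
        using * by (simp_all add: form_le_def scale matrix_vector_mult_minus)
      show "trace (q x ** ((- ric x) ** q x ** (- ric x))) = - lam * trace (q x ** (- ric x))"
        using tr by (simp add: matrix_distribs neg)
    qed
    then show ?thesis by (simp add: matrix_distribs)
  qed
  then have "q x ** (ric x ** q x ** ric x) = lam *\<^sub>R (q x ** ric x)" by (simp add: matrix_distribs)
  then show ?thesis by (simp add: \<rho>_def matrix_mul_assoc)
qed

end

text \<open>The bounds on the Ricci tensor act from here on only through
  \<open>\<rho>_\<rho>\<close>: \<open>\<rho> / lam\<close> is a projection, and \<open>H\<close> is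
  \<open>lam\<close> times the complementary one.\<close>

locale chart_soliton_split = chart_soliton U g F lam
  for U :: "(real^'n::finite) set" and g F lam +
  assumes lam: "lam \<noteq> 0"
    and ric_N: "\<And>x. x \<in> U \<Longrightarrow> ricci g x *v grad g F x = 0"
    and \<rho>_\<rho>: "\<And>x. x \<in> U \<Longrightarrow> \<rho> x ** \<rho> x = lam *\<^sub>R \<rho> x"
begin

lemma \<rho>_N: "x \<in> U \<Longrightarrow> \<rho> x *v N x = 0"
  by (simp add: \<rho>_def ric_N flip: matrix_vector_mul_assoc)

lemma \<rho>_H: "x \<in> U \<Longrightarrow> \<rho> x ** H x = 0"
  by (simp add: H_def matrix_distribs \<rho>_\<rho>)

lemma B_N: "x \<in> U \<Longrightarrow> B i x *v N x = 0"
  using B_N_if_ric_N[OF ric_N] by (simp add: matrix_vector_mul_assoc \<rho>_H)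

lemma pd_scal_zero: "x \<in> U \<Longrightarrow> pd j (scal g) x = 0"
  by (simp add: pd_scal_soliton ric_N)

lemma trace_B: "x \<in> U \<Longrightarrow> trace (B j x) = 0"
  using pd_scal_zero by (simp add: pd_scal)

lemma div_B: "x \<in> U \<Longrightarrow> (\<Sum>j\<in>UNIV. B j x $ j $ m) = 0"
  using pd_scal_zero[of x m] pd_scal_eq_div[of x m] by simp

text \<open>The derivative of \<open>\<rho> ** \<rho> = lam *\<^sub>R \<rho>\<close>. It says that
  \<open>B j\<close> maps the kernel of \<open>\<rho>\<close> into the image and the image into the
  kernel.\<close>

lemma \<rho>_B: "x \<in> U \<Longrightarrow> \<rho> x ** B j x = lam *\<^sub>R B j x - B j x ** \<rho> x"
proof -
  assume x: "x \<in> U"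
  have "D j (\<lambda>y. \<rho> y ** \<rho> y) x = D j (\<lambda>y. lam *\<^sub>R \<rho> y) x" by (rule D_cong[OF x \<rho>_\<rho>])
  moreover have "D j (\<lambda>y. lam *\<^sub>R \<rho> y) x = lam *\<^sub>R B j x"
    using x unfolding D_def
    by (simp add: pd_scaleR smooth_imp_diff smooth_\<rho> matrix_distribs algebra_simps)
  ultimately show ?thesis
    by (simp add: D_mult x smooth_\<rho> algebra_simps)
qed

lemma trace_\<rho>_B: "x \<in> U \<Longrightarrow> trace (\<rho> x ** B j x) = 0"
proof -
  assume x: "x \<in> U"
  have "trace (\<rho> x ** B j x) = lam * trace (B j x) - trace (\<rho> x ** B j x)"
    by (subst \<rho>_B[OF x], simp only: trace_sub trace_mul_sym[of "B j x"])
      (simp add: trace_def sum_distrib_left)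
  then show ?thesis by (simp add: trace_B x)
qed

text \<open>The full second covariant derivative \<open>\<nabla>\<^sub>m\<nabla>\<^sub>i\<rho>\<close>.\<close>

definition nB :: "'n \<Rightarrow> 'n \<Rightarrow> real^'n \<Rightarrow> real^'n^'n" where
  "nB m i x = D m (B i) x - (\<Sum>p\<in>UNIV. \<Gamma> m x $ p $ i *\<^sub>R B p x)"

text \<open>\<open>trace_\<rho>_B\<close> states that half the differential of |Ric|^2 vanishes;
  this is one further derivative of it.\<close>

lemma trace_\<rho>_nB: "x \<in> U \<Longrightarrow> trace (\<rho> x ** nB m i x) = - trace (B m x ** B i x)"
proof -
  assume x: "x \<in> U"
  have "pd m (\<lambda>y. trace (\<rho> y ** B i y)) x = pd m (\<lambda>_. 0) x" by (rule pd_U_cong[OF x trace_\<rho>_B])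
  then have "trace (D m (\<lambda>y. \<rho> y ** B i y) x) = 0"
    by (simp add: trace_D x smooth_simps smooth_\<rho> smooth_B)
  then have *: "trace (\<rho> x ** D m (B i) x) = - trace (B m x ** B i x)"
    by (simp add: D_mult x smooth_\<rho> smooth_B trace_add)
  have "trace (\<Sum>p\<in>UNIV. \<Gamma> m x $ p $ i *\<^sub>R (\<rho> x ** B p x)) = (\<Sum>p\<in>UNIV. \<Gamma> m x $ p $ i *\<^sub>R trace (\<rho> x ** B p x))"
  proof -
    have l: "linear (trace :: real^'n^'n \<Rightarrow> real)" by (rule bounded_linear.linear[OF bounded_linear_trace])
    show ?thesis by (simp add: linear_sum[OF l] linear_cmul[OF l])
  qed
  then show ?thesis
    by (simp add: nB_def matrix_distribs matrix_sum_right trace_sub * trace_\<rho>_B x)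
qed

text \<open>Covariant derivative of a vanishing contraction between the label \<open>j\<close> and a
  raised matrix index. \<open>D\<close> is blind to the label, so its correction has to be
  subtracted by hand.\<close>

lemma D_contracted:
  assumes x: "x \<in> U" and M: "\<And>j. smooth_on (M j) U"
    and zero: "\<And>y a. y \<in> U \<Longrightarrow> (\<Sum>j\<in>UNIV. (M j y ** q y) $ a $ j) = 0"
  shows "(\<Sum>j\<in>UNIV. ((D m (M j) x - (\<Sum>p\<in>UNIV. \<Gamma> m x $ p $ j *\<^sub>R M p x)) ** q x) $ a $ j) = 0"
proof -
  have pdM: "pd m (\<lambda>y. M j y ** q y) x = D m (M j) x ** q x - \<Gamma> m x ** (M j x ** q x)
      - (M j x ** q x) ** transpose (\<Gamma> m x)" for j
    by (simp add: D_def pd_mm smooth_imp_diff M smooth_q x pd_q matrix_distribs matrix_mul_assoc algebra_simps)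
  have "pd m (\<lambda>y. \<Sum>j\<in>UNIV. (M j y ** q y) $ a $ j) x = pd m (\<lambda>_. 0) x"
    by (rule pd_U_cong[OF x zero])
  moreover have "pd m (\<lambda>y. \<Sum>j\<in>UNIV. (M j y ** q y) $ a $ j) x = (\<Sum>j\<in>UNIV. pd m (\<lambda>y. M j y ** q y) x $ a $ j)"
    using x by (simp add: pd_sum pd_nth2 smooth_imp_diff smooth_simps M smooth_q)
  ultimately have 0: "(\<Sum>j\<in>UNIV. (D m (M j) x ** q x) $ a $ j) =
      (\<Sum>j\<in>UNIV. (\<Gamma> m x ** (M j x ** q x)) $ a $ j) + (\<Sum>j\<in>UNIV. ((M j x ** q x) ** transpose (\<Gamma> m x)) $ a $ j)"
    by (simp add: pdM sum_subtractf)
  have 1: "(\<Sum>j\<in>UNIV. (\<Gamma> m x ** (M j x ** q x)) $ a $ j) = 0"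
  proof -
    have "(\<Sum>j\<in>UNIV. (\<Gamma> m x ** (M j x ** q x)) $ a $ j)
        = (\<Sum>p\<in>UNIV. \<Sum>j\<in>UNIV. \<Gamma> m x $ a $ p * (M j x ** q x) $ p $ j)"
      unfolding matrix_mult_nth[of "\<Gamma> m x"] by (rule sum.swap)
    then show ?thesis by (simp add: zero x flip: sum_distrib_left)
  qed
  \<comment> \<open>The derivative of \<open>q\<close> leaves a transposed \<open>\<Gamma>\<close>
    acting on the raised index; under the sum over \<open>j\<close> it is precisely the label
    correction.\<close>
  have 2: "(\<Sum>j\<in>UNIV. ((M j x ** q x) ** transpose (\<Gamma> m x)) $ a $ j)
      = (\<Sum>j\<in>UNIV. ((\<Sum>p\<in>UNIV. \<Gamma> m x $ p $ j *\<^sub>R M p x) ** q x) $ a $ j)"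
    unfolding matrix_mult_nth[of _ "transpose (\<Gamma> m x)"] matrix_sum_left matrix_scaleR_left
    by (subst sum.swap) (simp add: transpose_def mult.commute)
  show ?thesis using 0 1 2 by (simp add: matrix_diff_rdistrib sum_subtractf)
qed

lemma B_q_sym: "x \<in> U \<Longrightarrow> (B j x ** q x) $ a $ b = (B j x ** q x) $ b $ a"
proof -
  assume x: "x \<in> U"
  have "transpose (nric j x) = nric j x" by (simp add: vec_eq_iff transpose_def nric_sym[OF x, of j])
  then have "transpose (B j x ** q x) = B j x ** q x"
    by (simp add: B_eq x matrix_transpose_mul sym_q matrix_mul_assoc)
  from arg_cong[OF this, of "\<lambda>A. A $ b $ a"] show ?thesis by (simp add: transpose_def)
qed

lemma div_B_q: "x \<in> U \<Longrightarrow> (\<Sum>j\<in>UNIV. (B j x ** q x) $ a $ j) = 0"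
proof -
  assume x: "x \<in> U"
  have "(\<Sum>j\<in>UNIV. (B j x ** q x) $ a $ j) = (\<Sum>j\<in>UNIV. (B j x ** q x) $ j $ a)"
    by (rule sum.cong[OF refl]) (rule B_q_sym[OF x])
  also have "\<dots> = (\<Sum>k\<in>UNIV. (\<Sum>j\<in>UNIV. B j x $ j $ k) * q x $ k $ a)"
    unfolding matrix_mult_nth sum_distrib_right by (rule sum.swap)
  finally show ?thesis by (simp add: div_B x)
qed

text \<open>\<open>\<rho>_B\<close> moves \<open>\<rho>\<close> to the left, where it no longer
  touches the contracted index and \<open>div_B_q\<close> applies.\<close>

lemma div_B_\<rho>_q: "x \<in> U \<Longrightarrow> (\<Sum>j\<in>UNIV. (B j x ** \<rho> x ** q x) $ a $ j) = 0"
proof -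
  assume x: "x \<in> U"
  have "B j x ** \<rho> x = lam *\<^sub>R B j x - \<rho> x ** B j x" for j by (simp add: \<rho>_B x)
  then have "(\<Sum>j\<in>UNIV. (B j x ** \<rho> x ** q x) $ a $ j) =
      lam * (\<Sum>j\<in>UNIV. (B j x ** q x) $ a $ j) - (\<Sum>j\<in>UNIV. (\<rho> x ** (B j x ** q x)) $ a $ j)"
    by (simp add: matrix_distribs sum_subtractf sum_distrib_left matrix_mul_assoc)
  also have "(\<Sum>j\<in>UNIV. (\<rho> x ** (B j x ** q x)) $ a $ j)
      = (\<Sum>p\<in>UNIV. \<rho> x $ a $ p * (\<Sum>j\<in>UNIV. (B j x ** q x) $ p $ j))"
    unfolding matrix_mult_nth[of "\<rho> x"] sum_distrib_left by (rule sum.swap)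
  finally show ?thesis by (simp add: div_B_q x)
qed

lemma div_nB_q: "x \<in> U \<Longrightarrow> (\<Sum>j\<in>UNIV. (nB m j x ** q x) $ a $ j) = 0"
  unfolding nB_def by (rule D_contracted[OF _ smooth_B div_B_q])

lemma div_nB_\<rho>_q:
  "x \<in> U \<Longrightarrow> (\<Sum>j\<in>UNIV. (nB m j x ** \<rho> x ** q x) $ a $ j) = - (\<Sum>j\<in>UNIV. (B j x ** B m x ** q x) $ a $ j)"
proof -
  assume x: "x \<in> U"
  have "(\<Sum>j\<in>UNIV. ((D m (\<lambda>y. B j y ** \<rho> y) x - (\<Sum>p\<in>UNIV. \<Gamma> m x $ p $ j *\<^sub>R (B p x ** \<rho> x))) ** q x) $ a $ j) = 0"
    by (rule D_contracted[OF x, where M="\<lambda>j y. B j y ** \<rho> y"])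
      (simp_all add: smooth_simps smooth_B smooth_\<rho> div_B_\<rho>_q)
  moreover have "D m (\<lambda>y. B j y ** \<rho> y) x - (\<Sum>p\<in>UNIV. \<Gamma> m x $ p $ j *\<^sub>R (B p x ** \<rho> x))
      = nB m j x ** \<rho> x + B j x ** B m x" for j
    by (simp add: D_mult x smooth_B smooth_\<rho> nB_def matrix_distribs matrix_sum_left)
  ultimately show ?thesis
    by (simp add: matrix_add_rdistrib sum.distrib eq_neg_iff_add_eq_0)
qed

lemma nB_commute: "x \<in> U \<Longrightarrow> nB m j x - nB j m x = Rm m j x ** \<rho> x - \<rho> x ** Rm m j x"
  using D_commute[of x \<rho> m j] by (simp add: nB_def smooth_\<rho> \<Gamma>_sym[of x m _ j])

lemma g_symmetric_D:
  assumes x: "x \<in> U" and M: "smooth_on M U" "\<And>y. y \<in> U \<Longrightarrow> transpose (M y) ** g y = g y ** M y"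
  shows "transpose (D m M x) ** g x = g x ** D m M x"
proof -
  have "pd m (\<lambda>y. transpose (M y) ** g y) x = pd m (\<lambda>y. g y ** M y) x"
    by (rule pd_U_cong[OF x]) (rule M)
  then have *: "transpose (pd m M x) ** g x + transpose (M x) ** pd m g x = pd m g x ** M x + g x ** pd m M x"
    using x by (simp add: pd_mm pd_transpose smooth_imp_diff smooth_simps M smooth_g algebra_simps)
  have 1: "transpose (M x) ** g x ** \<Gamma> m x = g x ** M x ** \<Gamma> m x"
    using M(2)[OF x] by simp
  have 2: "transpose (\<Gamma> m x) ** transpose (M x) ** g x = transpose (\<Gamma> m x) ** g x ** M x"
    using M(2)[OF x] by (simp flip: matrix_mul_assoc)
  show ?thesis
    using * unfolding D_def pd_g[OF x]
    by (simp add: matrix_distribs transpose_linear matrix_transpose_mul matrix_mul_assoc 1 2 algebra_simps)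
qed

lemma g_symmetric_B: "x \<in> U \<Longrightarrow> transpose (B i x) ** g x = g x ** B i x"
proof -
  assume x: "x \<in> U"
  have "transpose (\<rho> y) ** g y = g y ** \<rho> y" if "y \<in> U" for y
  proof -
    have "transpose (g y ** \<rho> y) = g y ** \<rho> y" using that by (simp add: g_\<rho> sym_ric)
    then show ?thesis using that by (simp add: matrix_transpose_mul sym_g)
  qed
  then show ?thesis by (intro g_symmetric_D x smooth_\<rho>)
qed

lemma nB_q_sym: "x \<in> U \<Longrightarrow> transpose (nB m i x ** q x) = nB m i x ** q x"
proof -
  assume x: "x \<in> U"
  have sum: "transpose (\<Sum>p\<in>I. c p *\<^sub>R B p x) ** g x = g x ** (\<Sum>p\<in>I. c p *\<^sub>R B p x)" for c I
  proof (induction I rule: infinite_finite_induct)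
    case (insert a I)
    then show ?case by (simp add: matrix_distribs transpose_linear g_symmetric_B x)
  qed (simp_all add: vec_eq_iff transpose_def matrix_matrix_mult_def)
  have "transpose (nB m i x) ** g x = g x ** nB m i x"
    by (simp add: nB_def transpose_linear matrix_distribs sum g_symmetric_D g_symmetric_B smooth_B x)
  then have "q x ** (transpose (nB m i x) ** g x) ** q x = q x ** (g x ** nB m i x) ** q x" by simp
  moreover have "q x ** (transpose (nB m i x) ** g x) ** q x = q x ** transpose (nB m i x) ** (g x ** q x)"
    by (simp add: matrix_mul_assoc)
  moreover have "q x ** (g x ** nB m i x) ** q x = (q x ** g x) ** nB m i x ** q x"
    by (simp add: matrix_mul_assoc)
  ultimately show ?thesis by (simp add: q_g g_q x matrix_transpose_mul sym_q)
qed

text \<open>The covariant derivative of \<open>Rm_N\<close> in direction \<open>m\<close>. The label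
  corrections on both sides match because \<open>Rm_N\<close> itself converts those of
  \<open>Rm\<close> into those of \<open>B\<close>.\<close>

lemma nB_exchange:
  assumes x: "x \<in> U"
  shows "nB m i x *v axis j 1 - nB m j x *v axis i 1 = - (nR m i j x *v N x) - Rm i j x *v (H x *v axis m 1)"
proof -
  have \<Gamma>_axis: "M *v (\<Gamma> m x *v axis k 1) = (\<Sum>p\<in>UNIV. \<Gamma> m x $ p $ k *\<^sub>R (M *v axis p 1))" for M :: "real^'n^'n" and k
    unfolding matrix_vector_mult_basis
    by (rule vec_eqI) (simp add: column_def matrix_vector_mult_def mult.commute)
  define u v where "u = axis i (1::real)" and "v = axis j (1::real)"
  have "pd m (\<lambda>y. B i y *v v - B j y *v u) x = pd m (\<lambda>y. - (Rm i j y *v N y)) x"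
    by (rule pd_U_cong[OF x]) (simp add: Rm_N u_def v_def)
  then have e1: "pd m (B i) x *v v = pd m (B j) x *v u
      - pd m (Rm i j) x *v N x - Rm i j x *v (H x *v axis m 1) + Rm i j x *v (\<Gamma> m x *v N x)"
    using x by (simp add: pd_diff pd_minus pd_mv smooth_imp_diff smooth_simps smooth_B smooth_Rm smooth_N pd_N algebra_simps)
  have "B i x *v v = B j x *v u - Rm i j x *v N x" by (simp add: Rm_N x u_def v_def)
  then have e2: "\<Gamma> m x *v (B i x *v v) = \<Gamma> m x *v (B j x *v u) - \<Gamma> m x *v (Rm i j x *v N x)"
    by (simp only: matrix_vector_mult_diff_distrib)
  have D_vec: "D m M x *v z = pd m M x *v z + \<Gamma> m x *v (M x *v z) - M x *v (\<Gamma> m x *v z)" for M z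
    by (simp add: D_def algebra_simps flip: matrix_vector_mul_assoc)
  have *: "D m (B i) x *v v + B i x *v (\<Gamma> m x *v v) - D m (B j) x *v u - B j x *v (\<Gamma> m x *v u)
      = - (D m (Rm i j) x *v N x) - Rm i j x *v (H x *v axis m 1)"
    unfolding D_vec e1 e2 by simp
  have sum1: "(\<Sum>p\<in>UNIV. \<Gamma> m x $ p $ i *\<^sub>R Rm p j x) *v N x
     = (\<Sum>p\<in>UNIV. \<Gamma> m x $ p $ i *\<^sub>R (B j x *v axis p 1)) - (\<Sum>p\<in>UNIV. \<Gamma> m x $ p $ i *\<^sub>R B p x) *v v"
    by (simp add: matrix_vector_sum_left Rm_N x v_def scaleR_diff_right sum_subtractf flip: scaleR_matrix_vector_assoc)
  have sum2: "(\<Sum>p\<in>UNIV. \<Gamma> m x $ p $ j *\<^sub>R Rm i p x) *v N x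
     = (\<Sum>p\<in>UNIV. \<Gamma> m x $ p $ j *\<^sub>R B p x) *v u - (\<Sum>p\<in>UNIV. \<Gamma> m x $ p $ j *\<^sub>R (B i x *v axis p 1))"
    by (simp add: matrix_vector_sum_left Rm_N x u_def scaleR_diff_right sum_subtractf flip: scaleR_matrix_vector_assoc)
  show ?thesis
    using * unfolding nB_def nR_def u_def[symmetric] v_def[symmetric] matrix_vector_mult_diff_rdistrib sum1 sum2
    unfolding u_def v_def \<Gamma>_axis by (simp add: algebra_simps)
qed

end

section \<open>The Bochner-type identity and integrability of the kernel\<close>

context chart_soliton_split
begin

text \<open>By \<open>g_divR\<close> the left side is a difference of two contractions of
  \<open>\<nabla>Ric\<close> with \<open>N\<close>. The one in a tensor slot vanishes by
  \<open>B_N\<close>; the other is the derivative along \<open>N\<close>.\<close>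

lemma divR_N:
  assumes x: "x \<in> U"
  shows "divR j x *v N x = - (\<Sum>b\<in>UNIV. N x $ b *\<^sub>R (B b x *v axis j 1))"
proof -
  have 0: "(\<Sum>b\<in>UNIV. nric a x $ b $ j * N x $ b) = 0" for a
  proof -
    have "(nric a x *v N x) $ j = 0"
      by (simp add: B_N x flip: g_B matrix_vector_mul_assoc)
    then show ?thesis by (simp add: matrix_vector_mult_def nric_sym[OF x, of a j])
  qed
  have "g x *v (divR j x *v N x) = - (\<Sum>b\<in>UNIV. N x $ b *\<^sub>R (nric b x *v axis j 1))"
  proof (rule vec_eqI)
    fix a
    have "(g x *v (divR j x *v N x)) $ a = (\<Sum>b\<in>UNIV. (g x ** divR j x) $ a $ b * N x $ b)"
      by (simp add: matrix_vector_mul_assoc) (simp add: matrix_vector_mult_def)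
    also have "\<dots> = - (\<Sum>b\<in>UNIV. nric b x $ a $ j * N x $ b)"
      by (simp add: g_divR x left_diff_distrib sum_subtractf 0)
    finally show "(g x *v (divR j x *v N x)) $ a = (- (\<Sum>b\<in>UNIV. N x $ b *\<^sub>R (nric b x *v axis j 1))) $ a"
      by (simp add: matrix_vector_mult_basis column_def mult.commute)
  qed
  then have "q x *v (g x *v (divR j x *v N x)) = q x *v (- (\<Sum>b\<in>UNIV. N x $ b *\<^sub>R (nric b x *v axis j 1)))"
    by simp
  moreover have "q x *v (- (\<Sum>b\<in>UNIV. N x $ b *\<^sub>R (nric b x *v axis j 1)))
      = - (\<Sum>b\<in>UNIV. N x $ b *\<^sub>R (B b x *v axis j 1))"
    by (simp add: B_eq x linear_neg[OF matrix_vector_mul_linear] linear_sum[OF matrix_vector_mul_linear]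
        linear_cmul[OF matrix_vector_mul_linear] matrix_vector_mul_assoc)
  ultimately show ?thesis by (simp add: matrix_vector_mul_assoc matrix_mul_assoc q_g x)
qed

text \<open>The Laplacian of the constant function \<open>|Ric|\<^sup>2\<close>. Curvature enters twice, once through the
  Ricci identity for \<open>\<nabla>\<^sub>m\<nabla>\<^sub>j\<rho>\<close> and once through \<open>R(\<sqdot>,\<sqdot>)\<nabla>f\<close>, with the same term.\<close>

lemma norm_B:
  assumes x: "x \<in> U"
  shows "(\<Sum>m\<in>UNIV. \<Sum>i\<in>UNIV. q x $ m $ i * trace (B m x ** B i x))
    = 2 * (\<Sum>m\<in>UNIV. \<Sum>j\<in>UNIV. (B j x ** B m x ** q x) $ m $ j)"
proof -
  define X where "X = (\<Sum>m\<in>UNIV. \<Sum>j\<in>UNIV. (\<rho> x ** Rm m j x ** H x ** q x) $ j $ m)"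
  define Q where "Q = (\<Sum>m\<in>UNIV. \<Sum>j\<in>UNIV. (B j x ** B m x ** q x) $ m $ j)"
  define T where "T = (\<Sum>m\<in>UNIV. \<Sum>j\<in>UNIV. (\<rho> x ** nB m j x ** q x) $ j $ m)"
  have mv: "(M *v axis k 1) $ l = M $ l $ k" for M :: "real^'n^'n" and k l
    by (simp add: matrix_vector_mult_basis column_def)
  have T_X: "T = - X"
  proof -
    \<comment> \<open>Under \<open>\<rho>\<close> from the left, \<open>\<rho>_\<rho>\<close> turns
      the commutator of \<open>Rm m j\<close> and \<open>\<rho>\<close> into
      \<open>- (\<rho> ** Rm m j ** H)\<close>. The exchanged second derivative drops out because
      \<open>\<rho>\<close> is divergence free.\<close>
    have comm: "\<rho> x ** nB m j x ** q x = \<rho> x ** (nB j m x ** q x) - \<rho> x ** Rm m j x ** H x ** q x" for m j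
    proof -
      have "nB m j x = nB j m x + (Rm m j x ** \<rho> x - \<rho> x ** Rm m j x)"
        using nB_commute[OF x, of m j] by (simp add: algebra_simps)
      moreover have "\<rho> x ** \<rho> x ** Rm m j x = lam *\<^sub>R (\<rho> x ** Rm m j x)"
        by (simp add: \<rho>_\<rho> x matrix_distribs)
      ultimately show ?thesis
        by (simp add: H_def matrix_distribs matrix_mul_assoc)
    qed
    have "(\<Sum>m\<in>UNIV. \<Sum>j\<in>UNIV. (\<rho> x ** (nB j m x ** q x)) $ j $ m)
        = (\<Sum>j\<in>UNIV. \<Sum>m\<in>UNIV. (\<rho> x ** (nB j m x ** q x)) $ j $ m)" by (rule sum.swap)
    also have "\<dots> = (\<Sum>j\<in>UNIV. \<Sum>p\<in>UNIV. \<rho> x $ j $ p * (\<Sum>m\<in>UNIV. (nB j m x ** q x) $ p $ m))"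
      unfolding matrix_mult_nth[of "\<rho> x"] sum_distrib_left by (rule sum.cong[OF refl]) (rule sum.swap)
    finally show ?thesis
      by (simp add: T_def X_def comm sum_subtractf div_nB_q x)
  qed
  have T_Q: "T = - Q"
  proof -
    \<comment> \<open>Transposition moves \<open>\<rho>\<close> to the right of \<open>nB\<close>,
      into the form evaluated by \<open>div_nB_\<rho>_q\<close>.\<close>
    have "q x ** transpose (\<rho> x) = \<rho> x ** q x"
      by (simp add: \<rho>_def matrix_transpose_mul sym_q sym_ric x matrix_mul_assoc)
    then have "transpose (\<rho> x ** (nB m j x ** q x)) = nB m j x ** \<rho> x ** q x" for m j
      by (simp add: matrix_transpose_mul[of "\<rho> x"] nB_q_sym x flip: matrix_mul_assoc)
    from arg_cong[OF this, of "\<lambda>A. A $ m $ j" for m j]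
    have "(\<rho> x ** nB m j x ** q x) $ j $ m = (nB m j x ** \<rho> x ** q x) $ m $ j" for m j
      by (simp add: transpose_def matrix_mul_assoc)
    then show ?thesis by (simp add: T_def Q_def div_nB_\<rho>_q x sum_negf)
  qed
  \<comment> \<open>Summing over \<open>m\<close> and \<open>i\<close> produces \<open>divR\<close>,
    so by \<open>divR_N\<close> this term is a combination of the traces of
    \<open>\<rho> ** B b\<close>, which are zero.\<close>
  have T3: "(\<Sum>m\<in>UNIV. \<Sum>i\<in>UNIV. \<Sum>j\<in>UNIV. q x $ m $ i * (\<rho> x *v (nR m i j x *v N x)) $ j) = 0"
  proof -
    have lin: "(\<rho> x *v (divR j x *v N x)) $ j = (\<Sum>m\<in>UNIV. \<Sum>i\<in>UNIV. q x $ m $ i * (\<rho> x *v (nR m i j x *v N x)) $ j)" for j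
      by (simp add: divR_def matrix_vector_sum_left linear_sum[OF matrix_vector_mul_linear]
          linear_cmul[OF matrix_vector_mul_linear] flip: scaleR_matrix_vector_assoc)
    have "(\<Sum>m\<in>UNIV. \<Sum>i\<in>UNIV. \<Sum>j\<in>UNIV. q x $ m $ i * (\<rho> x *v (nR m i j x *v N x)) $ j)
        = (\<Sum>m\<in>UNIV. \<Sum>j\<in>UNIV. \<Sum>i\<in>UNIV. q x $ m $ i * (\<rho> x *v (nR m i j x *v N x)) $ j)"
      by (rule sum.cong[OF refl]) (rule sum.swap)
    also have "\<dots> = (\<Sum>j\<in>UNIV. (\<rho> x *v (divR j x *v N x)) $ j)"
      unfolding lin by (rule sum.swap)
    also have "\<dots> = (\<Sum>j\<in>UNIV. \<Sum>b\<in>UNIV. - (N x $ b * (\<rho> x ** B b x) $ j $ j))"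
      by (simp add: divR_N x linear_neg[OF matrix_vector_mul_linear] linear_sum[OF matrix_vector_mul_linear]
        linear_cmul[OF matrix_vector_mul_linear] matrix_vector_mul_assoc mv sum_negf)
    also have "\<dots> = (\<Sum>b\<in>UNIV. - (N x $ b * trace (\<rho> x ** B b x)))"
      by (subst sum.swap) (simp add: trace_def sum_distrib_left sum_negf)
    finally show ?thesis by (simp add: trace_\<rho>_B x)
  qed
  have T4: "(\<Sum>m\<in>UNIV. \<Sum>i\<in>UNIV. \<Sum>j\<in>UNIV. q x $ m $ i * (\<rho> x *v (Rm i j x *v (H x *v axis m 1))) $ j) = X"
  proof -
    have "q x $ m $ i * (\<rho> x *v (Rm i j x *v (H x *v axis m 1))) $ j = (\<rho> x ** Rm i j x ** H x) $ j $ m * q x $ m $ i" for m i j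
      by (simp add: matrix_vector_mul_assoc mv matrix_mul_assoc)
    then have "(\<Sum>m\<in>UNIV. \<Sum>i\<in>UNIV. \<Sum>j\<in>UNIV. q x $ m $ i * (\<rho> x *v (Rm i j x *v (H x *v axis m 1))) $ j)
        = (\<Sum>i\<in>UNIV. \<Sum>m\<in>UNIV. \<Sum>j\<in>UNIV. (\<rho> x ** Rm i j x ** H x) $ j $ m * q x $ m $ i)"
      by (simp only:) (rule sum.swap)
    also have "\<dots> = X" unfolding X_def matrix_mult_nth[of _ "q x"]
      by (rule sum.cong[OF refl]) (rule sum.swap)
    finally show ?thesis .
  qed
  have T2: "(\<Sum>m\<in>UNIV. \<Sum>i\<in>UNIV. \<Sum>j\<in>UNIV. q x $ m $ i * (\<rho> x *v (nB m j x *v axis i 1)) $ j) = T"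
  proof -
    have "(\<Sum>i\<in>UNIV. \<Sum>j\<in>UNIV. q x $ m $ i * (\<rho> x *v (nB m j x *v axis i 1)) $ j)
        = (\<Sum>j\<in>UNIV. (\<rho> x ** nB m j x ** q x) $ j $ m)" for m
      unfolding matrix_mult_nth[of _ "q x"]
      by (subst sum.swap) (simp add: matrix_vector_mul_assoc mv sym_q_nth[OF x, of m] mult.commute)
    then show ?thesis by (simp add: T_def)
  qed
  have T1: "(\<Sum>m\<in>UNIV. \<Sum>i\<in>UNIV. \<Sum>j\<in>UNIV. q x $ m $ i * (\<rho> x *v (nB m i x *v axis j 1)) $ j)
      = - (\<Sum>m\<in>UNIV. \<Sum>i\<in>UNIV. q x $ m $ i * trace (B m x ** B i x))"
  proof -
    have "(\<Sum>j\<in>UNIV. q x $ m $ i * (\<rho> x *v (nB m i x *v axis j 1)) $ j) = q x $ m $ i * trace (\<rho> x ** nB m i x)" for m i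
      by (simp add: matrix_vector_mul_assoc mv trace_def sum_distrib_left)
    then show ?thesis by (simp add: trace_\<rho>_nB x sum_negf)
  qed
  have "(\<rho> x *v (nB m i x *v axis j 1)) $ j - (\<rho> x *v (nB m j x *v axis i 1)) $ j
      = - (\<rho> x *v (nR m i j x *v N x)) $ j - (\<rho> x *v (Rm i j x *v (H x *v axis m 1))) $ j" for m i j
    using arg_cong[OF nB_exchange[OF x, of m i j], of "\<lambda>v. (\<rho> x *v v) $ j"]
    by (simp add: matrix_vector_mult_diff_distrib linear_neg[OF matrix_vector_mul_linear])
  then have "(\<Sum>m\<in>UNIV. \<Sum>i\<in>UNIV. \<Sum>j\<in>UNIV. q x $ m $ i * ((\<rho> x *v (nB m i x *v axis j 1)) $ j - (\<rho> x *v (nB m j x *v axis i 1)) $ j))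
     = (\<Sum>m\<in>UNIV. \<Sum>i\<in>UNIV. \<Sum>j\<in>UNIV. q x $ m $ i * (- (\<rho> x *v (nR m i j x *v N x)) $ j - (\<rho> x *v (Rm i j x *v (H x *v axis m 1))) $ j))"
    by (simp only:)
  \<comment> \<open>With \<open>T = - X\<close> the norm equals \<open>- 2 * T\<close>, and
    \<open>T = - Q\<close> makes it \<open>2 * Q\<close>: the factor 2 records the two occurrences
    of the curvature term.\<close>
  then have "- (\<Sum>m\<in>UNIV. \<Sum>i\<in>UNIV. q x $ m $ i * trace (B m x ** B i x)) - T = - X"
    by (simp only: right_diff_distrib mult_minus_right sum_subtractf sum_negf T1 T2 T3 T4)
  then show ?thesis using T_X T_Q by (simp add: Q_def)
qed

text \<open>A tight frame consisting of eigenvectors of the Ricci endomorphism: decompose the inverse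
  metric along kernel and image of \<open>\<rho>\<close>.\<close>

lemma eigenframe:
  assumes x: "x \<in> U"
  obtains w :: "'n + 'n \<Rightarrow> real^'n" where
    "\<And>a b. q x $ a $ b = (\<Sum>\<alpha>\<in>UNIV. w \<alpha> $ a * w \<alpha> $ b)"
    "\<And>\<alpha>. isl \<alpha> \<Longrightarrow> \<rho> x *v w \<alpha> = 0" "\<And>\<alpha>. \<not> isl \<alpha> \<Longrightarrow> \<rho> x *v w \<alpha> = lam *\<^sub>R w \<alpha>"
proof -
  define P where "P = (1 / lam) *\<^sub>R \<rho> x"
  have PP: "P ** P = P" using lam by (simp add: P_def matrix_distribs \<rho>_\<rho> x)
  have Pq: "q x ** transpose P = P ** q x"
    by (simp add: P_def \<rho>_def matrix_transpose_mul transpose_linear matrix_distribs sym_q sym_ric x matrix_mul_assoc)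
  \<comment> \<open>A projection \<open>C\<close> that is self-adjoint for the metric satisfies
    \<open>C ** q = C ** q ** transpose C\<close>, which is semidefinite. This is used for the
    projections onto kernel and image.\<close>
  have psd: "\<exists>w::'n \<Rightarrow> real^'n. \<forall>a b. (C ** q x) $ a $ b = (\<Sum>k\<in>UNIV. w k $ a * w k $ b)"
    if CC: "C ** C = C" and Cq: "q x ** transpose C = C ** q x" for C
  proof -
    have sym: "transpose (C ** q x) = C ** q x" using Cq by (simp add: matrix_transpose_mul sym_q x)
    have "C ** q x = C ** (C ** q x)" by (simp add: matrix_mul_assoc CC)
    also have "\<dots> = C ** q x ** transpose C" by (simp add: Cq[symmetric] matrix_mul_assoc)
    finally have e: "C ** q x = C ** q x ** transpose C" .
    have "v \<bullet> ((C ** q x) *v v) = (transpose C *v v) \<bullet> (q x *v (transpose C *v v))" for v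
      by (subst e, simp only: inner_transpose[of v C, symmetric] matrix_vector_mul_assoc matrix_mul_assoc)
    moreover have "0 \<le> v \<bullet> (q x *v v)" for v using pos_q[OF x, of v] by (cases "v = 0") auto
    ultimately have "0 \<le> v \<bullet> ((C ** q x) *v v)" for v by (simp only:)
    then show ?thesis by (rule psd_sum_of_squares[OF sym]) blast
  qed
  have "(mat 1 - P) ** (mat 1 - P) = mat 1 - P" by (simp add: matrix_distribs PP)
  moreover have "q x ** transpose (mat 1 - P) = (mat 1 - P) ** q x"
    by (simp add: transpose_linear matrix_distribs Pq)
  ultimately obtain k :: "'n \<Rightarrow> real^'n" where k: "\<And>a b. ((mat 1 - P) ** q x) $ a $ b = (\<Sum>c\<in>UNIV. k c $ a * k c $ b)"
    using psd by blast
  obtain l :: "'n \<Rightarrow> real^'n" where l: "\<And>a b. (P ** q x) $ a $ b = (\<Sum>c\<in>UNIV. l c $ a * l c $ b)"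
    using psd[OF PP Pq] by blast
  have Pk: "P *v k c = 0" for c
    by (rule sum_of_squares_kernel[OF k]) (simp add: matrix_mul_assoc matrix_distribs PP)
  have Pl: "(mat 1 - P) *v l c = 0" for c
    by (rule sum_of_squares_kernel[OF l]) (simp add: matrix_mul_assoc matrix_distribs PP)
  have \<rho>P: "\<rho> x *v v = lam *\<^sub>R (P *v v)" for v
    using lam by (simp add: P_def flip: scaleR_matrix_vector_assoc)
  show ?thesis
  \<comment> \<open>Each half supplies as many vectors as there are coordinates, some of them
    possibly zero, and \<open>isl\<close> records the kernel half.\<close>
  proof (rule that[of "case_sum k l"])
    show "q x $ a $ b = (\<Sum>\<alpha>\<in>UNIV. case_sum k l \<alpha> $ a * case_sum k l \<alpha> $ b)" for a b
    proof -
      have "q x = (mat 1 - P) ** q x + P ** q x" by (simp add: matrix_distribs)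
      from arg_cong[OF this, of "\<lambda>A. A $ a $ b"] show ?thesis
        by (simp add: k l UNIV_Plus_UNIV[symmetric] sum.Plus del: UNIV_Plus_UNIV)
    qed
    show "\<rho> x *v case_sum k l \<alpha> = 0" if "isl \<alpha>" for \<alpha>
      using that by (cases \<alpha>) (simp_all add: \<rho>P Pk)
    show "\<rho> x *v case_sum k l \<alpha> = lam *\<^sub>R case_sum k l \<alpha>" if "\<not> isl \<alpha>" for \<alpha>
      using that Pl by (cases \<alpha>) (simp_all add: \<rho>P matrix_vector_mult_diff_rdistrib)
  qed
qed

text \<open>By \<open>norm_B\<close> the kernel of \<open>\<rho>\<close> is integrable, which makes it invariant under the flow of
  the gradient; hence \<open>\<rho>\<close> is parallel along the gradient.\<close>

lemma B_along_N:
  assumes x: "x \<in> U"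
  shows "(\<Sum>i\<in>UNIV. N x $ i *\<^sub>R B i x) = 0"
proof -
  obtain w :: "'n + 'n \<Rightarrow> real^'n" where
    w: "\<And>a b. q x $ a $ b = (\<Sum>\<alpha>\<in>UNIV. w \<alpha> $ a * w \<alpha> $ b)"
    and w0: "\<And>\<alpha>. isl \<alpha> \<Longrightarrow> \<rho> x *v w \<alpha> = 0"
    and w1: "\<And>\<alpha>. \<not> isl \<alpha> \<Longrightarrow> \<rho> x *v w \<alpha> = lam *\<^sub>R w \<alpha>"
    using eigenframe[OF x] by blast
  define ip where "ip y z = y \<bullet> (g x *v z)" for y z
  define BB where "BB v = (\<Sum>i\<in>UNIV. v $ i *\<^sub>R B i x)" for v :: "real^'n"
  define b where "b \<alpha> \<beta> \<gamma> = ip (w \<gamma>) (BB (w \<alpha>) *v w \<beta>)" for \<alpha> \<beta> \<gamma>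
  have ip_sym: "ip y z = ip z y" for y z unfolding ip_def by (rule inner_symmetric[OF sym_g[OF x]])
  have ip_lin: "linear (ip y)" for y
    unfolding ip_def by (rule linearI) (simp_all add: inner_add_right algebra_simps)
  \<comment> \<open>\<open>q ** g = mat 1\<close> read as a resolution of the identity. The vectors
    may be dependent, yet expansions and traces take the same form as in an orthonormal
    basis.\<close>
  have frame: "y = (\<Sum>\<alpha>\<in>UNIV. ip (w \<alpha>) y *\<^sub>R w \<alpha>)" for y
  proof (rule vec_eqI)
    fix a
    have "y $ a = (q x *v (g x *v y)) $ a" by (simp add: matrix_vector_mul_assoc q_g x)
    also have "\<dots> = (\<Sum>c\<in>UNIV. \<Sum>\<alpha>\<in>UNIV. w \<alpha> $ a * w \<alpha> $ c * (g x *v y) $ c)"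
      by (simp add: matrix_vector_mult_def[of "q x"] w sum_distrib_right)
    also have "\<dots> = (\<Sum>\<alpha>\<in>UNIV. \<Sum>c\<in>UNIV. w \<alpha> $ a * w \<alpha> $ c * (g x *v y) $ c)" by (rule sum.swap)
    also have "\<dots> = (\<Sum>\<alpha>\<in>UNIV. ip (w \<alpha>) y *\<^sub>R w \<alpha>) $ a"
      by (simp add: ip_def inner_vec_def sum_distrib_left sum_distrib_right mult_ac)
    finally show "y $ a = (\<Sum>\<alpha>\<in>UNIV. ip (w \<alpha>) y *\<^sub>R w \<alpha>) $ a" .
  qed
  have zeroI: "y = 0" if "\<And>\<alpha>. ip (w \<alpha>) y = 0" for y
    using frame[of y] by (simp add: that)
  have parseval: "ip y z = (\<Sum>\<gamma>\<in>UNIV. ip (w \<gamma>) y * ip (w \<gamma>) z)" for y z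
    by (subst frame[of z]) (simp add: linear_sum[OF ip_lin] linear_cmul[OF ip_lin] ip_sym[of y] mult.commute)
  have contract: "(\<Sum>m\<in>UNIV. (M m *v v) $ m) = (\<Sum>\<beta>\<in>UNIV. ip (w \<beta>) ((\<Sum>m\<in>UNIV. w \<beta> $ m *\<^sub>R M m) *v v))"
    for M :: "'n \<Rightarrow> real^'n^'n" and v
  proof -
    have "(M m *v v) $ m = (\<Sum>\<beta>\<in>UNIV. w \<beta> $ m * ip (w \<beta>) (M m *v v))" for m
      using arg_cong[OF frame[of "M m *v v"], of "\<lambda>v. v $ m"] by (simp add: mult.commute)
    then have "(\<Sum>m\<in>UNIV. (M m *v v) $ m) = (\<Sum>\<beta>\<in>UNIV. \<Sum>m\<in>UNIV. w \<beta> $ m * ip (w \<beta>) (M m *v v))"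
      by (simp only:) (rule sum.swap)
    then show ?thesis
      by (simp add: matrix_vector_sum_left linear_sum[OF ip_lin] linear_cmul[OF ip_lin]
          flip: scaleR_matrix_vector_assoc)
  qed
  have trace_frame: "trace M = (\<Sum>\<beta>\<in>UNIV. ip (w \<beta>) (M *v w \<beta>))" for M :: "real^'n^'n"
  proof -
    have "M $ m $ m = (\<Sum>\<beta>\<in>UNIV. w \<beta> $ m * ip (w \<beta>) (M *v axis m 1))" for m
      using arg_cong[OF frame[of "M *v axis m 1"], of "\<lambda>v. v $ m"]
      by (simp add: matrix_vector_mult_basis column_def mult.commute)
    then have "trace M = (\<Sum>\<beta>\<in>UNIV. \<Sum>m\<in>UNIV. w \<beta> $ m * ip (w \<beta>) (M *v axis m 1))"
      unfolding trace_def by (simp only:) (rule sum.swap)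
    also have "\<dots> = (\<Sum>\<beta>\<in>UNIV. ip (w \<beta>) (M *v (\<Sum>m\<in>UNIV. w \<beta> $ m *\<^sub>R axis m 1)))"
      by (simp add: linear_sum[OF ip_lin] linear_cmul[OF ip_lin] linear_sum[OF matrix_vector_mul_linear]
          linear_cmul[OF matrix_vector_mul_linear])
    finally show ?thesis by (simp flip: vec_eq_sum_axis)
  qed
  have g_symmetric: "transpose (BB v) ** g x = g x ** BB v" for v
  proof -
    have "transpose (\<Sum>i\<in>I. v $ i *\<^sub>R B i x) ** g x = g x ** (\<Sum>i\<in>I. v $ i *\<^sub>R B i x)" for I
    proof (induction I rule: infinite_finite_induct)
      case (insert a I)
      then show ?case by (simp add: matrix_distribs transpose_linear g_symmetric_B x)
    qed (simp_all add: vec_eq_iff transpose_def matrix_matrix_mult_def)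
    then show ?thesis by (simp add: BB_def)
  qed
  have self_adj: "ip y (M *v z) = ip (M *v y) z" if "transpose M ** g x = g x ** M" for M y z
    using inner_transpose[of y "transpose M" "g x *v z"]
    by (simp only: ip_def matrix_vector_mul_assoc that transpose_transpose)
  note BB_adj = self_adj[OF g_symmetric]
  have "transpose (g x ** \<rho> x) = g x ** \<rho> x" by (simp add: g_\<rho> sym_ric x)
  then have \<rho>_adj: "ip y (\<rho> x *v z) = ip (\<rho> x *v y) z" for y z
    by (intro self_adj) (simp add: matrix_transpose_mul sym_g x)
  have b_sym: "b \<alpha> \<beta> \<gamma> = b \<alpha> \<gamma> \<beta>" for \<alpha> \<beta> \<gamma>
    unfolding b_def by (rule trans[OF BB_adj ip_sym])
  have \<rho>_BB: "\<rho> x *v (BB u *v v) = lam *\<^sub>R (BB u *v v) - BB u *v (\<rho> x *v v)" for u v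
  proof -
    have "\<rho> x ** BB u = lam *\<^sub>R BB u - BB u ** \<rho> x"
      by (simp add: BB_def matrix_sum_left matrix_sum_right matrix_distribs \<rho>_B x scaleR_diff_right
          sum_subtractf scaleR_sum_right mult.commute)
    then show ?thesis
      by (simp add: matrix_vector_mul_assoc matrix_vector_mult_diff_rdistrib scaleR_matrix_vector_assoc)
  qed
  \<comment> \<open>\<open>\<rho> B + B \<rho> = lam B\<close> would count \<open>b\<close> with
    factor 0 if both vectors lie in the kernel and with factor 2 if both lie in the image, instead
    of once.\<close>
  have b_zero: "b \<alpha> \<beta> \<gamma> = 0" if "isl \<beta> = isl \<gamma>" for \<alpha> \<beta> \<gamma>
  proof -
    have "lam * b \<alpha> \<beta> \<gamma> = ip (w \<gamma>) (\<rho> x *v (BB (w \<alpha>) *v w \<beta>)) + ip (w \<gamma>) (BB (w \<alpha>) *v (\<rho> x *v w \<beta>))"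
      by (simp add: \<rho>_BB b_def linear_diff[OF ip_lin] linear_cmul[OF ip_lin])
    moreover have "ip (w \<gamma>) (\<rho> x *v (BB (w \<alpha>) *v w \<beta>)) = (if isl \<gamma> then 0 else lam * b \<alpha> \<beta> \<gamma>)"
      unfolding \<rho>_adj using w0 w1 by (simp add: b_def ip_def)
    moreover have "ip (w \<gamma>) (BB (w \<alpha>) *v (\<rho> x *v w \<beta>)) = (if isl \<beta> then 0 else lam * b \<alpha> \<beta> \<gamma>)"
      using w0 w1 by (simp add: b_def ip_def matrix_vector_mult_scaleR)
    ultimately show ?thesis using lam that by (auto split: if_splits)
  qed
  have norm1: "(\<Sum>m\<in>UNIV. \<Sum>i\<in>UNIV. q x $ m $ i * trace (B m x ** B i x))
      = (\<Sum>\<alpha>\<in>UNIV. \<Sum>\<beta>\<in>UNIV. \<Sum>\<gamma>\<in>UNIV. (b \<alpha> \<beta> \<gamma>)\<^sup>2)"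
  proof -
    have l: "linear (trace :: real^'n^'n \<Rightarrow> real)" by (rule bounded_linear.linear[OF bounded_linear_trace])
    have tr: "trace (BB u ** M) = (\<Sum>m\<in>UNIV. u $ m * trace (B m x ** M))"
      "trace (M ** BB u) = (\<Sum>i\<in>UNIV. u $ i * trace (M ** B i x))" for u M
      by (simp_all add: BB_def matrix_sum_left matrix_sum_right matrix_distribs linear_sum[OF l] linear_cmul[OF l])
    have "trace (BB u ** BB u) = (\<Sum>m\<in>UNIV. \<Sum>i\<in>UNIV. u $ m * u $ i * trace (B m x ** B i x))" for u
      unfolding tr(1)[of u "BB u"] unfolding tr(2) by (simp add: sum_distrib_left mult.assoc)
    moreover have "trace (BB u ** BB u) = (\<Sum>\<beta>\<in>UNIV. \<Sum>\<gamma>\<in>UNIV. (ip (w \<gamma>) (BB u *v w \<beta>))\<^sup>2)" for u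
    proof -
      have "ip (w \<beta>) ((BB u ** BB u) *v w \<beta>) = (\<Sum>\<gamma>\<in>UNIV. (ip (w \<gamma>) (BB u *v w \<beta>))\<^sup>2)" for \<beta>
      proof -
        have "ip (BB u *v w \<beta>) (BB u *v w \<beta>) = ip (w \<beta>) ((BB u ** BB u) *v w \<beta>)"
          by (simp only: BB_adj[symmetric] matrix_vector_mul_assoc)
        then show ?thesis using parseval[of "BB u *v w \<beta>" "BB u *v w \<beta>"] by (simp only: power2_eq_square)
      qed
      then show ?thesis by (simp only: trace_frame)
    qed
    ultimately have eq: "(\<Sum>m\<in>UNIV. \<Sum>i\<in>UNIV. u $ m * u $ i * trace (B m x ** B i x))
        = (\<Sum>\<beta>\<in>UNIV. \<Sum>\<gamma>\<in>UNIV. (ip (w \<gamma>) (BB u *v w \<beta>))\<^sup>2)" for u by simp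
    have "(\<Sum>m\<in>UNIV. \<Sum>i\<in>UNIV. q x $ m $ i * trace (B m x ** B i x))
      = (\<Sum>m\<in>UNIV. \<Sum>\<alpha>\<in>UNIV. \<Sum>i\<in>UNIV. w \<alpha> $ m * w \<alpha> $ i * trace (B m x ** B i x))"
      unfolding w sum_distrib_right by (rule sum.cong[OF refl]) (rule sum.swap)
    also have "\<dots> = (\<Sum>\<alpha>\<in>UNIV. \<Sum>m\<in>UNIV. \<Sum>i\<in>UNIV. w \<alpha> $ m * w \<alpha> $ i * trace (B m x ** B i x))"
      by (rule sum.swap)
    finally show ?thesis by (simp only: eq b_def)
  qed
  have norm2: "(\<Sum>m\<in>UNIV. \<Sum>j\<in>UNIV. (B j x ** B m x ** q x) $ m $ j)
      = (\<Sum>\<alpha>\<in>UNIV. \<Sum>\<beta>\<in>UNIV. \<Sum>\<gamma>\<in>UNIV. b \<alpha> \<beta> \<gamma> * b \<beta> \<alpha> \<gamma>)"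
  proof -
    have 1: "(M ** q x) $ m $ j = (\<Sum>\<alpha>\<in>UNIV. w \<alpha> $ j * (M *v w \<alpha>) $ m)" for M :: "real^'n^'n" and m j
    proof -
      have "(M ** q x) $ m $ j = (\<Sum>p\<in>UNIV. \<Sum>\<alpha>\<in>UNIV. M $ m $ p * (w \<alpha> $ p * w \<alpha> $ j))"
        by (simp add: matrix_mult_nth w sum_distrib_left)
      also have "\<dots> = (\<Sum>\<alpha>\<in>UNIV. \<Sum>p\<in>UNIV. M $ m $ p * (w \<alpha> $ p * w \<alpha> $ j))" by (rule sum.swap)
      finally show ?thesis by (simp add: matrix_vector_mult_def sum_distrib_left mult_ac)
    qed
    have 2: "(\<Sum>j\<in>UNIV. w \<alpha> $ j * ((B j x ** B m x) *v w \<alpha>) $ m) = ((BB (w \<alpha>) ** B m x) *v w \<alpha>) $ m" for \<alpha> m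
      by (simp add: BB_def matrix_sum_left matrix_distribs matrix_vector_sum_left flip: scaleR_matrix_vector_assoc)
    have "(\<Sum>m\<in>UNIV. \<Sum>j\<in>UNIV. (B j x ** B m x ** q x) $ m $ j)
        = (\<Sum>m\<in>UNIV. \<Sum>\<alpha>\<in>UNIV. \<Sum>j\<in>UNIV. w \<alpha> $ j * ((B j x ** B m x) *v w \<alpha>) $ m)"
      unfolding 1 by (rule sum.cong[OF refl]) (rule sum.swap)
    also have "\<dots> = (\<Sum>\<alpha>\<in>UNIV. \<Sum>m\<in>UNIV. ((BB (w \<alpha>) ** B m x) *v w \<alpha>) $ m)"
      unfolding 2 by (rule sum.swap)
    also have "\<dots> = (\<Sum>\<alpha>\<in>UNIV. \<Sum>\<beta>\<in>UNIV. ip (w \<beta>) ((BB (w \<alpha>) ** BB (w \<beta>)) *v w \<alpha>))"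
      unfolding contract by (simp add: BB_def[of "w _"] matrix_sum_right matrix_distribs)
    also have "\<dots> = (\<Sum>\<alpha>\<in>UNIV. \<Sum>\<beta>\<in>UNIV. ip (BB (w \<alpha>) *v w \<beta>) (BB (w \<beta>) *v w \<alpha>))"
      by (simp only: BB_adj[symmetric] matrix_vector_mul_assoc)
    finally show ?thesis by (simp only: parseval[of "BB _ *v _"] b_def)
  qed
  \<comment> \<open>\<open>norm_B\<close>, expressed in the frame, is the hypothesis of
    \<open>two_kinds_symmetric\<close>; for two kernel indices the result is integrability of the
    kernel.\<close>
  have swap: "b \<alpha> \<beta> \<gamma> = b \<beta> \<alpha> \<gamma>" if "isl \<alpha>" "isl \<beta>" for \<alpha> \<beta> \<gamma>
    by (rule two_kinds_symmetric[of b isl]) (use that b_sym b_zero norm_B[OF x] in \<open>simp_all add: norm1 norm2\<close>)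
  define c where "c \<alpha> = ip (w \<alpha>) (N x)" for \<alpha>
  have c0: "c \<alpha> = 0" if "\<not> isl \<alpha>" for \<alpha>
  proof -
    have "lam * c \<alpha> = ip (\<rho> x *v w \<alpha>) (N x)" by (simp add: c_def w1[OF that] ip_def)
    also have "\<dots> = ip (w \<alpha>) (\<rho> x *v N x)" by (rule \<rho>_adj[symmetric])
    also have "\<dots> = 0" by (simp add: \<rho>_N x ip_def)
    finally show ?thesis using lam by simp
  qed
  have BB_N: "ip (w \<gamma>) (BB (N x) *v v) = (\<Sum>\<alpha>\<in>UNIV. c \<alpha> * ip (w \<gamma>) (BB (w \<alpha>) *v v))" for \<gamma> v
  proof -
    have l: "linear (\<lambda>u. ip (w \<gamma>) (BB u *v v))"
      unfolding BB_def by (rule linearI)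
        (simp_all add: matrix_vector_sum_left linear_add[OF ip_lin] linear_sum[OF ip_lin] linear_cmul[OF ip_lin] sum.distrib
          algebra_simps sum_distrib_left flip: scaleR_matrix_vector_assoc)
    show ?thesis by (subst frame[of "N x"]) (simp add: c_def linear_sum[OF l] linear_cmul[OF l])
  qed
  \<comment> \<open>By \<open>c0\<close> only kernel vectors occur in the expansion of
    \<open>N\<close>, so \<open>swap\<close> trades the derivative along \<open>N\<close> on
    \<open>w \<beta>\<close> for the one along \<open>w \<beta>\<close> on \<open>N\<close>, which
    \<open>B_N\<close> kills.\<close>
  have on_ker: "ip (w \<gamma>) (BB (N x) *v w \<beta>) = 0" if "isl \<beta>" for \<beta> \<gamma>
  proof -
    have "ip (w \<gamma>) (BB (N x) *v w \<beta>) = (\<Sum>\<alpha>\<in>UNIV. c \<alpha> * b \<beta> \<alpha> \<gamma>)"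
      unfolding BB_N by (rule sum.cong[OF refl]) (use c0 swap[OF _ that] in \<open>auto simp: b_def\<close>)
    also have "\<dots> = ip (w \<gamma>) (BB (w \<beta>) *v (\<Sum>\<alpha>\<in>UNIV. c \<alpha> *\<^sub>R w \<alpha>))"
      by (simp add: b_def linear_sum[OF ip_lin] linear_cmul[OF ip_lin] linear_sum[OF matrix_vector_mul_linear]
          linear_cmul[OF matrix_vector_mul_linear])
    also have "(\<Sum>\<alpha>\<in>UNIV. c \<alpha> *\<^sub>R w \<alpha>) = N x" using frame[of "N x"] by (simp add: c_def)
    also have "BB (w \<beta>) *v N x = 0"
      by (simp add: BB_def matrix_vector_sum_left B_N x flip: scaleR_matrix_vector_assoc)
    finally show ?thesis by (simp add: ip_def)
  qed
  have "ip (w \<gamma>) (BB (N x) *v w \<beta>) = 0" for \<beta> \<gamma>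
  proof (cases "isl \<beta> = isl \<gamma>")
    case True
    then show ?thesis using b_zero[OF True] by (simp add: BB_N b_def)
  next
    case False
    show ?thesis
    proof (cases "isl \<beta>")
      case True
      then show ?thesis by (rule on_ker)
    next
      case False
      then have "isl \<gamma>" using \<open>isl \<beta> \<noteq> isl \<gamma>\<close> by simp
      have "ip (w \<gamma>) (BB (N x) *v w \<beta>) = ip (w \<beta>) (BB (N x) *v w \<gamma>)"
        by (rule trans[OF BB_adj ip_sym])
      also have "\<dots> = 0" by (rule on_ker[OF \<open>isl \<gamma>\<close>])
      finally show ?thesis .
    qed
  qed
  then have BBw: "BB (N x) *v w \<beta> = 0" for \<beta> by (intro zeroI)
  have "BB (N x) *v y = 0" for y
    by (subst frame[of y]) (simp add: linear_sum[OF matrix_vector_mul_linear] linear_cmul[OF matrix_vector_mul_linear] BBw)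
  then show ?thesis unfolding BB_def[symmetric] by (simp add: matrix_eq)
qed

lemma radially_flat_split:
  assumes x: "x \<in> U"
  shows "radial_sec g F E x = 0"
proof -
  have "radial x $ l $ i = 0" for l i
  proof -
    have "radial x $ l $ i = (\<Sum>j\<in>UNIV. N x $ j * B j x $ l $ i) - (\<Sum>j\<in>UNIV. B i x $ l $ j * N x $ j)"
      by (simp add: radial_def Rm_N x matrix_vector_mult_basis column_def algebra_simps sum_subtractf)
    also have "(\<Sum>j\<in>UNIV. N x $ j * B j x $ l $ i) = (\<Sum>j\<in>UNIV. N x $ j *\<^sub>R B j x) $ l $ i" by simp
    also have "\<dots> = 0" by (simp add: B_along_N x)
    also have "(\<Sum>j\<in>UNIV. B i x $ l $ j * N x $ j) = (B i x *v N x) $ l" by (simp add: matrix_vector_mult_def)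
    finally show ?thesis by (simp add: B_N x)
  qed
  then have "radial x = 0" by (simp add: vec_eq_iff)
  then show ?thesis by (simp add: radial_sec_eq x)
qed

end

section \<open>Change of charts\<close>

locale chart_change = M1: chart_soliton U1 g1 F1 lam + M2: chart_soliton U2 g2 F2 lam
  for U1 U2 :: "(real^'n::finite) set" and g1 g2 F1 F2 lam +
  fixes V :: "(real^'n) set" and \<phi> :: "real^'n \<Rightarrow> real^'n" and T :: "real^'n \<Rightarrow> real^'n^'n"
  assumes open_V: "open V" and V_U1: "V \<subseteq> U1" and \<phi>_U2: "\<And>y. y \<in> V \<Longrightarrow> \<phi> y \<in> U2"
    and smooth_\<phi>: "smooth_on \<phi> V"
    and T: "\<And>y. T y = (\<chi> a i. pd i \<phi> y $ a)"
    and g_\<phi>: "\<And>y. y \<in> V \<Longrightarrow> g1 y = transpose (T y) ** g2 (\<phi> y) ** T y"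
    and F_\<phi>: "\<And>y. y \<in> V \<Longrightarrow> F1 y = F2 (\<phi> y)"
begin

lemma smooth_T: "smooth_on T V"
proof (rule smooth_on_mat[OF open_V])
  show "smooth_on (\<lambda>y. T y $ a $ i) V" for a i
    unfolding T by (simp add: smooth_on_linear[OF bounded_linear_vec_nth open_V] smooth_on_pd smooth_\<phi>)
qed

lemma differentiable_T: "y \<in> V \<Longrightarrow> T differentiable (at y)"
  and differentiable_\<phi>: "y \<in> V \<Longrightarrow> \<phi> differentiable (at y)"
  by (auto intro: smooth_on_imp_differentiable smooth_T smooth_\<phi>)

lemma differentiable_compose:
  "y \<in> V \<Longrightarrow> smooth_on h U2 \<Longrightarrow> (\<lambda>z. h (\<phi> z)) differentiable (at y)"
  using differentiable_chain_at[OF differentiable_\<phi>, of y h] smooth_on_imp_differentiable[of h U2] \<phi>_U2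
  by (simp add: comp_def)

lemma pd_\<phi>:
  assumes "y \<in> V" "smooth_on h U2"
  shows "pd i (\<lambda>z. h (\<phi> z)) y = (\<Sum>a\<in>UNIV. T y $ a $ i *\<^sub>R pd a h (\<phi> y))"
  using pd_compose[OF differentiable_\<phi>[OF assms(1)] smooth_on_imp_differentiable[OF assms(2) \<phi>_U2[OF assms(1)]]]
  by (simp add: T)

lemma invertible_T:
  assumes y: "y \<in> V"
  shows "invertible (T y)"
proof -
  have "v = 0" if "T y *v v = 0" for v
  proof (rule ccontr)
    assume "v \<noteq> 0"
    then have "0 < v \<bullet> (g1 y *v v)" using M1.pos_g V_U1 y by blast
    also have "g1 y *v v = 0" by (simp add: g_\<phi>[OF y] that flip: matrix_vector_mul_assoc)
    finally show False by simp
  qed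
  then show ?thesis by (simp add: invertible_left_inverse matrix_left_invertible_ker)
qed

lemma pd_T_sym: "y \<in> V \<Longrightarrow> pd i T y $ a $ k = pd k T y $ a $ i"
proof -
  assume y: "y \<in> V"
  have "pd i T y $ a $ k = pd i (\<lambda>z. T z $ a $ k) y" for i k
    by (rule pd_nth2[OF differentiable_T[OF y], symmetric])
  moreover have "pd i (\<lambda>z. pd k \<phi> z $ a) y = pd i (pd k \<phi>) y $ a" for i k
    by (rule pd_nth[OF smooth_on_imp_differentiable[OF smooth_on_pd[OF smooth_\<phi>] y]])
  ultimately show ?thesis using pd_commute[OF open_V smooth_\<phi> y, of i k] by (simp add: T)
qed

text \<open>The value of \<open>T ** \<Gamma>\<close> predicted by the transformation law of
  Christoffel symbols: second derivatives of the transition map plus the pulled-back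
  connection.\<close>

definition W :: "'n \<Rightarrow> real^'n \<Rightarrow> real^'n^'n" where
  "W i y = pd i T y + (\<Sum>a\<in>UNIV. T y $ a $ i *\<^sub>R M2.\<Gamma> a (\<phi> y)) ** T y"

lemma W_nth: "W i y $ b $ k = pd i T y $ b $ k + (\<Sum>a\<in>UNIV. \<Sum>c\<in>UNIV. T y $ a $ i * M2.\<Gamma> a (\<phi> y) $ b $ c * T y $ c $ k)"
  by (simp add: W_def matrix_sum_left matrix_distribs matrix_mult_nth sum_distrib_left mult.assoc)

lemma W_sym: "y \<in> V \<Longrightarrow> W i y $ b $ k = W k y $ b $ i"
proof -
  assume y: "y \<in> V"
  have "(\<Sum>a\<in>UNIV. \<Sum>c\<in>UNIV. T y $ a $ i * M2.\<Gamma> a (\<phi> y) $ b $ c * T y $ c $ k)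
      = (\<Sum>c\<in>UNIV. \<Sum>a\<in>UNIV. T y $ c $ k * M2.\<Gamma> c (\<phi> y) $ b $ a * T y $ a $ i)"
    by (subst sum.swap, intro sum.cong refl) (use M2.\<Gamma>_sym[OF \<phi>_U2[OF y]] in \<open>simp add: mult_ac\<close>)
  then show ?thesis using pd_T_sym[OF y] by (simp add: W_nth)
qed

text \<open>The candidate obtained from \<open>W\<close> by inverting \<open>T\<close> is symmetric
  and compatible with \<open>g1\<close>, so \<open>\<Gamma>_unique\<close> identifies it.\<close>

lemma T_\<Gamma>:
  assumes y: "y \<in> V"
  shows "T y ** M1.\<Gamma> i y = W i y"
proof -
  define R where "R = matrix_inv (T y)"
  have TR: "T y ** R = mat 1"
    using matrix_inv_inverse(1)[OF invertible_T[OF y]] by (simp add: R_def)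
  have y1: "y \<in> U1" using y V_U1 by blast
  have "M1.\<Gamma> i y = R ** W i y"
  proof (rule M1.\<Gamma>_unique[OF y1, of "\<lambda>i. R ** W i y"])
    show "(R ** W i y) $ l $ k = (R ** W k y) $ l $ i" for i l k
      by (simp add: matrix_mult_nth W_sym[OF y, of i _ k])
    fix i
    define Y where "Y = (\<Sum>a\<in>UNIV. T y $ a $ i *\<^sub>R M2.\<Gamma> a (\<phi> y))"
    have transpose_sum: "transpose (\<Sum>a\<in>I. c a *\<^sub>R A a) = (\<Sum>a\<in>I. c a *\<^sub>R transpose (A a))"
      for c and A :: "'n \<Rightarrow> real^'n^'n" and I
      by (simp add: vec_eq_iff transpose_def)
    have "pd i (\<lambda>z. g2 (\<phi> z)) y = (\<Sum>a\<in>UNIV. T y $ a $ i *\<^sub>R pd a g2 (\<phi> y))"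
      by (rule pd_\<phi>[OF y M2.smooth_g])
    also have "\<dots> = transpose Y ** g2 (\<phi> y) + g2 (\<phi> y) ** Y"
      by (simp add: M2.pd_g \<phi>_U2 y Y_def transpose_sum matrix_sum_left matrix_sum_right matrix_distribs
          scaleR_add_right sum.distrib)
    finally have g2: "pd i (\<lambda>z. g2 (\<phi> z)) y = transpose Y ** g2 (\<phi> y) + g2 (\<phi> y) ** Y" .
    have TRW: "T y ** (R ** W i y) = W i y" by (simp add: matrix_mul_assoc TR)
    have d: "(\<lambda>z. g2 (\<phi> z)) differentiable (at y)" "T differentiable (at y)"
      "(\<lambda>z. transpose (T z)) differentiable (at y)"
      "(\<lambda>z. transpose (T z) ** g2 (\<phi> z)) differentiable (at y)"
    proof -
      show d: "(\<lambda>z. g2 (\<phi> z)) differentiable (at y)" "T differentiable (at y)"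
        by (rule differentiable_compose[OF y M2.smooth_g], rule differentiable_T[OF y])
      show d': "(\<lambda>z. transpose (T z)) differentiable (at y)"
        using bounded_linear.has_derivative[OF bounded_linear_transpose] d(2) unfolding differentiable_def by blast
      show "(\<lambda>z. transpose (T z) ** g2 (\<phi> z)) differentiable (at y)"
        using bounded_bilinear.FDERIV[OF bounded_bilinear_matrix_mult] d' d(1) unfolding differentiable_def by blast
    qed
    have "pd i g1 y = pd i (\<lambda>z. transpose (T z) ** g2 (\<phi> z) ** T z) y"
      by (rule pd_cong[OF open_V y g_\<phi>])
    also have "\<dots> = transpose (W i y) ** g2 (\<phi> y) ** T y + transpose (T y) ** g2 (\<phi> y) ** W i y"
      by (simp add: pd_mm[OF d(4,2)] pd_mm[OF d(3,1)] pd_transpose[OF d(2)] g2 W_def Y_def[symmetric]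
          matrix_distribs transpose_linear matrix_transpose_mul matrix_mul_assoc algebra_simps)
    also have "transpose (W i y) = transpose (R ** W i y) ** transpose (T y)"
      by (simp only: TRW flip: matrix_transpose_mul)
    also have "transpose (T y) ** g2 (\<phi> y) ** W i y = g1 y ** (R ** W i y)"
      by (simp add: g_\<phi>[OF y] TRW flip: matrix_mul_assoc)
    also have "transpose (R ** W i y) ** transpose (T y) ** g2 (\<phi> y) ** T y = transpose (R ** W i y) ** g1 y"
      by (simp add: g_\<phi>[OF y] matrix_mul_assoc)
    finally show "pd i g1 y = transpose (R ** W i y) ** g1 y + g1 y ** (R ** W i y)" .
  qed
  then show ?thesis by (simp add: matrix_mul_assoc TR)
qed

text \<open>The second derivatives of the transition map produced by the chain rule cancel against
  those contained in \<open>W\<close>.\<close>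

lemma hess_\<phi>:
  assumes y: "y \<in> V"
  shows "hess g1 F1 y = transpose (T y) ** hess g2 F2 (\<phi> y) ** T y"
proof (rule mat_eqI)
  fix i j
  have pdF: "pd k F1 z = (\<Sum>a\<in>UNIV. T z $ a $ k * pd a F2 (\<phi> z))" if "z \<in> V" for k z
  proof -
    have "pd k F1 z = pd k (\<lambda>z. F2 (\<phi> z)) z" by (rule pd_cong[OF open_V that F_\<phi>])
    then show ?thesis by (simp add: pd_\<phi>[OF that M2.smooth_F])
  qed
  have d: "(\<lambda>z. T z $ a $ k) differentiable (at y)" "(\<lambda>z. pd a F2 (\<phi> z)) differentiable (at y)" for a k
    by (intro smooth_on_imp_differentiable[OF _ y] smooth_on_linear[OF bounded_linear_vec_nth open_V] smooth_T)
      (intro differentiable_compose y smooth_on_pd M2.smooth_F)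
  have "pd i (pd j F1) y = pd i (\<lambda>z. \<Sum>a\<in>UNIV. T z $ a $ j * pd a F2 (\<phi> z)) y"
    by (rule pd_cong[OF open_V y pdF])
  also have "\<dots> = (\<Sum>a\<in>UNIV. pd i (\<lambda>z. T z $ a $ j * pd a F2 (\<phi> z)) y)"
    by (rule pd_sum) (intro differentiable_mult d)
  also have "\<dots> = (\<Sum>a\<in>UNIV. T y $ a $ j * (\<Sum>b\<in>UNIV. T y $ b $ i * pd b (pd a F2) (\<phi> y)) + pd i T y $ a $ j * pd a F2 (\<phi> y))"
    by (simp add: pd_mult[OF d] pd_\<phi>[OF y smooth_on_pd[OF M2.smooth_F]] pd_nth2[OF differentiable_T[OF y]])
  finally have 1: "pd i (pd j F1) y = (\<Sum>a\<in>UNIV. \<Sum>b\<in>UNIV. T y $ b $ i * pd b (pd a F2) (\<phi> y) * T y $ a $ j)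
      + (\<Sum>a\<in>UNIV. pd i T y $ a $ j * pd a F2 (\<phi> y))"
    by (simp add: sum.distrib sum_distrib_left mult_ac)
  have "(\<Sum>k\<in>UNIV. M1.\<Gamma> i y $ k $ j * pd k F1 y)
      = (\<Sum>k\<in>UNIV. \<Sum>a\<in>UNIV. T y $ a $ k * M1.\<Gamma> i y $ k $ j * pd a F2 (\<phi> y))"
    by (simp add: pdF[OF y] sum_distrib_left mult_ac)
  also have "\<dots> = (\<Sum>a\<in>UNIV. (T y ** M1.\<Gamma> i y) $ a $ j * pd a F2 (\<phi> y))"
    by (subst sum.swap) (simp add: matrix_mult_nth sum_distrib_right)
  finally have 2: "(\<Sum>k\<in>UNIV. M1.\<Gamma> i y $ k $ j * pd k F1 y) = (\<Sum>a\<in>UNIV. pd i T y $ a $ j * pd a F2 (\<phi> y))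
      + (\<Sum>a\<in>UNIV. (\<Sum>b\<in>UNIV. \<Sum>c\<in>UNIV. T y $ b $ i * M2.\<Gamma> b (\<phi> y) $ a $ c * T y $ c $ j) * pd a F2 (\<phi> y))"
    by (simp add: T_\<Gamma>[OF y] W_nth distrib_right sum.distrib)
  have "(\<Sum>a\<in>UNIV. (\<Sum>b\<in>UNIV. \<Sum>c\<in>UNIV. T y $ b $ i * M2.\<Gamma> b (\<phi> y) $ a $ c * T y $ c $ j) * pd a F2 (\<phi> y))
      = (\<Sum>a\<in>UNIV. \<Sum>b\<in>UNIV. \<Sum>c\<in>UNIV. T y $ b $ i * (M2.\<Gamma> b (\<phi> y) $ a $ c * pd a F2 (\<phi> y)) * T y $ c $ j)"
    by (simp add: sum_distrib_left mult_ac)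
  also have "\<dots> = (\<Sum>b\<in>UNIV. \<Sum>a\<in>UNIV. \<Sum>c\<in>UNIV. T y $ b $ i * (M2.\<Gamma> b (\<phi> y) $ a $ c * pd a F2 (\<phi> y)) * T y $ c $ j)"
    by (rule sum.swap)
  also have "\<dots> = (\<Sum>b\<in>UNIV. \<Sum>c\<in>UNIV. \<Sum>a\<in>UNIV. T y $ b $ i * (M2.\<Gamma> b (\<phi> y) $ a $ c * pd a F2 (\<phi> y)) * T y $ c $ j)"
    by (rule sum.cong[OF refl]) (rule sum.swap)
  also have "\<dots> = (\<Sum>c\<in>UNIV. \<Sum>b\<in>UNIV. T y $ b $ i * (\<Sum>a\<in>UNIV. M2.\<Gamma> b (\<phi> y) $ a $ c * pd a F2 (\<phi> y)) * T y $ c $ j)"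
    by (subst sum.swap) (simp add: sum_distrib_left sum_distrib_right)
  finally have 3: "(\<Sum>a\<in>UNIV. (\<Sum>b\<in>UNIV. \<Sum>c\<in>UNIV. T y $ b $ i * M2.\<Gamma> b (\<phi> y) $ a $ c * T y $ c $ j) * pd a F2 (\<phi> y))
      = (\<Sum>c\<in>UNIV. \<Sum>b\<in>UNIV. T y $ b $ i * (\<Sum>a\<in>UNIV. M2.\<Gamma> b (\<phi> y) $ a $ c * pd a F2 (\<phi> y)) * T y $ c $ j)" .
  have h1: "hess g1 F1 y $ i $ j = pd i (pd j F1) y - (\<Sum>k\<in>UNIV. M1.\<Gamma> i y $ k $ j * pd k F1 y)"
    by (simp add: hess_def partial_eq_pd M1.\<Gamma>_def)
  have h2: "hess g2 F2 (\<phi> y) $ b $ a = pd b (pd a F2) (\<phi> y) - (\<Sum>k\<in>UNIV. M2.\<Gamma> b (\<phi> y) $ k $ a * pd k F2 (\<phi> y))" for a b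
    by (simp add: hess_def partial_eq_pd M2.\<Gamma>_def)
  have "(transpose (T y) ** hess g2 F2 (\<phi> y) ** T y) $ i $ j
      = (\<Sum>a\<in>UNIV. \<Sum>b\<in>UNIV. T y $ b $ i * hess g2 F2 (\<phi> y) $ b $ a * T y $ a $ j)"
    by (simp add: matrix_mult_nth transpose_def sum_distrib_right)
  also have "\<dots> = hess g1 F1 y $ i $ j"
    unfolding h1 1 2 3 h2 by (simp add: left_diff_distrib right_diff_distrib sum_subtractf)
  finally show "hess g1 F1 y $ i $ j = (transpose (T y) ** hess g2 F2 (\<phi> y) ** T y) $ i $ j" ..
qed

lemma scal_\<phi>:
  assumes y: "y \<in> V"
  shows "scal g1 y = scal g2 (\<phi> y)"
proof -
  have y1: "y \<in> U1" and y2: "\<phi> y \<in> U2" using y V_U1 \<phi>_U2 by auto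
  have lap1: "scal g1 y = lam * real CARD('n) - trace (M1.q y ** hess g1 F1 y)"
  proof -
    have "ricci g1 y = lam *\<^sub>R g1 y - hess g1 F1 y" using M1.soliton[OF y1] by (simp add: algebra_simps)
    then have "M1.\<rho> y = lam *\<^sub>R mat 1 - M1.q y ** hess g1 F1 y"
      by (simp add: M1.\<rho>_def matrix_distribs M1.q_g[OF y1])
    then show ?thesis
      by (simp add: M1.scal_eq_trace[OF y1] trace_sub) (simp add: trace_def mat_def)
  qed
  have lap2: "scal g2 (\<phi> y) = lam * real CARD('n) - trace (M2.q (\<phi> y) ** hess g2 F2 (\<phi> y))"
  proof -
    have "ricci g2 (\<phi> y) = lam *\<^sub>R g2 (\<phi> y) - hess g2 F2 (\<phi> y)" using M2.soliton[OF y2] by (simp add: algebra_simps)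
    then have "M2.\<rho> (\<phi> y) = lam *\<^sub>R mat 1 - M2.q (\<phi> y) ** hess g2 F2 (\<phi> y)"
      by (simp add: M2.\<rho>_def matrix_distribs M2.q_g[OF y2])
    then show ?thesis
      by (simp add: M2.scal_eq_trace[OF y2] trace_sub) (simp add: trace_def mat_def)
  qed
  define R where "R = matrix_inv (T y)"
  have TR: "T y ** R = mat 1"
    using matrix_inv_inverse(1)[OF invertible_T[OF y]] by (simp add: R_def)
  \<comment> \<open>The inverse metric pushed forward by \<open>T\<close>; it is recognised as that
    of the second chart by being a left inverse of \<open>g2\<close>.\<close>
  define Z where "Z = T y ** M1.q y ** transpose (T y)"
  have "Z ** g2 (\<phi> y) ** T y = T y"
    using M1.q_g[OF y1] unfolding g_\<phi>[OF y] Z_def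
    by (metis g_\<phi>[OF y] matrix_mul_assoc matrix_mul_rid)
  then have "Z ** g2 (\<phi> y) ** (T y ** R) = T y ** R" by (simp add: matrix_mul_assoc)
  then have "Z ** g2 (\<phi> y) = mat 1" by (simp add: TR)
  then have "Z ** (g2 (\<phi> y) ** M2.q (\<phi> y)) = M2.q (\<phi> y)" by (simp add: matrix_mul_assoc)
  then have Z: "Z = M2.q (\<phi> y)" by (simp add: M2.g_q[OF y2])
  have "trace (M1.q y ** hess g1 F1 y) = trace ((M1.q y ** transpose (T y) ** hess g2 F2 (\<phi> y)) ** T y)"
    by (simp add: hess_\<phi>[OF y] matrix_mul_assoc)
  also have "\<dots> = trace (T y ** (M1.q y ** transpose (T y) ** hess g2 F2 (\<phi> y)))" by (rule trace_mul_sym)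
  also have "\<dots> = trace (M2.q (\<phi> y) ** hess g2 F2 (\<phi> y))" by (simp add: Z_def matrix_mul_assoc flip: Z)
  finally show ?thesis by (simp add: lap1 lap2)
qed

end

section \<open>Globalisation\<close>

lemma chart_inv_chart: "is_chart M c \<Longrightarrow> p \<in> fst c \<Longrightarrow> chart_inv c (snd c p) = p"
proof -
  assume c: "is_chart M c" and p: "p \<in> fst c"
  have "topspace (subtopology M (fst c)) = fst c"
    using c by (auto simp: is_chart_def dest: openin_subset)
  then have "inj_on (snd c) (fst c)"
    using c homeomorphic_map_maps unfolding is_chart_def by (metis homeomorphic_imp_injective_map)
  then show ?thesis using p by (simp add: chart_inv_def)
qed

text \<open>\<open>level\<close> holds for an arbitrary predicate, so one argument shows both a
  level set and its complement to be open.\<close>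

lemma connected_locally_constant:
  assumes "connected_space X"
    and loc: "\<And>p. p \<in> topspace X \<Longrightarrow> \<exists>W. openin X W \<and> p \<in> W \<and> (\<forall>r\<in>W. s r = s p)"
  shows "\<exists>k. \<forall>p\<in>topspace X. s p = k"
proof (cases "topspace X = {}")
  case False
  then obtain p0 where p0: "p0 \<in> topspace X" by blast
  define A where "A = {p \<in> topspace X. s p = s p0}"
  define C where "C = {p \<in> topspace X. s p \<noteq> s p0}"
  have level: "openin X {p \<in> topspace X. Q (s p)}" for Q
  proof (subst openin_subopen, intro ballI)
    fix p assume p: "p \<in> {p \<in> topspace X. Q (s p)}"
    then obtain W where W: "openin X W" "p \<in> W" "\<forall>r\<in>W. s r = s p" using loc by blast
    have "W \<subseteq> {p \<in> topspace X. Q (s p)}"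
    proof
      fix r assume r: "r \<in> W"
      then have "s r = s p" "r \<in> topspace X" using W openin_subset by blast+
      then show "r \<in> {p \<in> topspace X. Q (s p)}" using p by simp
    qed
    then show "\<exists>W. openin X W \<and> p \<in> W \<and> W \<subseteq> {p \<in> topspace X. Q (s p)}" using W by blast
  qed
  have "openin X A" "openin X C" unfolding A_def C_def by (rule level)+
  moreover have "topspace X \<subseteq> A \<union> C" "A \<inter> C = {}" "A \<noteq> {}" using p0 by (auto simp: A_def C_def)
  ultimately have "C = {}" using assms(1) unfolding connected_space_def by blast
  then show ?thesis unfolding C_def by blast
qed simp

locale soliton_manifold =
  fixes M :: "'a topology" and \<A> :: "('a, 'n::finite) chart set"
    and g :: "('a, 'n) chart \<Rightarrow> real ^ 'n \<Rightarrow> real ^ 'n ^ 'n" and f :: "'a \<Rightarrow> real" and lam :: real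
  assumes manifold: "smooth_manifold M \<A>" and metric: "riemannian_metric \<A> g"
    and potential: "smooth_function \<A> f" and soliton: "gradient_ricci_soliton \<A> g f lam"
begin

lemma chart: "c \<in> \<A> \<Longrightarrow> is_chart M c"
  using manifold by (simp add: smooth_manifold_def)

lemma local_soliton: "c \<in> \<A> \<Longrightarrow> chart_soliton (chart_image c) (g c) (f \<circ> chart_inv c) lam"
  using chart[of c] metric potential soliton
  by unfold_locales
    (auto simp: is_chart_def riemannian_metric_def smooth_function_def gradient_ricci_soliton_def in_charts_def)

lemma scal_chart_independent:
  assumes c: "c \<in> \<A>" and d: "d \<in> \<A>" and p: "p \<in> fst c" "p \<in> fst d"
  shows "scal (g c) (snd c p) = scal (g d) (snd d p)"
proof -
  define V where "V = snd c ` (fst c \<inter> fst d)"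
  define \<phi> where "\<phi> = transition c d"
  define T where "T y = (\<chi> a i. pd i \<phi> y $ a)" for y
  have \<phi>: "\<phi> (snd c r) = snd d r" if "r \<in> fst c" for r
    using chart_inv_chart[OF chart[OF c] that] by (simp add: \<phi>_def transition_def)
  have sm: "smooth_on \<phi> V"
    using manifold c d by (simp add: smooth_manifold_def \<phi>_def V_def)
  have "open V"
  proof -
    have oc: "openin M (fst c)" "openin M (fst d)" "open (chart_image c)"
      and hom: "homeomorphic_map (subtopology M (fst c)) (top_of_set (chart_image c)) (snd c)"
      using chart[OF c] chart[OF d] by (auto simp: is_chart_def)
    have "openin (subtopology M (fst c)) (fst c \<inter> fst d)"
      using oc by (auto simp: openin_subtopology)
    then have "openin (top_of_set (chart_image c)) V"
      using homeomorphic_imp_open_map[OF hom] by (simp add: open_map_def V_def)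
    then show ?thesis using oc openin_open_eq by blast
  qed
  interpret chart_change "chart_image c" "chart_image d" "g c" "g d" "f \<circ> chart_inv c" "f \<circ> chart_inv d" lam V \<phi> T
  proof (intro chart_change.intro local_soliton c d chart_change_axioms.intro \<open>open V\<close> sm)
    show "V \<subseteq> chart_image c" by (auto simp: V_def chart_image_def)
    show "\<phi> y \<in> chart_image d" if "y \<in> V" for y
      using that \<phi> by (auto simp: V_def chart_image_def)
    show "T y = (\<chi> a i. pd i \<phi> y $ a)" for y by (rule T_def)
    show "(f \<circ> chart_inv c) y = (f \<circ> chart_inv d) (\<phi> y)" if "y \<in> V" for y
      using that by (auto simp: V_def \<phi> chart_inv_chart[OF chart[OF c]] chart_inv_chart[OF chart[OF d]])
    show "g c y = transpose (T y) ** g d (\<phi> y) ** T y" if y: "y \<in> V" for y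
    proof -
      obtain r where r: "r \<in> fst c" "r \<in> fst d" "y = snd c r" using y by (auto simp: V_def)
      have Tv: "frechet_derivative \<phi> (at y) v = T y *v v" for v
        by (rule vec_eqI) (simp add: frechet_derivative_eq_sum_pd[OF smooth_on_imp_differentiable[OF sm y]]
            T_def matrix_vector_mult_def mult.commute)
      have "\<forall>u v. u \<bullet> (g c (snd c r) *v v) = frechet_derivative (transition c d) (at (snd c r)) u \<bullet>
          (g d (snd d r) *v frechet_derivative (transition c d) (at (snd c r)) v)"
        using metric c d r(1,2) unfolding riemannian_metric_def Let_def by blast
      then have *: "u \<bullet> (g c y *v v) = (T y *v u) \<bullet> (g d (\<phi> y) *v (T y *v v))" for u v
        using Tv \<phi>[OF r(1)] r(3) by (simp add: \<phi>_def)
      have "u \<bullet> (g c y *v v) = u \<bullet> ((transpose (T y) ** g d (\<phi> y) ** T y) *v v)" for u v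
        using inner_transpose[of u "transpose (T y)" "g d (\<phi> y) *v (T y *v v)"]
        by (simp only: * transpose_transpose matrix_vector_mul_assoc matrix_mul_assoc)
      then have "g c y *v v = (transpose (T y) ** g d (\<phi> y) ** T y) *v v" for v
        by (rule iffD1[OF vector_eq_ldot, OF allI])
      then show ?thesis by (rule iffD2[OF matrix_eq, OF allI])
    qed
  qed
  show ?thesis using scal_\<phi>[of "snd c p"] p \<phi> by (simp add: V_def)
qed

lemma constant_scalar_curvature_if_locally:
  assumes conn: "connected_space M"
    and loc: "\<And>c x j. c \<in> \<A> \<Longrightarrow> x \<in> chart_image c \<Longrightarrow> pd j (scal (g c)) x = 0"
  shows "constant_scalar_curvature \<A> g"
proof -
  \<comment> \<open>A chart is picked at each point to make \<open>scal\<close> a function on the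
    manifold; \<open>scal_chart_independent\<close> removes the dependence on the choice.\<close>
  define s where "s p = (let c = SOME c. c \<in> \<A> \<and> p \<in> fst c in scal (g c) (snd c p))" for p
  have s: "s p = scal (g c) (snd c p)" if "c \<in> \<A>" "p \<in> fst c" for c p
    unfolding s_def Let_def
    using someI[of "\<lambda>c. c \<in> \<A> \<and> p \<in> fst c" c] that scal_chart_independent by blast
  have "\<exists>k. \<forall>p\<in>topspace M. s p = k"
  proof (rule connected_locally_constant[OF conn])
    fix p assume "p \<in> topspace M"
    then have "p \<in> (\<Union>c\<in>\<A>. fst c)" using manifold by (simp add: smooth_manifold_def)
    then obtain c where c: "c \<in> \<A>" "p \<in> fst c" by blast
    interpret chart_soliton "chart_image c" "g c" "f \<circ> chart_inv c" lam by (rule local_soliton[OF c(1)])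
    have hom: "homeomorphic_map (subtopology M (fst c)) (top_of_set (chart_image c)) (snd c)"
      and oc: "openin M (fst c)" using chart[OF c(1)] by (auto simp: is_chart_def)
    have "snd c p \<in> chart_image c" using c by (auto simp: chart_image_def)
    then obtain r where r: "r > 0" "ball (snd c p) r \<subseteq> chart_image c"
      using open_U openE by blast
    define W where "W = {y \<in> fst c. snd c y \<in> ball (snd c p) r}"
    have tc: "topspace (subtopology M (fst c)) = fst c" using openin_subset[OF oc] by auto
    have "continuous_map (subtopology M (fst c)) euclidean (snd c)"
      using homeomorphic_imp_continuous_map[OF hom] continuous_map_into_fulltopology by blast
    from openin_continuous_map_preimage[OF this iffD1[OF open_openin open_ball[of "snd c p" r]]]
    have "openin (subtopology M (fst c)) W" unfolding W_def tc .
    then have "openin M W" using oc openin_trans_full by blast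
    moreover have "p \<in> W" using c r by (simp add: W_def)
    moreover have "s y = s p" if "y \<in> W" for y
    proof -
      have "(scal (g c) has_derivative (\<lambda>_. 0)) (at x within ball (snd c p) r)" if "x \<in> ball (snd c p) r" for x
      proof -
        have x: "x \<in> chart_image c" using that r by blast
        have sm: "smooth_on (scal (g c)) (chart_image c)"
          by (rule smooth_on_cong[OF open_U scal_eq_trace[symmetric]]) (simp_all add: smooth_simps smooth_\<rho>)
        have diff: "scal (g c) differentiable (at x)" by (rule smooth_on_imp_differentiable[OF sm x])
        then have "frechet_derivative (scal (g c)) (at x) = (\<lambda>_. 0)"
          by (simp add: fun_eq_iff frechet_derivative_eq_sum_pd loc[OF c(1) x])
        then show ?thesis
          using diff frechet_derivative_works has_derivative_at_withinI by metis
      qed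
      then have "\<exists>k. \<forall>x\<in>ball (snd c p) r. scal (g c) x = k"
        by (intro has_derivative_zero_constant convex_ball)
      then have "scal (g c) (snd c y) = scal (g c) (snd c p)"
        using that r by (metis (mono_tags, lifting) W_def centre_in_ball mem_Collect_eq)
      then show ?thesis using that c s by (simp add: W_def)
    qed
    ultimately show "\<exists>W. openin M W \<and> p \<in> W \<and> (\<forall>r\<in>W. s r = s p)" by blast
  qed
  then obtain k where k: "\<And>p. p \<in> topspace M \<Longrightarrow> s p = k" by blast
  have "scal (g c) x = k" if "c \<in> \<A>" "x \<in> chart_image c" for c x
  proof -
    obtain p where p: "p \<in> fst c" "x = snd c p" using \<open>x \<in> chart_image c\<close> by (auto simp: chart_image_def)
    moreover have "p \<in> topspace M" using manifold that p by (auto simp: smooth_manifold_def)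
    ultimately show ?thesis using s[OF that(1) p(1)] k[of p] by simp
  qed
  then show ?thesis
    unfolding constant_scalar_curvature_def in_charts_def by (intro exI[of _ k] ballI)
qed

lemma constant_scalar_curvature_if_ric_grad:
  assumes "connected_space M"
    and "\<And>c x. c \<in> \<A> \<Longrightarrow> x \<in> chart_image c \<Longrightarrow> ricci (g c) x *v grad (g c) (f \<circ> chart_inv c) x = 0"
  shows "constant_scalar_curvature \<A> g"
proof (rule constant_scalar_curvature_if_locally[OF assms(1)])
  fix c x j assume c: "c \<in> \<A>" and x: "x \<in> chart_image c"
  interpret chart_soliton "chart_image c" "g c" "f \<circ> chart_inv c" lam by (rule local_soliton[OF c])
  show "pd j (scal (g c)) x = 0" by (simp add: pd_scal_soliton[OF x] assms(2)[OF c x])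
qed

lemma ric_grad_if_constant_scal:
  assumes "constant_scalar_curvature \<A> g" "c \<in> \<A>" "x \<in> chart_image c"
  shows "ricci (g c) x *v grad (g c) (f \<circ> chart_inv c) x = 0"
proof -
  interpret chart_soliton "chart_image c" "g c" "f \<circ> chart_inv c" lam by (rule local_soliton[OF assms(2)])
  obtain s where "\<And>y. y \<in> chart_image c \<Longrightarrow> scal (g c) y = s"
    using assms unfolding constant_scalar_curvature_def in_charts_def by blast
  then show ?thesis by (rule ric_N_zero_if_scal_constant[OF assms(3)])
qed

end

theorem proposition1:
  fixes M :: "'a topology"
    and \<A> :: "('a, 'n::finite) chart set"
    and g :: "('a, 'n) chart \<Rightarrow> real ^ 'n \<Rightarrow> real ^ 'n ^ 'n"
    and f :: "'a \<Rightarrow> real"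
    and lam :: real
  assumes "smooth_manifold M \<A>"
    and "connected_space M"
    and "riemannian_metric \<A> g"
    and "smooth_function \<A> f"
    and "lam \<noteq> 0"
    and "gradient_ricci_soliton \<A> g f lam"
  shows
    "(constant_scalar_curvature \<A> g \<and>
        (lam > 0 \<longrightarrow> radial_sec_nonneg \<A> g f) \<and>
        (lam < 0 \<longrightarrow> radial_sec_nonpos \<A> g f)
      \<longrightarrow> radially_flat \<A> g f \<and> constant_scalar_curvature \<A> g) \<and>
     (constant_scalar_curvature \<A> g \<and>
        (lam > 0 \<longrightarrow> in_charts \<A> (\<lambda>c x. form_le 0 (ricci (g c) x) \<and>
                                       form_le (ricci (g c) x) (lam *\<^sub>R g c x))) \<and>
        (lam < 0 \<longrightarrow> in_charts \<A> (\<lambda>c x. form_le (lam *\<^sub>R g c x) (ricci (g c) x) \<and>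
                                       form_le (ricci (g c) x) 0))
      \<longrightarrow> radially_flat \<A> g f \<and> constant_scalar_curvature \<A> g) \<and>
     (harmonic_curvature \<A> g
      \<longrightarrow> radially_flat \<A> g f \<and> constant_scalar_curvature \<A> g) \<and>
     (radially_flat \<A> g f \<and>
        (lam > 0 \<longrightarrow> in_charts \<A> (\<lambda>c x. form_le 0 (ricci (g c) x))) \<and>
        (lam < 0 \<longrightarrow> in_charts \<A> (\<lambda>c x. form_le (ricci (g c) x) 0))
      \<longrightarrow> radially_flat \<A> g f \<and> constant_scalar_curvature \<A> g)"
\<comment> \<open>Conclusions that repeat a hypothesis of their own case, such as constant scalar
  curvature in (1) and (2), are closed by assumption at the end.\<close>
proof (intro conjI impI; (elim conjE)?)
  interpret soliton_manifold M \<A> g f lam using assms by unfold_locales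
  note flatI = radially_flat_def[of \<A> g f, unfolded in_charts_def, THEN iffD2, rule_format]
  {
    assume s: "constant_scalar_curvature \<A> g"
      and sec: "lam > 0 \<longrightarrow> radial_sec_nonneg \<A> g f" "lam < 0 \<longrightarrow> radial_sec_nonpos \<A> g f"
    show "radially_flat \<A> g f"
    proof (rule flatI)
      fix c x E assume c: "c \<in> \<A>" and x: "x \<in> chart_image c"
      interpret chart_soliton "chart_image c" "g c" "f \<circ> chart_inv c" lam by (rule local_soliton[OF c])
      note r = ric_grad_if_constant_scal[OF s c x]
      show "radial_sec (g c) (f \<circ> chart_inv c) E x = 0"
      proof (cases "lam > 0")
        case True
        then show ?thesis using sec c x r
          by (intro radial_flat_if_nonneg[OF x]) (auto simp: radial_sec_nonneg_def in_charts_def)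
      next
        case False
        then show ?thesis using sec c x r \<open>lam \<noteq> 0\<close>
          by (intro radial_flat_if_nonpos[OF x]) (auto simp: radial_sec_nonpos_def in_charts_def)
      qed
    qed
  next
    assume s: "constant_scalar_curvature \<A> g"
      and bounds: "lam > 0 \<longrightarrow> in_charts \<A> (\<lambda>c x. form_le 0 (ricci (g c) x) \<and> form_le (ricci (g c) x) (lam *\<^sub>R g c x))"
        "lam < 0 \<longrightarrow> in_charts \<A> (\<lambda>c x. form_le (lam *\<^sub>R g c x) (ricci (g c) x) \<and> form_le (ricci (g c) x) 0)"
    show "radially_flat \<A> g f"
    proof (rule flatI)
      fix c x E assume c: "c \<in> \<A>" and x: "x \<in> chart_image c"
      interpret chart_soliton "chart_image c" "g c" "f \<circ> chart_inv c" lam by (rule local_soliton[OF c])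
      interpret chart_soliton_split "chart_image c" "g c" "f \<circ> chart_inv c" lam
      proof
        show "lam \<noteq> 0" by fact
        show r: "ricci (g c) y *v grad (g c) (f \<circ> chart_inv c) y = 0" if "y \<in> chart_image c" for y
          by (rule ric_grad_if_constant_scal[OF s c that])
        show "\<rho> y ** \<rho> y = lam *\<^sub>R \<rho> y" if y: "y \<in> chart_image c" for y
          using bounds c y \<open>lam \<noteq> 0\<close> unfolding in_charts_def
          by (intro \<rho>_\<rho>_if_bounds[OF r]) (auto simp: neq_iff)
      qed
      show "radial_sec (g c) (f \<circ> chart_inv c) E x = 0" by (rule radially_flat_split[OF x])
    qed
  next
    assume "harmonic_curvature \<A> g"
    then have h: "\<And>c x l j k. c \<in> \<A> \<Longrightarrow> x \<in> chart_image c \<Longrightarrow> curvature_codiff (g c) l j k x = 0"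
      unfolding harmonic_curvature_def in_charts_def by blast
    show "radially_flat \<A> g f"
    proof (rule flatI)
      fix c x E assume c: "c \<in> \<A>" and x: "x \<in> chart_image c"
      interpret chart_soliton "chart_image c" "g c" "f \<circ> chart_inv c" lam by (rule local_soliton[OF c])
      show "radial_sec (g c) (f \<circ> chart_inv c) E x = 0"
        by (rule harmonic_consequences(1)[OF x h[OF c x]])
    qed
    show "constant_scalar_curvature \<A> g"
    proof (rule constant_scalar_curvature_if_ric_grad[OF \<open>connected_space M\<close>])
      fix c x assume c: "c \<in> \<A>" and x: "x \<in> chart_image c"
      interpret chart_soliton "chart_image c" "g c" "f \<circ> chart_inv c" lam by (rule local_soliton[OF c])
      show "ricci (g c) x *v grad (g c) (f \<circ> chart_inv c) x = 0"
        by (rule harmonic_consequences(2)[OF x h[OF c x]])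
    qed
  next
    assume flat: "radially_flat \<A> g f"
      and bounds: "lam > 0 \<longrightarrow> in_charts \<A> (\<lambda>c x. form_le 0 (ricci (g c) x))"
        "lam < 0 \<longrightarrow> in_charts \<A> (\<lambda>c x. form_le (ricci (g c) x) 0)"
    show "constant_scalar_curvature \<A> g"
    proof (rule constant_scalar_curvature_if_ric_grad[OF \<open>connected_space M\<close>])
      fix c x assume c: "c \<in> \<A>" and x: "x \<in> chart_image c"
      interpret chart_soliton "chart_image c" "g c" "f \<circ> chart_inv c" lam by (rule local_soliton[OF c])
      show "ricci (g c) x *v grad (g c) (f \<circ> chart_inv c) x = 0"
        using flat bounds c x \<open>lam \<noteq> 0\<close>
        by (intro ric_N_zero_if_radially_flat[OF x])
          (auto simp: radially_flat_def in_charts_def form_le_def neq_iff)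
    qed
  }
qed

end
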